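(* Let $W:\mathbb{R}^2\to[0,\infty)$ be a smooth function vanishing at exactly two points $\mathbf{p}_-$ and $\mathbf{p}_+$, with positive definite Hessians $D^2W(\mathbf{p}_\pm)>0$ and $\liminf_{|p|\to\infty}W(p)>0$, and let $F:=\sqrt{W}$. Let $\gamma_0:[0,1]\to\mathbb{R}^2$ be an unconstrained minimizing geodesic joining $\mathbf{p}_-$ to $\mathbf{p}_+$, i.e. a minimizer of $E$ among all locally Lipschitz continuous planar curves starting at $\mathbf{p}_-$ and ending at $\mathbf{p}_+$. Then there exists a number $\varepsilon_0>0$ such that for every $A\in\big(\mathcal{A}(\gamma_0)-\varepsilon_0,\ \mathcal{A}(\gamma_0)+\varepsilon_0\big)$ there exists a minimizer of the problem $$m_A:=\inf\left\{E(\gamma):\ \gamma:[a,b]\to\mathbb{R}^2\ \text{locally Lipschitz continuous},\ \gamma(a)=\mathbf{p}_-,\ \gamma(b)=\mathbf{p}_+,\ \mathcal{A}(\gamma)=A\right\}.$$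
   Context: For a locally Lipschitz continuous curve $\gamma=(\gamma^{(1)},\gamma^{(2)}):[a,b]\to\mathbb{R}^2$, $$E(\gamma):=\int_a^bF(\gamma(t))\,|\gamma'(t)|\,dt,\qquad \mathcal{A}(\gamma):=\int_a^b\gamma^{(1)}(t)\,\gamma^{(2)\prime}(t)\,dt=\int_\gamma p_1\,dp_2 .$$ *)

theory Defs
  imports "HOL-Analysis.Analysis"
begin

text \<open>All iterated directional derivatives up to order \<open>k\<close> exist everywhere, and those of
  order \<open>k\<close> are continuous.\<close>

fun times_cont_diff :: "nat \<Rightarrow> ('a::euclidean_space \<Rightarrow> real) \<Rightarrow> bool" where
  "times_cont_diff 0 f \<longleftrightarrow> continuous_on UNIV f"
| "times_cont_diff (Suc k) f \<longleftrightarrow> (\<forall>x. f differentiable (at x)) \<and>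
     (\<forall>v. times_cont_diff k (\<lambda>x. frechet_derivative f (at x) v))"

definition smooth :: "('a::euclidean_space \<Rightarrow> real) \<Rightarrow> bool" where
  "smooth f \<longleftrightarrow> (\<forall>k. times_cont_diff k f)"

definition partial_deriv :: "'n \<Rightarrow> (real ^ 'n \<Rightarrow> real) \<Rightarrow> real ^ 'n \<Rightarrow> real" where
  "partial_deriv i f x = frechet_derivative f (at x) (axis i 1)"

definition hessian :: "(real ^ 'n \<Rightarrow> real) \<Rightarrow> real ^ 'n \<Rightarrow> real ^ 'n ^ 'n" where
  "hessian f x = (\<chi> i j. partial_deriv i (partial_deriv j f) x)"

definition positive_definite :: "real ^ 'n ^ 'n \<Rightarrow> bool" where
  "positive_definite H \<longleftrightarrow> transpose H = H \<and> (\<forall>v. v \<noteq> 0 \<longrightarrow> v \<bullet> (H *v v) > 0)"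

definition locally_lipschitz_on :: "real set \<Rightarrow> (real \<Rightarrow> 'a::metric_space) \<Rightarrow> bool" where
  "locally_lipschitz_on S \<gamma> \<longleftrightarrow>
     (\<forall>t\<in>S. \<exists>u>0. \<exists>L. L-lipschitz_on (cball t u \<inter> S) \<gamma>)"

text \<open>A curve on \<open>[a, b]\<close> is a function on \<open>\<real>\<close> of which only the values on \<open>{a..b}\<close> matter;
  hence the one-sided derivatives at the endpoints below. A locally Lipschitz curve is
  differentiable almost everywhere; the values of \<^const>\<open>vector_derivative\<close> on the
  exceptional null set do not affect the integrals.\<close>

definition energy ::
    "(real ^ 2 \<Rightarrow> real) \<Rightarrow> real \<Rightarrow> real \<Rightarrow> (real \<Rightarrow> real ^ 2) \<Rightarrow> real" where
  "energy F a b \<gamma> =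
     integral {a..b} (\<lambda>t. F (\<gamma> t) * norm (vector_derivative \<gamma> (at t within {a..b})))"

definition area :: "real \<Rightarrow> real \<Rightarrow> (real \<Rightarrow> real ^ 2) \<Rightarrow> real" where
  "area a b \<gamma> =
     integral {a..b} (\<lambda>t. \<gamma> t $ 1 * vector_derivative \<gamma> (at t within {a..b}) $ 2)"

definition joins ::
    "real ^ 2 \<Rightarrow> real ^ 2 \<Rightarrow> real \<Rightarrow> real \<Rightarrow> (real \<Rightarrow> real ^ 2) \<Rightarrow> bool" where
  "joins p q a b \<gamma> \<longleftrightarrow> a < b \<and> locally_lipschitz_on {a..b} \<gamma> \<and> \<gamma> a = p \<and> \<gamma> b = q"

definition minimizing_geodesic ::
    "(real ^ 2 \<Rightarrow> real) \<Rightarrow> real ^ 2 \<Rightarrow> real ^ 2 \<Rightarrow> real \<Rightarrow> real \<Rightarrow> (real \<Rightarrow> real ^ 2) \<Rightarrow> bool" where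
  "minimizing_geodesic F p q a b \<gamma> \<longleftrightarrow> joins p q a b \<gamma> \<and>
     (\<forall>a' b' \<eta>. joins p q a' b' \<eta> \<longrightarrow> energy F a b \<gamma> \<le> energy F a' b' \<eta>)"

definition min_energy ::
    "(real ^ 2 \<Rightarrow> real) \<Rightarrow> real ^ 2 \<Rightarrow> real ^ 2 \<Rightarrow> real \<Rightarrow> real" where
  "min_energy F p q A = Inf {energy F a b \<gamma> | a b \<gamma>. joins p q a b \<gamma> \<and> area a b \<gamma> = A}"

end

theory Submission
  imports Defs "HOL-Complex_Analysis.Great_Picard"
begin

text \<open>
  The difficulty is that \<open>F\<close> vanishes at the wells. A minimizing sequence for the constrained problem may
  wind around a well more and more often at smaller and smaller distance. Energy and area of a loop
  of radius \<open>\<rho>\<close> are both of order \<open>\<rho>\<^sup>2\<close>, so such a sequence may generate area in the limit point,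
  and its length need not stay bounded. For areas close to that of the geodesic this is excluded by
  comparing two rates.

  \<^item> Near a well, area has a price. Since the Hessian is positive definite, \<open>F\<close> is comparable to the
    distance from the well. If a curve spends much more than \<open>\<rho>\<^sup>2\<close> before it is at distance
    \<open>\<rho>\<close>, then replacing this piece by a segment saves an energy of at least \<open>\<kappa>\<close> times the resulting change
    of area, with a fixed \<open>\<kappa> > 0\<close>. A curve for which no such replacement is profitable has a length that is
    bounded by its energy (\<open>straighten_start\<close>, \<open>cutoff_energy_bound\<close>).

  \<^item> Away from the wells, area is almost free for a curve with nearly minimal energy. Shears
    supported in a strip between the wells change the area of every curve by the same amount
    \<open>t c\<close>, and change the energy by a function of \<open>t\<close> that is semiconcave at zero
    (\<open>shear_family\<close>). The sheared curves have at least the energy of the geodesic. So the energy can grow in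
    neither direction at a rate above a constant that tends to zero with the energy excess.

  Shears of the geodesic itself show that the constrained infimum is close to the energy of the geodesic if the
  prescribed area is close to its area. Then all curves of a minimizing sequence are nearly minimal, and
  can be straightened at both wells; a shear restores the area and costs at most what
  straightening has saved. This gives a minimizing sequence of bounded length with the prescribed area. It is
  reparametrized by arc length, and its limit is the minimizer: area is continuous and energy is lower
  semicontinuous under uniform convergence with bounded length
  (\<open>bounded_length_curves_limit\<close>).

  Underlying all this is the calculus of Lipschitz functions on an interval: differentiability
  almost everywhere and the fundamental theorem of calculus (\<open>lipschitz_curve_calculus\<close>).
\<close>

section \<open>Lipschitz functions of one real variable\<close>

text \<open>The growth condition makes \<open>f\<close> a homeomorphism of the line, so its Stieltjes measure is the image
  of Lebesgue measure under \<open>f\<close>'s inverse. A set is null for this measure iff its image under \<open>f\<close> is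
  a Lebesgue null set, and Lipschitz maps preserve null sets; so Radon-Nikodym gives a density.\<close>

lemma strictly_expanding_real_has_density:
  fixes f :: "real \<Rightarrow> real"
  assumes lip: "\<And>s t. \<bar>f t - f s\<bar> \<le> L * \<bar>t - s\<bar>"
    and exp: "\<And>s t. s \<le> t \<Longrightarrow> t - s \<le> f t - f s"
  obtains g where "\<And>s t. s \<le> t \<Longrightarrow> (g has_integral f t - f s) {s..t}"
proof -
  have contf: "continuous_on UNIV f"
  proof (rule lipschitz_on_continuous_on)
    show "(max L 0)-lipschitz_on UNIV f"
    proof (rule lipschitz_onI)
      fix x y :: real
      have "\<bar>f x - f y\<bar> \<le> L * \<bar>x - y\<bar>" by (rule lip)
      also have "\<dots> \<le> max L 0 * \<bar>x - y\<bar>" by (intro mult_right_mono) auto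
      finally show "dist (f x) (f y) \<le> max L 0 * dist x y" by (simp add: dist_real_def)
    qed simp
  qed
  have mono: "s < t \<Longrightarrow> f s < f t" for s t using exp[of s t] by simp
  then have inj: "inj f" by (metis injI linorder_neqE_linordered_idom less_irrefl)
  have surj: "\<exists>t. f t = y" for y
  proof -
    let ?n = "\<bar>y - f 0\<bar>"
    have "f (- ?n) \<le> y" "y \<le> f ?n" using exp[of "- ?n" 0] exp[of 0 ?n] by auto
    then show ?thesis using IVT'[of f "- ?n" y ?n] continuous_on_subset[OF contf, of "{-?n..?n}"] by auto
  qed
  define h where "h = inv f"
  have fh: "f (h y) = y" and hf: "h (f t) = t" for y t
    using surj inj unfolding h_def by (auto simp: f_inv_into_f surj_def inv_f_f) (metis f_inv_into_f rangeI)
  have hlip: "\<bar>h y - h x\<bar> \<le> \<bar>y - x\<bar>" for x y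
  proof (cases "h x \<le> h y")
    case True then show ?thesis using exp[of "h x" "h y"] by (simp add: fh)
  next
    case False then show ?thesis using exp[of "h y" "h x"] by (simp add: fh)
  qed
  have "1-lipschitz_on UNIV h" by (rule lipschitz_onI) (use hlip in \<open>auto simp: dist_real_def abs_minus_commute\<close>)
  then have conth: "continuous_on UNIV h" by (rule lipschitz_on_continuous_on)
  then have [measurable]: "h \<in> borel_measurable borel" by (rule borel_measurable_continuous_onI)
  define N where "N = distr lborel borel h"
  have vim: "h -` A = f ` A" for A
    by (auto simp: fh hf image_iff) (metis fh)
  have ac: "absolutely_continuous lborel N"
    unfolding absolutely_continuous_def
  proof
    fix A :: "real set" assume A: "A \<in> null_sets lborel"
    have "negligible A" using A by (simp add: negligible_iff_null_sets null_sets_completionI)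
    then have "negligible (f ` A)"
      by (rule negligible_locally_Lipschitz_image[rotated])
        (use lip in \<open>auto intro!: exI[of _ UNIV] exI[of _ L]\<close>)
    moreover have "h -` A \<in> sets borel" using A measurable_sets_borel[of h borel A] by auto
    ultimately have "emeasure lborel (h -` A) = 0"
      by (metis vim negligible_iff_null_sets null_sets_completion_iff null_setsD1 sets_lborel)
    then show "A \<in> null_sets N"
      using A by (intro null_setsI) (auto simp: N_def emeasure_distr)
  qed
  obtain d where d[measurable]: "d \<in> borel_measurable borel" and dN: "density lborel d = N"
    using sigma_finite_measure.Radon_Nikodym[OF sigma_finite_lborel ac] by (auto simp: N_def)
  have Nint: "(\<integral>\<^sup>+x. d x * indicator {s..t} x \<partial>lborel) = ennreal (f t - f s)" if "s \<le> t" for s t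
  proof -
    have "(\<integral>\<^sup>+x. d x * indicator {s..t} x \<partial>lborel) = emeasure N {s..t}"
      unfolding dN[symmetric] by (simp add: emeasure_density)
    also have "\<dots> = emeasure lborel (h -` {s..t})" by (simp add: N_def emeasure_distr)
    also have "h -` {s..t} = {f s..f t}"
      unfolding vim using that
      apply (auto simp: image_iff Bex_def)
      apply (metis exp diff_ge_0_iff_ge order_trans)
      apply (metis exp diff_ge_0_iff_ge order_trans)
      by (metis fh linorder_not_le mono)
    finally show ?thesis using exp[OF that] that by simp
  qed
  have fin: "AE x in lborel. d x \<noteq> \<infinity>"
  proof -
    have "AE x in lborel. \<forall>n::nat. x \<in> {-real n..real n} \<longrightarrow> d x \<noteq> \<infinity>"
    proof (subst AE_all_countable, rule allI)
      fix n :: nat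
      have "AE x in lborel. d x * indicator {-real n..real n} x \<noteq> \<infinity>"
        by (rule nn_integral_PInf_AE) (auto simp: Nint)
      then show "AE x in lborel. x \<in> {-real n..real n} \<longrightarrow> d x \<noteq> \<infinity>"
        by eventually_elim (auto simp: indicator_def)
    qed
    then show ?thesis
    proof eventually_elim
      case (elim x)
      obtain n :: nat where "\<bar>x\<bar> \<le> real n" using real_arch_simple by blast
      with elim show ?case by (auto simp: abs_le_iff)
    qed
  qed
  show thesis
  proof
    fix s t :: real assume st: "s \<le> t"
    have "((\<lambda>x. enn2real (d x) * indicator {s..t} x) has_integral f t - f s) UNIV"
    proof (rule nn_integral_has_integral)
      have "(\<integral>\<^sup>+x. ennreal (enn2real (d x) * indicator {s..t} x) \<partial>lborel)
          = (\<integral>\<^sup>+x. d x * indicator {s..t} x \<partial>lborel)"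
        by (rule nn_integral_cong_AE, use fin in eventually_elim)
          (auto simp: indicator_def ennreal_enn2real_if)
      then show "(\<integral>\<^sup>+x. ennreal (enn2real (d x) * indicator {s..t} x) \<partial>lborel) = ennreal (f t - f s)"
        using Nint[OF st] by simp
    qed (use exp[OF st] st in auto)
    then have "((\<lambda>x. if x \<in> {s..t} then enn2real (d x) else 0) has_integral f t - f s) UNIV"
      by (rule has_integral_eq[rotated]) auto
    then show "((\<lambda>x. enn2real (d x)) has_integral f t - f s) {s..t}"
      by (simp only: has_integral_restrict_UNIV)
  qed
qed

text \<open>Adding \<open>(L + 1) t\<close> to an \<open>L\<close>-Lipschitz function makes it expanding.\<close>

lemma lipschitz_real_has_density:
  fixes f :: "real \<Rightarrow> real"
  assumes lip: "\<And>s t. \<bar>f t - f s\<bar> \<le> L * \<bar>t - s\<bar>"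
  obtains g where "\<And>s t. s \<le> t \<Longrightarrow> (g has_integral f t - f s) {s..t}"
proof -
  have L: "L \<ge> 0" using lip[of 1 0] by simp
  have 1: "\<bar>(f t + (L+1) * t) - (f s + (L+1) * s)\<bar> \<le> (2 * L+1) * \<bar>t - s\<bar>" for s t
  proof -
    have "\<bar>(L+1) * (t-s)\<bar> = (L+1) * \<bar>t-s\<bar>" using L by (simp add: abs_mult)
    then show ?thesis using lip[of t s] by (simp add: algebra_simps)
  qed
  have 2: "t - s \<le> (f t + (L+1) * t) - (f s + (L+1) * s)" if "s \<le> t" for s t
    using lip[of t s] that by (simp add: algebra_simps)
  obtain g where g: "\<And>s t. s \<le> t \<Longrightarrow> (g has_integral ((f t + (L+1) * t) - (f s + (L+1) * s))) {s..t}"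
    by (rule strictly_expanding_real_has_density[OF 1 2]) auto
  show thesis
  proof
    fix s t :: real assume "s \<le> t"
    from has_integral_diff[OF g[OF this] has_integral_const_real[of "L+1" s t]] this
    show "((\<lambda>x. g x - (L+1)) has_integral f t - f s) {s..t}"
      by (simp add: algebra_simps)
  qed
qed

text \<open>Lebesgue's differentiation theorem from one-sided averages \<open>{t..t+h}\<close>: the left-hand derivative is
  the right-hand one of the reflected function.\<close>

lemma indefinite_integral_has_vector_derivative_AE:
  fixes g :: "real \<Rightarrow> 'a::euclidean_space"
  assumes g: "\<And>s t. g integrable_on {s..t}"
    and f: "\<And>s t. s \<le> t \<Longrightarrow> f t - f s = integral {s..t} g"
  obtains N where "negligible N" "\<And>t. t \<notin> N \<Longrightarrow> (f has_vector_derivative g t) (at t)"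
proof -
  have one_sided: "\<exists>N. negligible N \<and> (\<forall>x e. x \<notin> N \<and> 0 < e \<longrightarrow>
      (\<exists>d>0. \<forall>h. 0 < h \<and> h < d \<longrightarrow> norm (integral {x..x+h} k /\<^sub>R h - k x) < e))"
    if k: "\<And>s t. k integrable_on {s..t}" for k :: "real \<Rightarrow> 'a"
  proof -
    have "k integrable_on cbox a b" for a b using k[of a b] by simp
    from integrable_ccontinuous_explicit[OF this]
    obtain N where N: "negligible N" "\<And>x e. \<lbrakk>x \<notin> N; 0 < e\<rbrakk> \<Longrightarrow> \<exists>d>0. \<forall>h. 0 < h \<and> h < d \<longrightarrow>
      norm (integral (cbox x (x + h *\<^sub>R One)) k /\<^sub>R h ^ DIM(real) - k x) < e"
      by metis
    show ?thesis using N by (intro exI[of _ N]) simp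
  qed
  obtain N1 where N1: "negligible N1"
    "\<And>x e. \<lbrakk>x \<notin> N1; 0 < e\<rbrakk> \<Longrightarrow> \<exists>d>0. \<forall>h. 0 < h \<and> h < d \<longrightarrow>
        norm (integral {x..x+h} g /\<^sub>R h - g x) < e"
    using one_sided[of g, OF g] by blast
  have "(\<lambda>t. g (- t)) integrable_on {s..t}" for s t
    using g[of "-t" "-s"] Henstock_Kurzweil_Integration.integrable_reflect_real[where f=g and a="-t" and b="-s"] by simp
  from one_sided[OF this] obtain N2 where N2: "negligible N2"
    "\<And>x e. \<lbrakk>x \<notin> N2; 0 < e\<rbrakk> \<Longrightarrow> \<exists>d>0. \<forall>h. 0 < h \<and> h < d \<longrightarrow>
        norm (integral {x..x+h} (\<lambda>t. g (- t)) /\<^sub>R h - g (- x)) < e"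
    by blast
  have scale: "c *\<^sub>R (X /\<^sub>R c - G) = X - c *\<^sub>R G" if "c \<noteq> 0" for c and X G :: 'a
    using that by (simp add: scaleR_right_diff_distrib)
  let ?N = "N1 \<union> uminus ` N2"
  have neg: "negligible ?N"
    using N1(1) N2(1)
    by (intro negligible_Un negligible_locally_Lipschitz_image[of N2] exI[of _ UNIV] exI[of _ "1::real"])
      (auto simp: norm_minus_commute)
  show thesis
  proof (rule that[OF neg])
    fix t assume t: "t \<notin> ?N"
    then have t1: "t \<notin> N1" and t2: "- t \<notin> N2" by (auto simp: image_iff)
    show "(f has_vector_derivative g t) (at t)"
      unfolding has_vector_derivative_def has_derivative_at_alt
    proof (intro conjI allI impI bounded_linear_scaleR_left)
      fix e :: real assume e: "e > 0"
      obtain d1 where d1: "d1 > 0" "\<And>h. 0 < h \<Longrightarrow> h < d1 \<Longrightarrow> norm (integral {t..t+h} g /\<^sub>R h - g t) < e"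
        using N1(2)[OF t1 e] by blast
      obtain d2 where d2: "d2 > 0" "\<And>h. 0 < h \<Longrightarrow> h < d2 \<Longrightarrow> norm (integral {-t..-t+h} (\<lambda>t. g (- t)) /\<^sub>R h - g t) < e"
        using N2(2)[OF t2 e] by auto
      show "\<exists>d>0. \<forall>y. norm (y - t) < d \<longrightarrow> norm (f y - f t - (y - t) *\<^sub>R g t) \<le> e * norm (y - t)"
      proof (intro exI[of _ "min d1 d2"] conjI allI impI)
        show "min d1 d2 > 0" using d1 d2 by simp
        fix y assume y: "norm (y - t) < min d1 d2"
        consider "y = t" | "y > t" | "y < t" by linarith
        then show "norm (f y - f t - (y - t) *\<^sub>R g t) \<le> e * norm (y - t)"
        proof cases
          case 1 then show ?thesis by simp
        next
          case 2
          have "norm (integral {t..y} g /\<^sub>R (y-t) - g t) < e" using d1(2)[of "y-t"] y 2 by auto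
          moreover have "f y - f t - (y - t) *\<^sub>R g t = (y-t) *\<^sub>R (integral {t..y} g /\<^sub>R (y-t) - g t)"
            using f[of t y] 2 by (simp add: scale)
          ultimately show ?thesis using 2 by (simp add: mult.commute)
        next
          case 3
          have flip: "(y - t) *\<^sub>R v = - ((t - y) *\<^sub>R v)" for v :: 'a
            by (metis minus_diff_eq scaleR_minus_left)
          have "integral {-t..-y} (\<lambda>t. g (- t)) = integral {y..t} g"
            by (simp add: integral_reflect_real)
          then have "norm (integral {y..t} g /\<^sub>R (t-y) - g t) < e" using d2(2)[of "t-y"] y 3 by auto
          moreover have "f y - f t - (y - t) *\<^sub>R g t = (y-t) *\<^sub>R (integral {y..t} g /\<^sub>R (t-y) - g t)"
            using f[of y t] 3 unfolding flip by (simp add: scale) (metis minus_diff_eq)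
          ultimately show ?thesis using 3 by (simp add: mult.commute)
        qed
      qed
    qed
  qed
qed

abbreviation velocity :: "(real \<Rightarrow> 'a::real_normed_vector) \<Rightarrow> real \<Rightarrow> 'a" where
  "velocity \<gamma> t \<equiv> vector_derivative \<gamma> (at t)"

text \<open>The interval is open: at its end points only one-sided derivatives of a curve make sense.\<close>

definition ae_between :: "real \<Rightarrow> real \<Rightarrow> (real \<Rightarrow> bool) \<Rightarrow> bool" where
  "ae_between a b P \<longleftrightarrow> (\<exists>N. negligible N \<and> (\<forall>t. a < t \<and> t < b \<and> t \<notin> N \<longrightarrow> P t))"

lemma ae_betweenI: "(\<And>t. a < t \<Longrightarrow> t < b \<Longrightarrow> P t) \<Longrightarrow> ae_between a b P"
  unfolding ae_between_def by (rule exI[of _ "{}"]) auto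

lemma ae_between_mp2:
  assumes "ae_between a b P" "ae_between a b Q"
    and "\<And>t. a < t \<Longrightarrow> t < b \<Longrightarrow> P t \<Longrightarrow> Q t \<Longrightarrow> R t"
  shows "ae_between a b R"
proof -
  obtain M N where "negligible M" "\<forall>t. a < t \<and> t < b \<and> t \<notin> M \<longrightarrow> P t"
    "negligible N" "\<forall>t. a < t \<and> t < b \<and> t \<notin> N \<longrightarrow> Q t"
    using assms unfolding ae_between_def by auto
  then show ?thesis
    unfolding ae_between_def by (intro exI[of _ "M \<union> N"]) (auto intro: assms(3))
qed

lemma ae_between_mono:
  assumes "ae_between a b P" "\<And>t. a < t \<Longrightarrow> t < b \<Longrightarrow> P t \<Longrightarrow> R t"
  shows "ae_between a b R"
  using ae_between_mp2[OF assms(1) assms(1)] assms(2) by blast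

lemma ae_between_subset:
  assumes "ae_between a b P" "a \<le> s" "t \<le> b"
  shows "ae_between s t P"
  using assms unfolding ae_between_def by (meson le_less_trans less_le_trans)

lemma integral_mono_ae:
  fixes f g :: "real \<Rightarrow> real"
  assumes "ae_between a b (\<lambda>t. f t \<le> g t)" "f integrable_on {a..b}" "g integrable_on {a..b}"
  shows "integral {a..b} f \<le> integral {a..b} g"
proof -
  obtain N where N: "negligible N" "\<forall>t. a < t \<and> t < b \<and> t \<notin> N \<longrightarrow> f t \<le> g t"
    using assms(1) unfolding ae_between_def by auto
  let ?N = "N \<union> {a,b}"
  have neg: "negligible ?N" using N by auto
  let ?f = "\<lambda>t. if t \<in> ?N then g t else f t"
  have "integral {a..b} f = integral {a..b} ?f"
    by (rule integral_spike[OF neg]) auto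
  also have "\<dots> \<le> integral {a..b} g"
  proof (rule integral_le[OF integrable_spike[OF assms(2) neg] assms(3)])
    show "?f x \<le> g x" if "x \<in> {a..b}" for x using N that by (auto simp: less_le)
  qed auto
  finally show ?thesis .
qed

lemma integral_cong_ae:
  fixes f g :: "real \<Rightarrow> 'a::euclidean_space"
  assumes "ae_between a b (\<lambda>t. f t = g t)"
  shows "integral {a..b} f = integral {a..b} g" "f integrable_on {a..b} \<longleftrightarrow> g integrable_on {a..b}"
proof -
  obtain N where N: "negligible N" "\<forall>t. a < t \<and> t < b \<and> t \<notin> N \<longrightarrow> f t = g t"
    using assms(1) unfolding ae_between_def by auto
  have neg: "negligible (N \<union> {a,b})" using N by auto
  show "integral {a..b} f = integral {a..b} g"
    by (rule integral_spike[OF neg]) (use N in force)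
  show "f integrable_on {a..b} \<longleftrightarrow> g integrable_on {a..b}"
    using integrable_spike[OF _ neg, of f "{a..b}" g] integrable_spike[OF _ neg, of g "{a..b}" f] N
    by force
qed

lemma indefinite_integral_derivative_ae:
  fixes k :: "real \<Rightarrow> 'a::euclidean_space"
  assumes k: "k integrable_on {a..b}"
  shows "ae_between a b (\<lambda>t. ((\<lambda>t. integral {a..t} k) has_vector_derivative k t) (at t))"
proof -
  define e where "e = (\<lambda>t. if t \<in> {a..b} then k t else 0)"
  have eU: "e integrable_on UNIV"
    using k unfolding e_def by (simp only: integrable_restrict_UNIV)
  then have ei: "e integrable_on {s..t}" for s t
    by (rule integrable_on_subinterval[where S=UNIV]) auto
  define E where "E t = integral {min a t..t} e - integral {t..max a t} e" for t
  have E: "E t - E s = integral {s..t} e" if "s \<le> t" for s t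
  proof -
    have comb: "integral {r..u} e = integral {r..v} e + integral {v..u} e" if "r \<le> v" "v \<le> u" for r v u
      using Henstock_Kurzweil_Integration.integral_combine[OF that ei] by simp
    have Er: "E r = integral {a..r} e" if "a \<le> r" for r using that by (simp add: E_def min_absorb1 max_absorb2)
    have El: "E r = - integral {r..a} e" if "r \<le> a" for r using that by (simp add: E_def min_absorb2 max_absorb1)
    consider "a \<le> s" | "s \<le> a" "a \<le> t" | "t \<le> a" using that by linarith
    then show ?thesis
    proof cases
      case 1 then show ?thesis using that comb[of a s t] by (simp add: Er)
    next
      case 2 then show ?thesis using comb[of s a t] by (simp add: Er El)
    next
      case 3 then show ?thesis using that comb[of s t a] by (simp add: El)
    qed
  qed
  obtain N where N: "negligible N" "\<And>t. t \<notin> N \<Longrightarrow> (E has_vector_derivative e t) (at t)"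
    using indefinite_integral_has_vector_derivative_AE[OF ei E] by auto
  show ?thesis unfolding ae_between_def
  proof (intro exI[of _ N] conjI allI impI N(1))
    fix t assume t: "a < t \<and> t < b \<and> t \<notin> N"
    have Ek: "E y = integral {a..y} k" if "y \<in> {a<..<b}" for y
    proof -
      have "E y = integral {a..y} e" using that by (simp add: E_def min_def max_def)
      also have "\<dots> = integral {a..y} k" using that by (intro integral_cong) (auto simp: e_def)
      finally show ?thesis .
    qed
    have "(E has_vector_derivative k t) (at t)" using N(2)[of t] t by (simp add: e_def)
    then show "((\<lambda>t. integral {a..t} k) has_vector_derivative k t) (at t)"
    proof (rule has_vector_derivative_transform_within_open)
      show "open {a<..<b}" by simp
      show "t \<in> {a<..<b}" using t by simp
    qed (rule Ek)
  qed
qed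

lemma has_vector_derivative_tendsto_quotient:
  fixes f :: "real \<Rightarrow> 'a::real_normed_vector"
  assumes "(f has_vector_derivative D) (at t)"
  shows "((\<lambda>y. (f y - f t) /\<^sub>R (y - t)) \<longlongrightarrow> D) (at t)"
proof (rule LIM_zero_cancel, rule tendsto_norm_zero_cancel)
  have lim: "((\<lambda>y. norm ((f y - f t) - (y - t) *\<^sub>R D) / norm (y - t)) \<longlongrightarrow> 0) (at t)"
    using assms unfolding has_vector_derivative_def has_derivative_iff_norm by simp
  have eq: "norm ((f y - f t) - (y - t) *\<^sub>R D) / norm (y - t) = norm ((f y - f t) /\<^sub>R (y - t) - D)"
    if "y \<noteq> t" for y
  proof -
    have "(f y - f t) - (y - t) *\<^sub>R D = (y - t) *\<^sub>R ((f y - f t) /\<^sub>R (y - t) - D)"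
      using that by (simp add: scaleR_right_diff_distrib)
    then show ?thesis using that by simp
  qed
  show "((\<lambda>y. norm ((f y - f t) /\<^sub>R (y - t) - D)) \<longlongrightarrow> 0) (at t)"
    by (rule Lim_transform_eventually[OF lim]) (use eq in \<open>auto simp: eventually_at_filter\<close>)
qed

lemma norm_velocity_le_lipschitz:
  fixes f :: "real \<Rightarrow> 'a::real_normed_vector"
  assumes "L-lipschitz_on {a..b} f" "a < t" "t < b" "(f has_vector_derivative D) (at t)"
  shows "norm D \<le> L"
proof (rule tendsto_upperbound)
  show "((\<lambda>y. norm ((f y - f t) /\<^sub>R (y - t))) \<longlongrightarrow> norm D) (at t)"
    by (intro tendsto_norm has_vector_derivative_tendsto_quotient assms)
  have "eventually (\<lambda>y. y \<in> {a<..<b}) (at t)"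
    using assms by (intro eventually_at_in_open') auto
  moreover have "eventually (\<lambda>y. y \<noteq> t) (at t)" by (simp add: eventually_at_filter)
  ultimately show "eventually (\<lambda>y. norm ((f y - f t) /\<^sub>R (y - t)) \<le> L) (at t)"
  proof eventually_elim
    case (elim y)
    have "norm (f y - f t) \<le> L * \<bar>y - t\<bar>"
      using lipschitz_onD[OF assms(1), of y t] elim assms by (auto simp: dist_norm)
    moreover have "norm ((f y - f t) /\<^sub>R (y - t)) = norm (f y - f t) / \<bar>y - t\<bar>"
      by (simp add: divide_inverse mult.commute)
    ultimately show ?case using elim by (simp add: pos_divide_le_eq)
  qed
qed auto

text \<open>The one-dimensional Rademacher theorem, together with the fundamental theorem of calculus. The
  function is first extended to the whole line by constants, and each component then has a density.\<close>

lemma lipschitz_curve_calculus: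
  fixes \<gamma> :: "real \<Rightarrow> 'a::euclidean_space"
  assumes lip: "L-lipschitz_on {a..b} \<gamma>" and ab: "a \<le> b"
  shows lipschitz_velocity_ae:
      "ae_between a b (\<lambda>t. (\<gamma> has_vector_derivative velocity \<gamma> t) (at t) \<and> norm (velocity \<gamma> t) \<le> L)"
    and lipschitz_ftc: "\<lbrakk>a \<le> s; s \<le> t; t \<le> b\<rbrakk> \<Longrightarrow> (velocity \<gamma> has_integral \<gamma> t - \<gamma> s) {s..t}"
proof -
  define e where "e t = \<gamma> (max a (min b t))" for t
  have L: "L \<ge> 0" using lip by (rule lipschitz_on_nonneg)
  have elip: "norm (e t - e s) \<le> L * \<bar>t - s\<bar>" for s t
  proof -
    have "norm (e t - e s) \<le> L * \<bar>max a (min b t) - max a (min b s)\<bar>"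
      using lipschitz_onD[OF lip, of "max a (min b t)" "max a (min b s)"] ab
      by (auto simp: e_def dist_norm)
    also have "\<dots> \<le> L * \<bar>t - s\<bar>" by (intro mult_left_mono L) auto
    finally show ?thesis .
  qed
  have "\<exists>g. \<forall>s t. s \<le> t \<longrightarrow> (g has_integral (e t \<bullet> i - e s \<bullet> i)) {s..t}" if "i \<in> Basis" for i
  proof -
    have "\<bar>e t \<bullet> i - e s \<bullet> i\<bar> \<le> L * \<bar>t - s\<bar>" for s t
      using elip[of t s] Basis_le_norm[OF that, of "e t - e s"] by (simp add: inner_diff_left)
    from lipschitz_real_has_density[OF this] show ?thesis by metis
  qed
  then obtain G where G: "\<And>i s t. i \<in> Basis \<Longrightarrow> s \<le> t \<Longrightarrow> (G i has_integral (e t \<bullet> i - e s \<bullet> i)) {s..t}"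
    by metis
  define g where "g t = (\<Sum>i\<in>Basis. G i t *\<^sub>R i)" for t
  have g: "(g has_integral e t - e s) {s..t}" if "s \<le> t" for s t
    by (rule has_integral_componentwise)
      (use G[OF _ that] in \<open>simp add: g_def inner_diff_left inner_sum_left_Basis\<close>)
  have gi: "g integrable_on {s..t}" for s t
    using g[of s t] by (cases "s \<le> t") auto
  obtain N where N: "negligible N" "\<And>t. t \<notin> N \<Longrightarrow> (e has_vector_derivative g t) (at t)"
    using indefinite_integral_has_vector_derivative_AE[OF gi integral_unique[OF g, symmetric]] by blast
  have D: "(\<gamma> has_vector_derivative g t) (at t)" if "a < t" "t < b" "t \<notin> N" for t
    using N(2)[OF that(3)]
    by (rule has_vector_derivative_transform_within_open[of _ _ _ "{a<..<b}"]) (use that in \<open>auto simp: e_def\<close>)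
  then have vg: "velocity \<gamma> t = g t" if "a < t" "t < b" "t \<notin> N" for t
    using that by (simp add: vector_derivative_at)
  show "ae_between a b (\<lambda>t. (\<gamma> has_vector_derivative velocity \<gamma> t) (at t) \<and> norm (velocity \<gamma> t) \<le> L)"
    unfolding ae_between_def
  proof (intro exI[of _ N] conjI allI impI)
    fix t assume t: "a < t \<and> t < b \<and> t \<notin> N"
    show "(\<gamma> has_vector_derivative velocity \<gamma> t) (at t)" using D[of t] vg[of t] t by simp
    then show "norm (velocity \<gamma> t) \<le> L" using norm_velocity_le_lipschitz[OF lip] t by blast
  qed (rule N(1))
  show "(velocity \<gamma> has_integral \<gamma> t - \<gamma> s) {s..t}" if "a \<le> s" "s \<le> t" "t \<le> b"
  proof (rule has_integral_spike)
    show "negligible (N \<union> {a,b})" using N(1) by simp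
    show "(g has_integral \<gamma> t - \<gamma> s) {s..t}" using g[OF that(2)] that by (simp add: e_def)
    fix x assume "x \<in> {s..t} - (N \<union> {a,b})"
    then show "velocity \<gamma> x = g x" using that by (intro vg) auto
  qed
qed

text \<open>Energy, length and area all have integrands of this form. The velocity is replaced by zero where it
  exceeds the Lipschitz constant; this happens only on a null set and makes the integrand bounded.\<close>

lemma lipschitz_integrand_integrable:
  fixes \<gamma> :: "real \<Rightarrow> 'a::euclidean_space" and \<Phi> :: "'a \<times> 'a \<Rightarrow> 'b::euclidean_space"
  assumes lip: "L-lipschitz_on {a..b} \<gamma>" and cont: "continuous_on UNIV \<Phi>"
  shows "(\<lambda>t. \<Phi> (\<gamma> t, velocity \<gamma> t)) integrable_on {a..b}"
proof (cases "a \<le> b")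
  case ab: True
  define D where "D t = (if norm (velocity \<gamma> t) \<le> L then velocity \<gamma> t else 0)" for t
  have L: "L \<ge> 0" using lip by (rule lipschitz_on_nonneg)
  have ae: "ae_between a b (\<lambda>t. \<Phi> (\<gamma> t, D t) = \<Phi> (\<gamma> t, velocity \<gamma> t))"
    using lipschitz_velocity_ae[OF lip ab] by (rule ae_between_mono) (simp add: D_def)
  have [measurable]: "velocity \<gamma> \<in> borel_measurable (lebesgue_on {a..b})"
    using lipschitz_ftc[OF lip ab, of a b] ab by (intro integrable_imp_measurable) auto
  have cg: "continuous_on {a..b} \<gamma>" by (rule lipschitz_on_continuous_on[OF lip])
  then have [measurable]: "\<gamma> \<in> borel_measurable (lebesgue_on {a..b})"
    by (intro continuous_imp_measurable_on_sets_lebesgue) auto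
  have [measurable]: "D \<in> borel_measurable (lebesgue_on {a..b})" unfolding D_def by measurable
  have [measurable]: "\<Phi> \<in> borel_measurable borel" using cont by (rule borel_measurable_continuous_onI)
  have meas: "(\<lambda>t. \<Phi> (\<gamma> t, D t)) \<in> borel_measurable (lebesgue_on {a..b})" by measurable
  have "compact (\<Phi> ` (\<gamma> ` {a..b} \<times> cball 0 L))"
    by (intro compact_continuous_image compact_Times continuous_on_subset[OF cont] cg) auto
  then have "bounded (\<Phi> ` (\<gamma> ` {a..b} \<times> cball 0 L))" by (rule compact_imp_bounded)
  then obtain B where B: "\<And>x. x \<in> \<Phi> ` (\<gamma> ` {a..b} \<times> cball 0 L) \<Longrightarrow> norm x \<le> B"
    unfolding bounded_iff by blast
  have "(\<lambda>t. \<Phi> (\<gamma> t, D t)) integrable_on {a..b}"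
  proof (rule measurable_bounded_by_integrable_imp_integrable[OF meas])
    show "norm (\<Phi> (\<gamma> t, D t)) \<le> B" if "t \<in> {a..b}" for t
    proof (rule B, rule imageI, rule SigmaI)
      show "\<gamma> t \<in> \<gamma> ` {a..b}" using that by (rule imageI)
      show "D t \<in> cball 0 L" using L by (simp add: D_def)
    qed
    show "(\<lambda>t. B) integrable_on {a..b}" by (rule integrable_const_ivl)
  qed simp
  then show ?thesis by (rule integral_cong_ae(2)[OF ae, THEN iffD1])
next
  case False
  then have "{a..b} = {}" by simp
  then show ?thesis by (simp only: integrable_on_empty)
qed

section \<open>Energy and area along Lipschitz curves\<close>

lemma locally_lipschitz_on_interval_iff:
  fixes \<gamma> :: "real \<Rightarrow> 'a::metric_space"
  shows "locally_lipschitz_on {a..b} \<gamma> \<longleftrightarrow> (\<exists>L. L-lipschitz_on {a..b} \<gamma>)"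
proof
  assume ll: "locally_lipschitz_on {a..b} \<gamma>"
  then have "local_lipschitz {0::real} {a..b} (\<lambda>_. \<gamma>)"
    unfolding local_lipschitz_def locally_lipschitz_on_def
    by (metis IntD2 singletonD singletonI)
  from local_lipschitz_compact_implies_lipschitz[OF this, of]
  show "\<exists>L. L-lipschitz_on {a..b} \<gamma>" by (metis compact_Icc compact_sing continuous_on_const singletonI)
next
  assume "\<exists>L. L-lipschitz_on {a..b} \<gamma>"
  then show "locally_lipschitz_on {a..b} \<gamma>"
    unfolding locally_lipschitz_on_def by (meson inf_le2 lipschitz_on_subset zero_less_one)
qed

lemma joins_iff:
  "joins p q a b \<gamma> \<longleftrightarrow> a < b \<and> (\<exists>L. L-lipschitz_on {a..b} \<gamma>) \<and> \<gamma> a = p \<and> \<gamma> b = q"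
  by (simp add: joins_def locally_lipschitz_on_interval_iff)

lemma velocity_within:
  assumes "a < t" "t < b"
  shows "vector_derivative \<gamma> (at t within {a..b}) = velocity \<gamma> t"
  using assms by (simp add: at_within_Icc_at)

text \<open>From here on all integrals along curves are written with the two-sided derivative.\<close>

lemma energy_velocity:
  "energy F a b \<gamma> = integral {a..b} (\<lambda>t. F (\<gamma> t) * norm (velocity \<gamma> t))"
  unfolding energy_def by (intro integral_cong_ae(1) ae_betweenI) (simp add: velocity_within)

lemma area_velocity:
  "area a b \<gamma> = integral {a..b} (\<lambda>t. \<gamma> t $ 1 * velocity \<gamma> t $ 2)"
  unfolding area_def by (intro integral_cong_ae(1) ae_betweenI) (simp add: velocity_within)

lemma velocity_cong:
  assumes "\<And>t. t \<in> {a..b} \<Longrightarrow> \<gamma> t = \<eta> t" "a < t" "t < b"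
  shows "velocity \<gamma> t = velocity \<eta> t"
proof (rule vector_derivative_cong_eq)
  have "eventually (\<lambda>x. x \<in> {a<..<b}) (nhds t)" using assms by (intro eventually_nhds_in_open) auto
  then show "eventually (\<lambda>x. x \<in> UNIV \<longrightarrow> \<gamma> x = \<eta> x) (nhds t)"
    by eventually_elim (use assms(1) in auto)
qed auto

lemma energy_cong:
  assumes "\<And>t. t \<in> {a..b} \<Longrightarrow> \<gamma> t = \<eta> t"
  shows "energy F a b \<gamma> = energy F a b \<eta>"
  unfolding energy_velocity
proof (intro integral_cong_ae(1) ae_betweenI)
  fix t assume t: "a < t" "t < b"
  show "F (\<gamma> t) * norm (velocity \<gamma> t) = F (\<eta> t) * norm (velocity \<eta> t)"
    using assms[of t] velocity_cong[of a b \<gamma> \<eta> t, OF assms t] t by simp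
qed

lemma area_cong:
  assumes "\<And>t. t \<in> {a..b} \<Longrightarrow> \<gamma> t = \<eta> t"
  shows "area a b \<gamma> = area a b \<eta>"
  unfolding area_velocity
proof (intro integral_cong_ae(1) ae_betweenI)
  fix t assume t: "a < t" "t < b"
  show "\<gamma> t $ 1 * velocity \<gamma> t $ 2 = \<eta> t $ 1 * velocity \<eta> t $ 2"
    using assms[of t] velocity_cong[of a b \<gamma> \<eta> t, OF assms t] t by simp
qed

context
  fixes \<gamma> :: "real \<Rightarrow> real ^ 2" and L a b :: real
  assumes lip: "L-lipschitz_on {a..b} \<gamma>"
begin

lemma sub_lip: "a \<le> s \<Longrightarrow> t \<le> b \<Longrightarrow> L-lipschitz_on {s..t} \<gamma>"
  by (rule lipschitz_on_subset[OF lip]) auto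

lemma energy_integrable:
  assumes F: "continuous_on UNIV F" and st: "a \<le> s" "t \<le> b"
  shows "(\<lambda>t. F (\<gamma> t) * norm (velocity \<gamma> t)) integrable_on {s..t}"
proof -
  have "continuous_on UNIV (\<lambda>x::(real^2)\<times>(real^2). F (fst x) * norm (snd x))"
    by (intro continuous_intros continuous_on_compose2[OF F]) auto
  from lipschitz_integrand_integrable[OF sub_lip[OF st] this] show ?thesis by simp
qed

lemma area_integrable:
  assumes st: "a \<le> s" "t \<le> b"
  shows "(\<lambda>t. \<gamma> t $ 1 * velocity \<gamma> t $ 2) integrable_on {s..t}"
proof -
  have "continuous_on UNIV (\<lambda>x::(real^2)\<times>(real^2). fst x $ 1 * snd x $ 2)"
    by (intro continuous_intros)
  from lipschitz_integrand_integrable[OF sub_lip[OF st] this] show ?thesis by simp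
qed

lemma energy_split:
  assumes F: "continuous_on UNIV F" and st: "a \<le> s" "s \<le> t" "t \<le> u" "u \<le> b"
  shows "energy F s u \<gamma> = energy F s t \<gamma> + energy F t u \<gamma>"
  unfolding energy_velocity
  using Henstock_Kurzweil_Integration.integral_combine[OF st(2,3) energy_integrable[OF F, of s u]] st by simp

lemma area_split:
  assumes st: "a \<le> s" "s \<le> t" "t \<le> u" "u \<le> b"
  shows "area s u \<gamma> = area s t \<gamma> + area t u \<gamma>"
  unfolding area_velocity
  using Henstock_Kurzweil_Integration.integral_combine[OF st(2,3) area_integrable[of s u]] st by simp

lemma energy_le:
  assumes F: "continuous_on UNIV F" and G: "continuous_on UNIV G" and st: "a \<le> s" "t \<le> b"
    and le: "\<And>u. s < u \<Longrightarrow> u < t \<Longrightarrow> F (\<gamma> u) \<le> G (\<gamma> u)"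
  shows "energy F s t \<gamma> \<le> energy G s t \<gamma>"
  unfolding energy_velocity
  by (intro integral_mono_ae ae_betweenI energy_integrable F G st mult_right_mono le) auto

lemma displacement_le_length:
  assumes "a \<le> s" "s \<le> t" "t \<le> b"
  shows "norm (\<gamma> t - \<gamma> s) \<le> energy (\<lambda>_. 1) s t \<gamma>"
proof -
  have "norm (integral {s..t} (velocity \<gamma>)) \<le> integral {s..t} (\<lambda>t. 1 * norm (velocity \<gamma> t))"
    using lipschitz_ftc[OF lip, of s t] energy_integrable[of "\<lambda>_. 1" s t] assms
    by (intro integral_norm_bound_integral) auto
  moreover have "integral {s..t} (velocity \<gamma>) = \<gamma> t - \<gamma> s"
    using lipschitz_ftc[OF lip, of s t] assms by (intro integral_unique) auto
  ultimately show ?thesis unfolding energy_velocity by simp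
qed

lemma energy_le_lipschitz:
  assumes F: "continuous_on UNIV F" and st: "a \<le> s" "s \<le> t" "t \<le> b"
    and K: "\<And>u. s < u \<Longrightarrow> u < t \<Longrightarrow> F (\<gamma> u) \<le> K" "0 \<le> K"
  shows "energy F s t \<gamma> \<le> K * L * (t - s)"
proof -
  have "energy F s t \<gamma> \<le> integral {s..t} (\<lambda>_. K * L)"
    unfolding energy_velocity
  proof (intro integral_mono_ae energy_integrable F st)
    show "ae_between s t (\<lambda>t. F (\<gamma> t) * norm (velocity \<gamma> t) \<le> K * L)"
      using ae_between_subset[OF lipschitz_velocity_ae[OF lip], of s t] st
      by (rule_tac ae_between_mono[of s t "\<lambda>t. (\<gamma> has_vector_derivative velocity \<gamma> t) (at t) \<and> norm (velocity \<gamma> t) \<le> L"])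
        (auto intro!: mult_mono K)
  qed auto
  then show ?thesis using st by (simp add: mult_ac)
qed

end

lemma energy_nonneg:
  assumes "\<And>t. t \<in> {a..b} \<Longrightarrow> 0 \<le> F (\<gamma> t)"
  shows "0 \<le> energy F a b \<gamma>"
proof (cases "(\<lambda>t. F (\<gamma> t) * norm (velocity \<gamma> t)) integrable_on {a..b}")
  case True then show ?thesis unfolding energy_velocity by (intro integral_nonneg mult_nonneg_nonneg assms) auto
next
  case False then show ?thesis unfolding energy_velocity by (simp add: not_integrable_integral)
qed

text \<open>A criterion that bounds the energy without referring to derivatives: dividing the assumed inequality
  by \<open>t - s\<close> gives \<open>F(\<gamma>) |\<gamma>'| \<le> g'\<close> almost everywhere. The assumption is stable under
  reparametrization and under pointwise limits, so the lemma replaces both a change of variables and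
  a separate argument for lower semicontinuity.\<close>

lemma energy_le_of_increments:
  fixes \<gamma> :: "real \<Rightarrow> real ^ 2"
  assumes lip: "L-lipschitz_on {a..b} \<gamma>" and g: "M-lipschitz_on {a..b} g" and ab: "a \<le> b"
    and F: "continuous_on UNIV F"
    and incr: "\<And>\<epsilon>. \<epsilon> > 0 \<Longrightarrow> \<exists>d>0. \<forall>s t. a \<le> s \<and> s \<le> t \<and> t \<le> b \<and> t - s < d \<longrightarrow>
        (F (\<gamma> s) - \<epsilon>) * norm (\<gamma> t - \<gamma> s) \<le> g t - g s"
  shows "energy F a b \<gamma> \<le> g b - g a"
proof -
  have "F (\<gamma> t) * norm (velocity \<gamma> t) \<le> velocity g t"
    if t: "a < t" "t < b" and D: "(\<gamma> has_vector_derivative velocity \<gamma> t) (at t)"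
       "(g has_vector_derivative velocity g t) (at t)" for t
  proof -
    have eps: "(F (\<gamma> t) - \<epsilon>) * norm (velocity \<gamma> t) \<le> velocity g t" if \<epsilon>: "\<epsilon> > 0" for \<epsilon>
    proof (rule tendsto_le)
      show "((\<lambda>y. (F (\<gamma> t) - \<epsilon>) * norm ((\<gamma> y - \<gamma> t) /\<^sub>R (y - t))) \<longlongrightarrow> (F (\<gamma> t) - \<epsilon>) * norm (velocity \<gamma> t)) (at_right t)"
        using has_vector_derivative_tendsto_quotient[OF D(1)]
        by (intro tendsto_intros) (rule tendsto_within_subset, auto)
      show "((\<lambda>y. (g y - g t) /\<^sub>R (y - t)) \<longlongrightarrow> velocity g t) (at_right t)"
        using has_vector_derivative_tendsto_quotient[OF D(2)] by (rule tendsto_within_subset) auto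
      obtain d where d: "d > 0" "\<And>s t. a \<le> s \<Longrightarrow> s \<le> t \<Longrightarrow> t \<le> b \<Longrightarrow> t - s < d \<Longrightarrow>
        (F (\<gamma> s) - \<epsilon>) * norm (\<gamma> t - \<gamma> s) \<le> g t - g s" using incr[OF \<epsilon>] by metis
      have "eventually (\<lambda>y. y \<in> {t<..<min b (t+d)}) (at_right t)"
        using t d(1) by (intro eventually_at_right_real) auto
      then show "eventually (\<lambda>y. (F (\<gamma> t) - \<epsilon>) * norm ((\<gamma> y - \<gamma> t) /\<^sub>R (y - t)) \<le> (g y - g t) /\<^sub>R (y - t)) (at_right t)"
      proof eventually_elim
        case (elim y)
        then have "inverse (y - t) * ((F (\<gamma> t) - \<epsilon>) * norm (\<gamma> y - \<gamma> t)) \<le> inverse (y - t) * (g y - g t)"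
          using t by (intro mult_left_mono d(2)) auto
        moreover have n: "norm ((\<gamma> y - \<gamma> t) /\<^sub>R (y - t)) = inverse (y - t) * norm (\<gamma> y - \<gamma> t)"
          using elim by simp
        ultimately show ?case unfolding n real_scaleR_def by (simp only: mult.left_commute)
      qed
    qed simp
    show ?thesis
    proof (rule field_le_epsilon)
      fix e :: real assume e: "e > 0"
      let ?n = "norm (velocity \<gamma> t)"
      have "0 < ?n + 1" by (simp add: add_nonneg_pos)
      then have "e / (?n + 1) * ?n \<le> e" using e by (simp add: pos_divide_le_eq)
      then show "F (\<gamma> t) * ?n \<le> velocity g t + e"
        using eps[of "e / (?n + 1)"] e by (simp add: algebra_simps add_pos_nonneg add.commute)
    qed
  qed
  then have "ae_between a b (\<lambda>t. F (\<gamma> t) * norm (velocity \<gamma> t) \<le> velocity g t)"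
    by (intro ae_between_mp2[OF lipschitz_velocity_ae[OF lip ab] lipschitz_velocity_ae[OF g ab]]) auto
  moreover note ftc = lipschitz_ftc[OF g ab, of a b]
  ultimately have "energy F a b \<gamma> \<le> integral {a..b} (velocity g)"
    unfolding energy_velocity using ab
    by (intro integral_mono_ae energy_integrable[OF lip] F) auto
  also have "\<dots> = g b - g a" using ftc ab by (intro integral_unique) auto
  finally show ?thesis .
qed

text \<open>The counterpart for the area. As the error is quadratic in \<open>t - s\<close>, the assumption forces
  \<open>\<alpha>' = \<gamma>\<^sub>1 \<gamma>\<^sub>2'\<close> almost everywhere, and it too survives limits.\<close>

lemma area_eq_of_increments:
  fixes \<gamma> :: "real \<Rightarrow> real ^ 2"
  assumes lip: "L-lipschitz_on {a..b} \<gamma>" and \<alpha>: "M-lipschitz_on {a..b} \<alpha>" and ab: "a \<le> b"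
    and incr: "\<And>s t. a \<le> s \<Longrightarrow> s \<le> t \<Longrightarrow> t \<le> b \<Longrightarrow>
        \<bar>\<alpha> t - \<alpha> s - \<gamma> s $ 1 * (\<gamma> t $ 2 - \<gamma> s $ 2)\<bar> \<le> K * (t - s)\<^sup>2"
  shows "area a b \<gamma> = \<alpha> b - \<alpha> a"
proof -
  have "\<gamma> t $ 1 * velocity \<gamma> t $ 2 = velocity \<alpha> t"
    if t: "a < t" "t < b" and D: "(\<gamma> has_vector_derivative velocity \<gamma> t) (at t)"
       "(\<alpha> has_vector_derivative velocity \<alpha> t) (at t)" for t
  proof -
    have "((\<lambda>y. (\<alpha> y - \<alpha> t) /\<^sub>R (y - t) - \<gamma> t $ 1 * (((\<gamma> y - \<gamma> t) /\<^sub>R (y - t)) $ 2)) \<longlongrightarrow>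
        velocity \<alpha> t - \<gamma> t $ 1 * velocity \<gamma> t $ 2) (at_right t)"
      by (intro tendsto_intros; rule tendsto_within_subset[of _ _ _ UNIV])
        (use has_vector_derivative_tendsto_quotient[OF D(1)] has_vector_derivative_tendsto_quotient[OF D(2)] in auto)
    moreover have "((\<lambda>y. (\<alpha> y - \<alpha> t) /\<^sub>R (y - t) - \<gamma> t $ 1 * (((\<gamma> y - \<gamma> t) /\<^sub>R (y - t)) $ 2)) \<longlongrightarrow> 0) (at_right t)"
    proof (rule Lim_null_comparison)
      have "((\<lambda>y. K * (y - t)) \<longlongrightarrow> K * (t - t)) (at_right t)" by (intro tendsto_intros)
      then show "((\<lambda>y. K * (y - t)) \<longlongrightarrow> 0) (at_right t)" by simp
      have "eventually (\<lambda>y. y \<in> {t<..<b}) (at_right t)"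
        using t by (intro eventually_at_right_real) auto
      then show "eventually (\<lambda>y. norm ((\<alpha> y - \<alpha> t) /\<^sub>R (y - t) - \<gamma> t $ 1 * (((\<gamma> y - \<gamma> t) /\<^sub>R (y - t)) $ 2)) \<le> K * (y - t)) (at_right t)"
      proof eventually_elim
        case (elim y)
        have "(\<alpha> y - \<alpha> t) /\<^sub>R (y - t) - \<gamma> t $ 1 * (((\<gamma> y - \<gamma> t) /\<^sub>R (y - t)) $ 2)
            = (\<alpha> y - \<alpha> t - \<gamma> t $ 1 * (\<gamma> y $ 2 - \<gamma> t $ 2)) / (y - t)"
          by (simp add: divide_inverse algebra_simps)
        moreover have "\<bar>\<alpha> y - \<alpha> t - \<gamma> t $ 1 * (\<gamma> y $ 2 - \<gamma> t $ 2)\<bar> \<le> K * (y - t) * (y - t)"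
          using incr[of t y] t elim by (simp add: power2_eq_square mult.assoc)
        ultimately show ?case using elim by (simp add: abs_divide pos_divide_le_eq)
      qed
    qed
    ultimately have "velocity \<alpha> t - \<gamma> t $ 1 * velocity \<gamma> t $ 2 = 0"
      using tendsto_unique trivial_limit_at_right_real by blast
    then show ?thesis by simp
  qed
  then have "ae_between a b (\<lambda>t. \<gamma> t $ 1 * velocity \<gamma> t $ 2 = velocity \<alpha> t)"
    by (intro ae_between_mp2[OF lipschitz_velocity_ae[OF lip ab] lipschitz_velocity_ae[OF \<alpha> ab]]) auto
  then have "area a b \<gamma> = integral {a..b} (velocity \<alpha>)"
    unfolding area_velocity by (rule integral_cong_ae)
  also have "\<dots> = \<alpha> b - \<alpha> a" using lipschitz_ftc[OF \<alpha> ab, of a b] ab by (intro integral_unique) auto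
  finally show ?thesis .
qed

text \<open>A continuously differentiable function is Lipschitz on the bounded region that the curve stays in,
  so its restriction to the curve is again covered by the calculus of Lipschitz functions.\<close>

lemma ftc_along_curve:
  fixes \<gamma> :: "real \<Rightarrow> 'a::euclidean_space" and \<psi> :: "'a \<Rightarrow> real"
  assumes lip: "L-lipschitz_on {a..b} \<gamma>" and ab: "a \<le> b"
    and D: "\<And>p. (\<psi> has_derivative D p) (at p)"
    and cont: "continuous_on UNIV (\<lambda>x. D (fst x) (snd x))"
  shows "((\<lambda>t. D (\<gamma> t) (velocity \<gamma> t)) has_integral \<psi> (\<gamma> b) - \<psi> (\<gamma> a)) {a..b}"
proof -
  have "compact (\<gamma> ` {a..b})"
    by (intro compact_continuous_image lipschitz_on_continuous_on[OF lip]) auto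
  then obtain R where R: "\<And>t. t \<in> {a..b} \<Longrightarrow> norm (\<gamma> t) \<le> R"
    using compact_imp_bounded[of "\<gamma> ` {a..b}"] unfolding bounded_iff ball_simps by blast
  have "compact ((\<lambda>x. D (fst x) (snd x)) ` (cball (0::'a) R \<times> cball (0::'a) 1))"
    by (intro compact_continuous_image compact_Times continuous_on_subset[OF cont]) auto
  from compact_imp_bounded[OF this] obtain B
    where B: "\<And>p v. norm p \<le> R \<Longrightarrow> norm v \<le> 1 \<Longrightarrow> \<bar>D p v\<bar> \<le> B"
    unfolding bounded_iff by (force simp: image_iff)
  have onorm: "onorm (D p) \<le> B" if "p \<in> cball 0 R" for p
  proof (rule onorm_le)
    interpret bl: bounded_linear "D p" using D by (rule has_derivative_bounded_linear)
    fix v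
    show "norm (D p v) \<le> B * norm v"
    proof (cases "v = 0")
      case False
      have "\<bar>D p (v /\<^sub>R norm v)\<bar> \<le> B" by (rule B) (use that False in auto)
      then show ?thesis using False by (simp add: bl.scaleR abs_mult field_simps)
    qed (simp add: bl.zero)
  qed
  have B0: "0 \<le> B" if "{a..b} \<noteq> {}"
  proof -
    have "norm (\<gamma> a) \<le> R" using R that by auto
    then show ?thesis using B[of "\<gamma> a" 0] by force
  qed
  have "B-lipschitz_on (cball 0 R) \<psi>"
  proof (rule lipschitz_onI)
    fix x y :: 'a assume xy: "x \<in> cball 0 R" "y \<in> cball 0 R"
    show "dist (\<psi> x) (\<psi> y) \<le> B * dist x y"
      using differentiable_bound[OF convex_cball has_derivative_at_withinI[OF D] onorm xy(1,2)]
      by (auto simp: dist_norm)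
  qed (use B0 ab in auto)
  then have "B-lipschitz_on (\<gamma> ` {a..b}) \<psi>" by (rule lipschitz_on_subset) (use R in auto)
  from lipschitz_on_compose[OF lip this] have lip2: "(B * L)-lipschitz_on {a..b} (\<lambda>t. \<psi> (\<gamma> t))"
    by (simp add: o_def)
  have "velocity (\<lambda>t. \<psi> (\<gamma> t)) t = D (\<gamma> t) (velocity \<gamma> t)"
    if "(\<gamma> has_vector_derivative velocity \<gamma> t) (at t)" for t
  proof (rule vector_derivative_at)
    interpret bl: bounded_linear "D (\<gamma> t)" using D by (rule has_derivative_bounded_linear)
    show "((\<lambda>t. \<psi> (\<gamma> t)) has_vector_derivative D (\<gamma> t) (velocity \<gamma> t)) (at t)"
      using has_derivative_compose[OF that[unfolded has_vector_derivative_def] D]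
      unfolding has_vector_derivative_def by (simp add: bl.scaleR)
  qed
  then have ae: "ae_between a b (\<lambda>t. velocity (\<lambda>t. \<psi> (\<gamma> t)) t = D (\<gamma> t) (velocity \<gamma> t))"
    by (intro ae_between_mono[OF lipschitz_velocity_ae[OF lip ab]]) blast
  have "(velocity (\<lambda>t. \<psi> (\<gamma> t)) has_integral \<psi> (\<gamma> b) - \<psi> (\<gamma> a)) {a..b}"
    using lipschitz_ftc[OF lip2 ab, of a b] ab by simp
  with integral_cong_ae[OF ae] show ?thesis
    by (metis has_integral_iff)
qed

lemma concat_curves:
  fixes \<gamma> \<eta> :: "real \<Rightarrow> real ^ 2"
  assumes \<gamma>: "L-lipschitz_on {a..c} \<gamma>" and \<eta>: "M-lipschitz_on {c..b} \<eta>"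
    and c: "a \<le> c" "c \<le> b" "\<gamma> c = \<eta> c"
  defines "\<zeta> \<equiv> \<lambda>t. if t \<le> c then \<gamma> t else \<eta> t"
  shows lipschitz_concat: "\<exists>K. K-lipschitz_on {a..b} \<zeta>"
    and energy_concat: "continuous_on UNIV F \<Longrightarrow> energy F a b \<zeta> = energy F a c \<gamma> + energy F c b \<eta>"
    and area_concat: "area a b \<zeta> = area a c \<gamma> + area c b \<eta>"
proof -
  have lip: "(max L M)-lipschitz_on {a..b} \<zeta>"
    unfolding \<zeta>_def by (rule lipschitz_on_concat_max[OF \<gamma> \<eta> c(3)])
  then show "\<exists>K. K-lipschitz_on {a..b} \<zeta>" by blast
  have 1: "\<zeta> t = \<gamma> t" if "t \<in> {a..c}" for t using that by (simp add: \<zeta>_def)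
  have 2: "\<zeta> t = \<eta> t" if "t \<in> {c..b}" for t using that c(3) by (auto simp: \<zeta>_def)
  show "energy F a b \<zeta> = energy F a c \<gamma> + energy F c b \<eta>" if "continuous_on UNIV F"
    using energy_split[OF lip that, of a c b] energy_cong[of a c \<zeta> \<gamma> F, OF 1]
      energy_cong[of c b \<zeta> \<eta> F, OF 2] c by simp
  show "area a b \<zeta> = area a c \<gamma> + area c b \<eta>"
    using area_split[OF lip, of a c b] area_cong[of a c \<zeta> \<gamma>, OF 1] area_cong[of c b \<zeta> \<eta>, OF 2] c by simp
qed

definition segment_curve :: "real ^ 2 \<Rightarrow> real ^ 2 \<Rightarrow> real \<Rightarrow> real \<Rightarrow> real \<Rightarrow> real ^ 2" where
  "segment_curve p q a b t = p + ((t - a) / (b - a)) *\<^sub>R (q - p)"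

lemma segment_curve_start [simp]: "segment_curve p q a b a = p"
  by (simp add: segment_curve_def)

lemma segment_curve_end [simp]: "a < b \<or> p = q \<Longrightarrow> segment_curve p q a b b = q"
  by (auto simp: segment_curve_def)

lemma segment_curve_lipschitz:
  assumes "a \<le> b"
  shows "(norm (q - p) / (b - a))-lipschitz_on S (segment_curve p q a b)"
proof (rule lipschitz_onI)
  fix s t
  have "segment_curve p q a b s - segment_curve p q a b t = ((s - t) / (b - a)) *\<^sub>R (q - p)"
    by (simp add: segment_curve_def algebra_simps diff_divide_distrib)
  then show "dist (segment_curve p q a b s) (segment_curve p q a b t) \<le> norm (q - p) / (b - a) * dist s t"
    using assms by (simp add: dist_norm abs_divide mult.commute)
qed (use assms in auto)

lemma norm_segment_curve:
  assumes "a \<le> t" "t \<le> b"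
  shows "norm (segment_curve p q a b t - p) \<le> norm (q - p)"
    and "norm (segment_curve p q a b t - q) \<le> norm (q - p)"
proof -
  let ?r = "(t - a) / (b - a)"
  have r: "0 \<le> ?r" "?r \<le> 1" using assms by (auto simp: divide_le_eq_1)
  show "norm (segment_curve p q a b t - p) \<le> norm (q - p)"
    using mult_right_mono[OF r(2), of "norm (q - p)"] r(1) by (simp add: segment_curve_def abs_of_nonneg del: abs_divide)
  have "segment_curve p q a b t - q = - ((1 - ?r) *\<^sub>R (q - p))"
    by (simp add: segment_curve_def algebra_simps)
  then have "norm (segment_curve p q a b t - q) = (1 - ?r) * norm (q - p)" using r by simp
  also have "\<dots> \<le> 1 * norm (q - p)" using r by (intro mult_right_mono) auto
  finally show "norm (segment_curve p q a b t - q) \<le> norm (q - p)" by simp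
qed

lemma energy_segment_curve_le:
  assumes F: "continuous_on UNIV F" and ab: "a \<le> b"
    and K: "\<And>t. a \<le> t \<Longrightarrow> t \<le> b \<Longrightarrow> F (segment_curve p q a b t) \<le> K" "0 \<le> K"
  shows "energy F a b (segment_curve p q a b) \<le> K * norm (q - p)"
proof -
  have "energy F a b (segment_curve p q a b) \<le> K * (norm (q - p) / (b - a)) * (b - a)"
    using energy_le_lipschitz[OF segment_curve_lipschitz[OF ab] F _ ab _ _ K(2), of a b] K(1) by simp
  also have "\<dots> \<le> K * norm (q - p)" using K(2) by simp
  finally show ?thesis .
qed

text \<open>The constant \<open>m\<close> may be negative; this spares a case distinction when the lemma is applied to
  \<open>F(\<gamma> s) - \<epsilon>\<close>.\<close>

lemma energy_ge_displacement:
  fixes \<gamma> :: "real \<Rightarrow> real ^ 2"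
  assumes lip: "L-lipschitz_on {a..b} \<gamma>" and F: "continuous_on UNIV F" and F0: "\<And>p. 0 \<le> F p"
    and st: "a \<le> s" "s \<le> t" "t \<le> b" and m: "\<And>u. s < u \<Longrightarrow> u < t \<Longrightarrow> m \<le> F (\<gamma> u)"
  shows "m * norm (\<gamma> t - \<gamma> s) \<le> energy F s t \<gamma>"
proof (cases "0 \<le> m")
  case True
  have "m * norm (\<gamma> t - \<gamma> s) \<le> m * energy (\<lambda>_. 1) s t \<gamma>"
    by (intro mult_left_mono displacement_le_length[OF lip] st True)
  also have "\<dots> = energy (\<lambda>_. m) s t \<gamma>" by (simp add: energy_velocity)
  also have "\<dots> \<le> energy F s t \<gamma>" by (intro energy_le[OF lip] F st m) auto
  finally show ?thesis .
next
  case False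
  then have "m * norm (\<gamma> t - \<gamma> s) \<le> 0" by (simp add: mult_nonpos_nonneg)
  also have "0 \<le> energy F s t \<gamma>" by (intro energy_nonneg F0)
  finally show ?thesis .
qed

text \<open>Both factors of \<open>\<integral> (\<gamma>\<^sub>1 - \<gamma>\<^sub>1(r)) \<gamma>\<^sub>2' dt\<close> are controlled by the length, which explains the square. The
  base point \<open>r\<close> is arbitrary so that the estimate also applies to reversed curves, whose left end
  point is the right end point of the original.\<close>

lemma area_increment:
  fixes \<gamma> :: "real \<Rightarrow> real ^ 2"
  assumes lip: "L-lipschitz_on {a..b} \<gamma>" and st: "a \<le> s" "s \<le> r" "r \<le> t" "t \<le> b"
  shows "\<bar>area s t \<gamma> - \<gamma> r $ 1 * (\<gamma> t $ 2 - \<gamma> s $ 2)\<bar> \<le> (energy (\<lambda>_. 1) s t \<gamma>)\<^sup>2"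
proof -
  let ?l = "energy (\<lambda>_. 1) s t \<gamma>"
  have len0: "0 \<le> energy (\<lambda>_. 1) u v \<gamma>" for u v by (rule energy_nonneg) simp
  have osc: "norm (\<gamma> u - \<gamma> r) \<le> ?l" if u: "s \<le> u" "u \<le> t" for u
  proof (cases "r \<le> u")
    case True
    have "norm (\<gamma> u - \<gamma> r) \<le> energy (\<lambda>_. 1) r u \<gamma>"
      using True st u by (intro displacement_le_length[OF lip]) auto
    also have "\<dots> \<le> ?l"
      using energy_split[OF lip, of "\<lambda>_. 1" s r t] energy_split[OF lip, of "\<lambda>_. 1" r u t] st u True
        len0[of s r] len0[of u t] by simp
    finally show ?thesis .
  next
    case False
    then have "norm (\<gamma> r - \<gamma> u) \<le> energy (\<lambda>_. 1) u r \<gamma>"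
      using st u by (intro displacement_le_length[OF lip]) auto
    also have "\<dots> \<le> ?l"
      using energy_split[OF lip, of "\<lambda>_. 1" s u t] energy_split[OF lip, of "\<lambda>_. 1" u r t] st u False
        len0[of s u] len0[of r t] by simp
    finally show ?thesis by (simp add: norm_minus_commute)
  qed
  have v: "((\<lambda>u. velocity \<gamma> u $ 2) has_integral (\<gamma> t $ 2 - \<gamma> s $ 2)) {s..t}"
    using has_integral_linear[OF lipschitz_ftc[OF lip, of s t] bounded_linear_vec_nth[of 2]] st
    by (simp add: o_def)
  have ar: "((\<lambda>u. \<gamma> u $ 1 * velocity \<gamma> u $ 2) has_integral area s t \<gamma>) {s..t}"
    unfolding area_velocity using area_integrable[OF lip, of s t] st by (intro integrable_integral) auto
  have dif: "((\<lambda>u. (\<gamma> u $ 1 - \<gamma> r $ 1) * velocity \<gamma> u $ 2) has_integral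
      (area s t \<gamma> - \<gamma> r $ 1 * (\<gamma> t $ 2 - \<gamma> s $ 2))) {s..t}"
    using has_integral_diff[OF ar has_integral_mult_right[OF v, of "\<gamma> r $ 1"]] by (simp add: algebra_simps)
  have "norm (integral {s..t} (\<lambda>u. (\<gamma> u $ 1 - \<gamma> r $ 1) * velocity \<gamma> u $ 2))
      \<le> integral {s..t} (\<lambda>u. ?l * norm (velocity \<gamma> u))"
  proof (rule integral_norm_bound_integral)
    show "(\<lambda>u. (\<gamma> u $ 1 - \<gamma> r $ 1) * velocity \<gamma> u $ 2) integrable_on {s..t}"
      using dif by (rule has_integral_integrable)
    show "(\<lambda>u. ?l * norm (velocity \<gamma> u)) integrable_on {s..t}"
      using energy_integrable[OF lip, of "\<lambda>_. ?l" s t] st by simp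
    fix u assume u: "u \<in> {s..t}"
    have "\<bar>\<gamma> u $ 1 - \<gamma> r $ 1\<bar> \<le> ?l"
      using component_le_norm_cart[of "\<gamma> u - \<gamma> r" 1] osc[of u] u by simp
    then show "norm ((\<gamma> u $ 1 - \<gamma> r $ 1) * velocity \<gamma> u $ 2) \<le> ?l * norm (velocity \<gamma> u)"
      using component_le_norm_cart[of "velocity \<gamma> u" 2] by (simp add: abs_mult mult_mono)
  qed
  also have "\<dots> = ?l * ?l" by (simp add: energy_velocity)
  finally show ?thesis using integral_unique[OF dif] by (simp add: power2_eq_square)
qed

lemma lipschitz_energy_from_start:
  fixes \<gamma> :: "real \<Rightarrow> real ^ 2"
  assumes lip: "L-lipschitz_on {a..b} \<gamma>" and F: "continuous_on UNIV F" and F0: "\<And>p. 0 \<le> F p"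
  shows "\<exists>M. M-lipschitz_on {a..b} (\<lambda>t. energy F a t \<gamma>)"
proof -
  have "compact (F ` \<gamma> ` {a..b})"
    by (intro compact_continuous_image continuous_on_subset[OF F] lipschitz_on_continuous_on[OF lip]) auto
  then obtain K where K: "\<And>t. t \<in> {a..b} \<Longrightarrow> norm (F (\<gamma> t)) \<le> K"
    using compact_imp_bounded[of "F ` \<gamma> ` {a..b}"] unfolding bounded_iff ball_simps by blast
  have L: "0 \<le> L" using lip by (rule lipschitz_on_nonneg)
  have "(max K 0 * L)-lipschitz_on {a..b} (\<lambda>t. energy F a t \<gamma>)"
  proof (rule lipschitz_on_leI)
    fix s t assume st: "s \<in> {a..b}" "t \<in> {a..b}" "s \<le> t"
    have "energy F a t \<gamma> - energy F a s \<gamma> = energy F s t \<gamma>"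
      using energy_split[OF lip F, of a s t] st by simp
    moreover have "energy F s t \<gamma> \<le> max K 0 * L * (t - s)"
      using st K by (intro energy_le_lipschitz[OF lip F]) (auto simp: le_max_iff_disj abs_le_iff)
    moreover have "0 \<le> energy F s t \<gamma>" by (intro energy_nonneg F0)
    ultimately show "dist (energy F a s \<gamma>) (energy F a t \<gamma>) \<le> max K 0 * L * dist s t"
      using st by (simp add: dist_real_def)
  qed (use L in simp)
  then show ?thesis by blast
qed

lemma length_le_lipschitz:
  fixes \<gamma> :: "real \<Rightarrow> real ^ 2"
  assumes lip: "L-lipschitz_on {a..b} \<gamma>" and st: "a \<le> s" "s \<le> t" "t \<le> b"
  shows "energy (\<lambda>_. 1) s t \<gamma> \<le> L * (t - s)"
  using energy_le_lipschitz[OF lip, of "\<lambda>_. 1" s t 1] st by simp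

lemma area_increment_lipschitz:
  fixes \<gamma> :: "real \<Rightarrow> real ^ 2"
  assumes lip: "L-lipschitz_on {a..b} \<gamma>" and st: "a \<le> s" "s \<le> r" "r \<le> t" "t \<le> b"
  shows "\<bar>area s t \<gamma> - \<gamma> r $ 1 * (\<gamma> t $ 2 - \<gamma> s $ 2)\<bar> \<le> L\<^sup>2 * (t - s)\<^sup>2"
proof -
  have "(energy (\<lambda>_. 1) s t \<gamma>)\<^sup>2 \<le> (L * (t - s))\<^sup>2"
    using length_le_lipschitz[OF lip, of s t] st by (intro power_mono energy_nonneg) auto
  then show ?thesis using area_increment[OF lip st] by (simp add: power_mult_distrib)
qed

lemma lipschitz_area_from_start:
  fixes \<gamma> :: "real \<Rightarrow> real ^ 2"
  assumes lip: "L-lipschitz_on {a..b} \<gamma>"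
  shows "\<exists>M. M-lipschitz_on {a..b} (\<lambda>t. area a t \<gamma>)"
proof -
  have "compact (\<gamma> ` {a..b})"
    by (intro compact_continuous_image lipschitz_on_continuous_on[OF lip]) auto
  then obtain R where R: "\<And>t. t \<in> {a..b} \<Longrightarrow> norm (\<gamma> t) \<le> R"
    using compact_imp_bounded[of "\<gamma> ` {a..b}"] unfolding bounded_iff ball_simps by blast
  have L: "0 \<le> L" using lip by (rule lipschitz_on_nonneg)
  have "(max R 0 * L + L\<^sup>2 * \<bar>b - a\<bar>)-lipschitz_on {a..b} (\<lambda>t. area a t \<gamma>)"
  proof (rule lipschitz_on_leI)
    fix s t assume st: "s \<in> {a..b}" "t \<in> {a..b}" "s \<le> t"
    have "area a t \<gamma> - area a s \<gamma> = area s t \<gamma>"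
      using area_split[OF lip, of a s t] st by simp
    moreover have "\<bar>area s t \<gamma> - \<gamma> s $ 1 * (\<gamma> t $ 2 - \<gamma> s $ 2)\<bar> \<le> L\<^sup>2 * (t - s)\<^sup>2"
      using st by (intro area_increment_lipschitz[OF lip]) auto
    moreover have "\<bar>\<gamma> s $ 1 * (\<gamma> t $ 2 - \<gamma> s $ 2)\<bar> \<le> max R 0 * (L * (t - s))"
    proof -
      have "\<bar>\<gamma> s $ 1\<bar> \<le> max R 0"
        using component_le_norm_cart[of "\<gamma> s" 1] R[of s] st by simp
      moreover have "\<bar>\<gamma> t $ 2 - \<gamma> s $ 2\<bar> \<le> L * (t - s)"
        using component_le_norm_cart[of "\<gamma> t - \<gamma> s" 2] lipschitz_onD[OF lip, of t s] st
        by (simp add: dist_norm)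
      ultimately show ?thesis by (auto simp: abs_mult intro!: mult_mono)
    qed
    moreover have "L\<^sup>2 * (t - s)\<^sup>2 \<le> L\<^sup>2 * \<bar>b - a\<bar> * (t - s)"
      using mult_left_mono[OF mult_right_mono[of "t - s" "\<bar>b - a\<bar>" "t - s"], of "L\<^sup>2"] st
      by (simp add: power2_eq_square[of "t - s"] mult.assoc)
    ultimately have "\<bar>area a t \<gamma> - area a s \<gamma>\<bar> \<le> max R 0 * L * (t - s) + L\<^sup>2 * \<bar>b - a\<bar> * (t - s)"
      by (simp add: mult.assoc)
    then show "dist (area a s \<gamma>) (area a t \<gamma>) \<le> (max R 0 * L + L\<^sup>2 * \<bar>b - a\<bar>) * dist s t"
      using st by (simp add: dist_real_def abs_minus_commute algebra_simps)
  qed (use L in simp)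
  then show ?thesis by blast
qed

text \<open>Reversal turns a statement about the initial well into one about the final well. The inequality
  suffices since it can be applied to the reversed curve as well.\<close>

lemma reversed_curve:
  fixes \<gamma> :: "real \<Rightarrow> real ^ 2"
  assumes J: "joins p q a b \<gamma>"
  defines "\<rho> \<equiv> \<lambda>t. \<gamma> (a + b - t)"
  shows joins_reverse: "joins q p a b \<rho>"
    and energy_reverse_le: "\<lbrakk>continuous_on UNIV F; \<And>p. 0 \<le> F p\<rbrakk> \<Longrightarrow> energy F a b \<rho> \<le> energy F a b \<gamma>"
    and area_reverse: "area a b \<rho> = - area a b \<gamma>"
proof -
  obtain L where lip: "L-lipschitz_on {a..b} \<gamma>" and ab: "a < b" and pq: "\<gamma> a = p" "\<gamma> b = q"
    using J by (auto simp: joins_iff)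
  have rev: "M-lipschitz_on {a..b} (\<lambda>t. f (a + b - t))" if "M-lipschitz_on {a..b} f"
    for M and f :: "real \<Rightarrow> 'b::metric_space"
  proof (rule lipschitz_onI)
    fix s t assume "s \<in> {a..b}" "t \<in> {a..b}"
    then show "dist (f (a + b - s)) (f (a + b - t)) \<le> M * dist s t"
      using lipschitz_onD[OF that, of "a + b - s" "a + b - t"] by (auto simp: dist_real_def abs_minus_commute)
  qed (rule lipschitz_on_nonneg[OF that])
  have lipr: "L-lipschitz_on {a..b} \<rho>" unfolding \<rho>_def by (rule rev[OF lip])
  then show "joins q p a b \<rho>" using ab pq by (auto simp: joins_iff \<rho>_def)
  show "energy F a b \<rho> \<le> energy F a b \<gamma>" if F: "continuous_on UNIV F" and F0: "\<And>p. 0 \<le> F p"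
  proof -
    obtain M where M: "M-lipschitz_on {a..b} (\<lambda>t. energy F a t \<gamma>)"
      using lipschitz_energy_from_start[OF lip F F0] by blast
    have uc: "uniformly_continuous_on {a..b} (\<lambda>t. F (\<rho> t))"
      by (intro compact_uniformly_continuous continuous_on_compose2[OF F] lipschitz_on_continuous_on[OF lipr]) auto
    have "energy F a b \<rho> \<le> - energy F a (a + b - b) \<gamma> - - energy F a (a + b - a) \<gamma>"
    proof (rule energy_le_of_increments[OF lipr lipschitz_on_minus[OF rev[OF M]] less_imp_le[OF ab] F])
      fix \<epsilon> :: real assume "\<epsilon> > 0"
      then obtain d where d: "d > 0" "\<And>s t. s \<in> {a..b} \<Longrightarrow> t \<in> {a..b} \<Longrightarrow> dist t s < d \<Longrightarrow>
          dist (F (\<rho> t)) (F (\<rho> s)) < \<epsilon>"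
        using uc unfolding uniformly_continuous_on_def by metis
      show "\<exists>d>0. \<forall>s t. a \<le> s \<and> s \<le> t \<and> t \<le> b \<and> t - s < d \<longrightarrow>
          (F (\<rho> s) - \<epsilon>) * norm (\<rho> t - \<rho> s)
          \<le> - energy F a (a + b - t) \<gamma> - - energy F a (a + b - s) \<gamma>"
      proof (intro exI[of _ d] conjI allI impI d(1))
        fix s t assume st: "a \<le> s \<and> s \<le> t \<and> t \<le> b \<and> t - s < d"
        have "(F (\<rho> s) - \<epsilon>) * norm (\<gamma> (a + b - s) - \<gamma> (a + b - t)) \<le> energy F (a + b - t) (a + b - s) \<gamma>"
        proof (rule energy_ge_displacement[OF lip F F0])
          fix u assume u: "a + b - t < u" "u < a + b - s"
          then have "dist (F (\<rho> (a + b - u))) (F (\<rho> s)) < \<epsilon>"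
            using st by (intro d(2)) (auto simp: dist_real_def)
          then show "F (\<rho> s) - \<epsilon> \<le> F (\<gamma> u)" by (simp add: \<rho>_def dist_real_def)
        qed (use st in auto)
        moreover have "energy F a (a + b - s) \<gamma> = energy F a (a + b - t) \<gamma> + energy F (a + b - t) (a + b - s) \<gamma>"
          using st by (intro energy_split[OF lip F]) auto
        ultimately show "(F (\<rho> s) - \<epsilon>) * norm (\<rho> t - \<rho> s)
          \<le> - energy F a (a + b - t) \<gamma> - - energy F a (a + b - s) \<gamma>"
          by (simp add: \<rho>_def norm_minus_commute)
      qed
    qed
    then show ?thesis by (simp add: energy_velocity)
  qed
  obtain M where M: "M-lipschitz_on {a..b} (\<lambda>t. area a t \<gamma>)"
    using lipschitz_area_from_start[OF lip] by blast
  have "area a b \<rho> = area a (a + b - b) \<gamma> - area a (a + b - a) \<gamma>"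
  proof (rule area_eq_of_increments[OF lipr rev[OF M] less_imp_le[OF ab]])
    fix s t assume st: "a \<le> s" "s \<le> t" "t \<le> b"
    have "area a (a + b - s) \<gamma> = area a (a + b - t) \<gamma> + area (a + b - t) (a + b - s) \<gamma>"
      using st by (intro area_split[OF lip]) auto
    moreover have "\<bar>area (a + b - t) (a + b - s) \<gamma> - \<gamma> (a + b - s) $ 1 * (\<gamma> (a + b - s) $ 2 - \<gamma> (a + b - t) $ 2)\<bar>
        \<le> L\<^sup>2 * ((a + b - s) - (a + b - t))\<^sup>2"
      using st by (intro area_increment_lipschitz[OF lip]) auto
    ultimately show "\<bar>area a (a + b - t) \<gamma> - area a (a + b - s) \<gamma> - \<rho> s $ 1 * (\<rho> t $ 2 - \<rho> s $ 2)\<bar> \<le> L\<^sup>2 * (t - s)\<^sup>2"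
      by (simp add: \<rho>_def algebra_simps abs_minus_commute)
  qed
  then show "area a b \<rho> = - area a b \<gamma>" by (simp add: area_velocity)
qed

section \<open>Compactness of curves of bounded length\<close>

text \<open>The curve is reparametrized on \<open>[0, 1]\<close> proportionally to its length, and the energy \<open>g\<close> and the
  area \<open>\<alpha>\<close> accumulated so far are carried along. All three functions are Lipschitz with constants that
  depend on the length and the region only, and the last two properties are the conditions on increments
  that bound the energy and determine the area of a curve. The new parameter need not be unique, since the curve may
  rest; any choice works because the curve does not move in between.\<close>

lemma constant_speed_lift:
  fixes \<gamma> :: "real \<Rightarrow> real ^ 2"
  assumes J: "joins p q a b \<gamma>" and pq: "p \<noteq> q"
    and F: "continuous_on UNIV F" and F0: "\<And>p. 0 \<le> F p"
    and len: "energy (\<lambda>_. 1) a b \<gamma> \<le> \<Lambda>"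
    and K: "\<And>x. norm x \<le> norm p + \<Lambda> \<Longrightarrow> F x \<le> K"
  obtains \<eta> :: "real \<Rightarrow> real ^ 2" and g \<alpha> :: "real \<Rightarrow> real"
  where "\<eta> 0 = p" "\<eta> 1 = q" "g 0 = 0" "g 1 = energy F a b \<gamma>" "\<alpha> 0 = 0" "\<alpha> 1 = area a b \<gamma>"
    "\<And>u. u \<in> {0..1} \<Longrightarrow> norm (\<eta> u) \<le> norm p + \<Lambda>"
    "\<And>u v. 0 \<le> u \<Longrightarrow> u \<le> v \<Longrightarrow> v \<le> 1 \<Longrightarrow> norm (\<eta> v - \<eta> u) \<le> \<Lambda> * (v - u)"
    "\<And>u v. 0 \<le> u \<Longrightarrow> u \<le> v \<Longrightarrow> v \<le> 1 \<Longrightarrow> \<bar>g v - g u\<bar> \<le> K * \<Lambda> * (v - u)"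
    "\<And>u v. 0 \<le> u \<Longrightarrow> u \<le> v \<Longrightarrow> v \<le> 1 \<Longrightarrow>
        \<bar>\<alpha> v - \<alpha> u - \<eta> u $ 1 * (\<eta> v $ 2 - \<eta> u $ 2)\<bar> \<le> \<Lambda>\<^sup>2 * (v - u)\<^sup>2"
    "\<And>u v m. 0 \<le> u \<Longrightarrow> u \<le> v \<Longrightarrow> v \<le> 1 \<Longrightarrow>
        (\<And>x. norm x \<le> norm p + \<Lambda> \<Longrightarrow> norm (x - \<eta> u) \<le> \<Lambda> * (v - u) \<Longrightarrow> m \<le> F x) \<Longrightarrow>
        m * norm (\<eta> v - \<eta> u) \<le> g v - g u"
proof -
  obtain L where lip: "L-lipschitz_on {a..b} \<gamma>" and ab: "a < b" and pq': "\<gamma> a = p" "\<gamma> b = q"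
    using J by (auto simp: joins_iff)
  let ?len = "\<lambda>s t. energy (\<lambda>_. 1) s t \<gamma>"
  define S where "S = ?len a b"
  have len0: "0 \<le> ?len s t" for s t by (intro energy_nonneg) simp
  have "norm (q - p) \<le> S"
    using displacement_le_length[OF lip, of a b] ab pq' by (simp add: S_def)
  then have S: "0 < S" using pq by (metis eq_iff_diff_eq_0 less_le_trans zero_less_norm_iff)
  obtain M where "M-lipschitz_on {a..b} (?len a)"
    using lipschitz_energy_from_start[OF lip, of "\<lambda>_. 1"] by auto
  then have cont: "continuous_on {a..b} (?len a)" by (rule lipschitz_on_continuous_on)
  have "\<exists>t\<in>{a..b}. ?len a t = u * S \<and> (u = 0 \<longrightarrow> t = a) \<and> (u = 1 \<longrightarrow> t = b)" if u: "u \<in> {0..1}" for u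
  proof -
    have la: "?len a a = 0" by (simp add: energy_velocity)
    consider "u = 0" | "u = 1" | "u \<noteq> 0" "u \<noteq> 1" by blast
    then show ?thesis
    proof cases
      case 1 then show ?thesis using la ab by (intro bexI[of _ a]) auto
    next
      case 2 then show ?thesis using ab by (intro bexI[of _ b]) (auto simp: S_def)
    next
      case 3
      have "u * S \<le> 1 * S" using u S by (intro mult_right_mono) auto
      then have "?len a a \<le> u * S" "u * S \<le> ?len a b" using u S by (auto simp: la S_def[symmetric])
      from IVT'[OF this less_imp_le[OF ab] cont] 3 show ?thesis by auto
    qed
  qed
  then obtain \<tau> where \<tau>: "\<And>u. u \<in> {0..1} \<Longrightarrow> \<tau> u \<in> {a..b}" "\<And>u. u \<in> {0..1} \<Longrightarrow> ?len a (\<tau> u) = u * S"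
      and \<tau>01: "\<tau> 0 = a" "\<tau> 1 = b"
    by (metis atLeastAtMost_iff order_refl zero_le_one)
  have \<tau>_len: "?len (\<tau> u) (\<tau> v) = (v - u) * S" and \<tau>_mono: "\<tau> u \<le> \<tau> v"
    if uv: "0 \<le> u" "u \<le> v" "v \<le> 1" for u v
  proof -
    show le: "\<tau> u \<le> \<tau> v"
    proof (rule ccontr)
      assume "\<not> \<tau> u \<le> \<tau> v"
      then have "?len a (\<tau> u) = ?len a (\<tau> v) + ?len (\<tau> v) (\<tau> u)"
        using \<tau>(1)[of u] \<tau>(1)[of v] uv by (intro energy_split[OF lip]) auto
      then have "v * S \<le> u * S" using \<tau>(2)[of u] \<tau>(2)[of v] len0[of "\<tau> v" "\<tau> u"] uv by simp
      then have "u = v" using S uv by simp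
      then show False using \<open>\<not> \<tau> u \<le> \<tau> v\<close> by simp
    qed
    have "?len a (\<tau> v) = ?len a (\<tau> u) + ?len (\<tau> u) (\<tau> v)"
      using \<tau>(1)[of u] \<tau>(1)[of v] uv le by (intro energy_split[OF lip]) auto
    then show "?len (\<tau> u) (\<tau> v) = (v - u) * S"
      using \<tau>(2)[of u] \<tau>(2)[of v] uv by (simp add: algebra_simps)
  qed
  have lenS: "(v - u) * S \<le> \<Lambda> * (v - u)" if "u \<le> v" for u v
    using mult_left_mono[OF len, of "v - u"] that by (simp add: S_def mult.commute)
  have \<Lambda>: "0 \<le> \<Lambda>" using S len by (simp add: S_def)
  have bnd: "norm (\<gamma> t) \<le> norm p + \<Lambda>" if "t \<in> {a..b}" for t
  proof -
    have "norm (\<gamma> t - p) \<le> ?len a t"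
      using displacement_le_length[OF lip, of a t] that pq' by simp
    also have "\<dots> \<le> ?len a b"
      using energy_split[OF lip, of "\<lambda>_. 1" a t b] that len0[of t b] by simp
    finally show ?thesis using len norm_triangle_sub[of "\<gamma> t" p] by simp
  qed
  have gdiff: "energy F a (\<tau> v) \<gamma> - energy F a (\<tau> u) \<gamma> = energy F (\<tau> u) (\<tau> v) \<gamma>"
    if "0 \<le> u" "u \<le> v" "v \<le> 1" for u v
    using energy_split[OF lip F, of a "\<tau> u" "\<tau> v"] \<tau>(1)[of u] \<tau>(1)[of v] \<tau>_mono[OF that] that by simp
  have adiff: "area a (\<tau> v) \<gamma> - area a (\<tau> u) \<gamma> = area (\<tau> u) (\<tau> v) \<gamma>"
    if "0 \<le> u" "u \<le> v" "v \<le> 1" for u v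
    using area_split[OF lip, of a "\<tau> u" "\<tau> v"] \<tau>(1)[of u] \<tau>(1)[of v] \<tau>_mono[OF that] that by simp
  have K0: "0 \<le> K" using K[of p] F0[of p] \<Lambda> by simp
  show thesis
  proof (rule that[of "\<lambda>u. \<gamma> (\<tau> u)" "\<lambda>u. energy F a (\<tau> u) \<gamma>" "\<lambda>u. area a (\<tau> u) \<gamma>"])
    show "energy F a (\<tau> 0) \<gamma> = 0" by (simp add: \<tau>01 energy_velocity)
    show "area a (\<tau> 0) \<gamma> = 0" by (simp add: \<tau>01 area_velocity)
    show "norm (\<gamma> (\<tau> u)) \<le> norm p + \<Lambda>" if "u \<in> {0..1}" for u by (intro bnd \<tau> that)
  next
    fix u v :: real assume uv: "0 \<le> u" "u \<le> v" "v \<le> 1"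
    note t = \<tau>(1)[of u] \<tau>(1)[of v] \<tau>_mono[OF uv]
    show "norm (\<gamma> (\<tau> v) - \<gamma> (\<tau> u)) \<le> \<Lambda> * (v - u)"
      using displacement_le_length[OF lip, of "\<tau> u" "\<tau> v"] t uv \<tau>_len[OF uv] lenS[OF uv(2)] by simp
    have "energy F (\<tau> u) (\<tau> v) \<gamma> \<le> energy (\<lambda>_. K) (\<tau> u) (\<tau> v) \<gamma>"
      using t uv by (intro energy_le[OF lip] F K bnd) auto
    also have "\<dots> = K * ?len (\<tau> u) (\<tau> v)" by (simp add: energy_velocity)
    also have "\<dots> \<le> K * (\<Lambda> * (v - u))" unfolding \<tau>_len[OF uv] by (intro mult_left_mono lenS uv K0)
    finally show "\<bar>energy F a (\<tau> v) \<gamma> - energy F a (\<tau> u) \<gamma>\<bar> \<le> K * \<Lambda> * (v - u)"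
      unfolding gdiff[OF uv] using energy_nonneg[of "\<tau> u" "\<tau> v" F \<gamma>] F0 by simp
    have "(?len (\<tau> u) (\<tau> v))\<^sup>2 \<le> (\<Lambda> * (v - u))\<^sup>2"
      using \<tau>_len[OF uv] lenS[OF uv(2)] len0[of "\<tau> u" "\<tau> v"] by (intro power_mono) auto
    moreover have "\<bar>area (\<tau> u) (\<tau> v) \<gamma> - \<gamma> (\<tau> u) $ 1 * (\<gamma> (\<tau> v) $ 2 - \<gamma> (\<tau> u) $ 2)\<bar> \<le> (?len (\<tau> u) (\<tau> v))\<^sup>2"
      using t uv by (intro area_increment[OF lip]) auto
    ultimately show "\<bar>area a (\<tau> v) \<gamma> - area a (\<tau> u) \<gamma> - \<gamma> (\<tau> u) $ 1 * (\<gamma> (\<tau> v) $ 2 - \<gamma> (\<tau> u) $ 2)\<bar>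
        \<le> \<Lambda>\<^sup>2 * (v - u)\<^sup>2"
      unfolding adiff[OF uv] by (simp add: power_mult_distrib)
    fix m assume m: "\<And>x. norm x \<le> norm p + \<Lambda> \<Longrightarrow> norm (x - \<gamma> (\<tau> u)) \<le> \<Lambda> * (v - u) \<Longrightarrow> m \<le> F x"
    show "m * norm (\<gamma> (\<tau> v) - \<gamma> (\<tau> u)) \<le> energy F a (\<tau> v) \<gamma> - energy F a (\<tau> u) \<gamma>"
      unfolding gdiff[OF uv]
    proof (rule energy_ge_displacement[OF lip F F0])
      fix r assume r: "\<tau> u < r" "r < \<tau> v"
      have "norm (\<gamma> r - \<gamma> (\<tau> u)) \<le> ?len (\<tau> u) r"
        using r t uv by (intro displacement_le_length[OF lip]) auto
      also have "\<dots> \<le> ?len (\<tau> u) (\<tau> v)"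
        using energy_split[OF lip, of "\<lambda>_. 1" "\<tau> u" r "\<tau> v"] r t uv len0[of r "\<tau> v"] by simp
      also have "\<dots> \<le> \<Lambda> * (v - u)" using \<tau>_len[OF uv] lenS[OF uv(2)] by simp
      finally show "m \<le> F (\<gamma> r)" using r t uv by (intro m bnd) auto
    qed (use t uv in auto)
  qed (simp_all add: \<tau>01 pq')
qed

text \<open>By Arzela-Ascoli the lifted triples of curve, accumulated energy and accumulated area have a
  uniformly convergent subsequence. The increment conditions pass to the limit, so that the limit
  curve has area exactly \<open>A\<close> and an energy of at most the limit of the energies.\<close>

theorem bounded_length_curves_limit:
  fixes \<gamma> :: "nat \<Rightarrow> real \<Rightarrow> real ^ 2"
  assumes pq: "p \<noteq> q" and F: "continuous_on UNIV F" and F0: "\<And>p. 0 \<le> F p"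
    and J: "\<And>n. joins p q (a n) (b n) (\<gamma> n)"
    and len: "\<And>n. energy (\<lambda>_. 1) (a n) (b n) (\<gamma> n) \<le> \<Lambda>"
    and E: "\<And>n. energy F (a n) (b n) (\<gamma> n) \<le> e n" and e: "e \<longlonglongrightarrow> c"
    and A: "\<And>n. area (a n) (b n) (\<gamma> n) = A"
  shows "\<exists>\<zeta>. joins p q 0 1 \<zeta> \<and> area 0 1 \<zeta> = A \<and> energy F 0 1 \<zeta> \<le> c"
proof -
  have \<Lambda>: "0 \<le> \<Lambda>"
    using len[of 0] energy_nonneg[of "a 0" "b 0" "\<lambda>_. 1" "\<gamma> 0"] by simp
  define R where "R = norm p + \<Lambda>"
  have R: "0 \<le> R" using \<Lambda> by (simp add: R_def)
  have "compact (F ` cball 0 R)" by (intro compact_continuous_image continuous_on_subset[OF F]) auto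
  then obtain K where "\<And>x. x \<in> cball 0 R \<Longrightarrow> norm (F x) \<le> K"
    using compact_imp_bounded[of "F ` cball 0 R"] unfolding bounded_iff ball_simps by blast
  then have K: "F x \<le> K" if "norm x \<le> norm p + \<Lambda>" for x using that by (force simp: R_def)
  have K0: "0 \<le> K" using K[of p] F0[of p] \<Lambda> by simp
  define Q where "Q n \<eta> g \<alpha> \<longleftrightarrow>
      \<eta> 0 = p \<and> \<eta> 1 = q \<and> g 0 = 0 \<and> g 1 = energy F (a n) (b n) (\<gamma> n) \<and> \<alpha> 0 = 0 \<and> \<alpha> 1 = A \<and>
      (\<forall>u. 0 \<le> u \<longrightarrow> u \<le> 1 \<longrightarrow> norm (\<eta> u) \<le> R) \<and>
      (\<forall>u v. 0 \<le> u \<longrightarrow> u \<le> v \<longrightarrow> v \<le> 1 \<longrightarrow>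
        norm (\<eta> v - \<eta> u) \<le> \<Lambda> * (v - u) \<and> \<bar>g v - g u\<bar> \<le> K * \<Lambda> * (v - u) \<and>
        \<bar>\<alpha> v - \<alpha> u - \<eta> u $ 1 * (\<eta> v $ 2 - \<eta> u $ 2)\<bar> \<le> \<Lambda>\<^sup>2 * (v - u)\<^sup>2 \<and>
        (\<forall>m. (\<forall>x. norm x \<le> R \<longrightarrow> norm (x - \<eta> u) \<le> \<Lambda> * (v - u) \<longrightarrow> m \<le> F x) \<longrightarrow>
          m * norm (\<eta> v - \<eta> u) \<le> g v - g u))"
    for n and \<eta> :: "real \<Rightarrow> real ^ 2" and g \<alpha> :: "real \<Rightarrow> real"
  have "\<exists>\<eta> g \<alpha>. Q n \<eta> g \<alpha>" for n
    apply (rule constant_speed_lift[OF J[of n] pq F F0 len K], assumption)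
    subgoal premises lift for \<eta> g \<alpha>
      unfolding Q_def R_def
      by (rule exI[of _ \<eta>], rule exI[of _ g], rule exI[of _ \<alpha>], intro conjI allI impI)
        (use lift A in auto)
    done
  then obtain \<eta> g \<alpha> where Q: "\<And>n. Q n (\<eta> n) (g n) (\<alpha> n)" by metis
  have ends: "\<eta> n 0 = p" "\<eta> n 1 = q" "g n 0 = 0" "g n 1 = energy F (a n) (b n) (\<gamma> n)"
      "\<alpha> n 0 = 0" "\<alpha> n 1 = A" for n
    using Q[of n] by (auto simp: Q_def)
  have \<eta>R: "norm (\<eta> n u) \<le> R" if "0 \<le> u" "u \<le> 1" for n u
    using Q[of n] that unfolding Q_def by blast
  have \<eta>lip: "norm (\<eta> n v - \<eta> n u) \<le> \<Lambda> * (v - u)"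
    and glip: "\<bar>g n v - g n u\<bar> \<le> K * \<Lambda> * (v - u)"
    and \<alpha>inc: "\<bar>\<alpha> n v - \<alpha> n u - \<eta> n u $ 1 * (\<eta> n v $ 2 - \<eta> n u $ 2)\<bar> \<le> \<Lambda>\<^sup>2 * (v - u)\<^sup>2"
    and ginc: "\<And>m. (\<And>x. norm x \<le> R \<Longrightarrow> norm (x - \<eta> n u) \<le> \<Lambda> * (v - u) \<Longrightarrow> m \<le> F x) \<Longrightarrow>
          m * norm (\<eta> n v - \<eta> n u) \<le> g n v - g n u"
    if "0 \<le> u" "u \<le> v" "v \<le> 1" for n u v
    using Q[of n] that unfolding Q_def by blast+
  define D where "D = \<Lambda> + K * \<Lambda> + (R * \<Lambda> + \<Lambda>\<^sup>2)"
  have D: "0 \<le> D" using \<Lambda> K0 R by (simp add: D_def)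
  define \<Psi> where "\<Psi> n u = (\<eta> n u, g n u, \<alpha> n u)" for n u
  have \<Psi>lip1: "norm (\<Psi> n v - \<Psi> n u) \<le> D * (v - u)" if uv: "0 \<le> u" "u \<le> v" "v \<le> 1" for n u v
  proof -
    have "\<bar>\<eta> n u $ 1 * (\<eta> n v $ 2 - \<eta> n u $ 2)\<bar> \<le> R * (\<Lambda> * (v - u))"
      using component_le_norm_cart[of "\<eta> n u" 1] \<eta>R[of u n] \<eta>lip[OF uv, of n]
        component_le_norm_cart[of "\<eta> n v - \<eta> n u" 2] uv R
      by (auto simp: abs_mult intro!: mult_mono)
    moreover have "\<Lambda>\<^sup>2 * (v - u)\<^sup>2 \<le> \<Lambda>\<^sup>2 * (v - u)"
      using uv by (intro mult_left_mono) (auto simp: power2_eq_square intro: mult_left_le_one_le)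
    ultimately have "\<bar>\<alpha> n v - \<alpha> n u\<bar> \<le> (R * \<Lambda> + \<Lambda>\<^sup>2) * (v - u)"
      using \<alpha>inc[OF uv, of n] by (simp add: algebra_simps)
    moreover have "norm (\<Psi> n v - \<Psi> n u) \<le> norm (\<eta> n v - \<eta> n u) + (\<bar>g n v - g n u\<bar> + \<bar>\<alpha> n v - \<alpha> n u\<bar>)"
      unfolding \<Psi>_def diff_Pair
      by (rule order_trans[OF norm_Pair_le] add_left_mono)+
        (use norm_Pair_le[of "g n v - g n u" "\<alpha> n v - \<alpha> n u"] in simp)
    ultimately show ?thesis using \<eta>lip[OF uv, of n] glip[OF uv, of n] by (simp add: D_def algebra_simps)
  qed
  have \<Psi>lip: "norm (\<Psi> n v - \<Psi> n u) \<le> D * \<bar>v - u\<bar>" if uv: "u \<in> {0..1}" "v \<in> {0..1}" for n u v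
    using \<Psi>lip1[of u v n] \<Psi>lip1[of v u n] uv by (cases "u \<le> v") (auto simp: norm_minus_commute)
  obtain G k where Gk: "strict_mono (k :: nat \<Rightarrow> nat)"
    "\<And>\<epsilon>. 0 < \<epsilon> \<Longrightarrow> \<exists>N. \<forall>n x. n \<ge> N \<and> x \<in> {0..1} \<longrightarrow> norm (\<Psi> (k n) x - G x) < \<epsilon>"
  proof (rule Arzela_Ascoli[of "{0..1::real}" \<Psi> "norm p + D"])
    show "norm (\<Psi> n x) \<le> norm p + D" if "x \<in> {0..1}" for n x
    proof -
      have "norm (\<Psi> n x - \<Psi> n 0) \<le> D * \<bar>x - 0\<bar>" by (intro \<Psi>lip that) auto
      also have "\<dots> \<le> D" using that D by (simp add: mult_left_le)
      finally have "norm (\<Psi> n x - \<Psi> n 0) \<le> D" .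
      moreover have "norm (\<Psi> n 0) = norm p" by (simp add: \<Psi>_def ends norm_Pair)
      ultimately show ?thesis using norm_triangle_sub[of "\<Psi> n x" "\<Psi> n 0"] by simp
    qed
    show "\<exists>d>0. \<forall>n y. y \<in> {0..1} \<and> norm (x - y) < d \<longrightarrow> norm (\<Psi> n x - \<Psi> n y) < \<epsilon>"
      if x: "x \<in> {0..1}" and \<epsilon>: "0 < \<epsilon>" for x \<epsilon>
    proof (intro exI[of _ "\<epsilon> / (D + 1)"] conjI allI impI)
      show "0 < \<epsilon> / (D + 1)" using \<epsilon> D by simp
      fix n y assume y: "y \<in> {0..1} \<and> norm (x - y) < \<epsilon> / (D + 1)"
      have "norm (\<Psi> n x - \<Psi> n y) \<le> D * \<bar>x - y\<bar>" using x y by (intro \<Psi>lip) auto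
      also have "\<dots> \<le> (D + 1) * \<bar>x - y\<bar>" by (intro mult_right_mono) auto
      also have "\<dots> < \<epsilon>" using y D by (simp add: field_simps)
      finally show "norm (\<Psi> n x - \<Psi> n y) < \<epsilon>" .
    qed
  qed (auto intro: that)
  have lim: "(\<lambda>n. \<Psi> (k n) u) \<longlonglongrightarrow> G u" if "0 \<le> u" "u \<le> 1" for u
    unfolding LIMSEQ_iff using Gk(2) that by (metis atLeastAtMost_iff)
  define H where "H u = fst (G u)" for u
  define h where "h u = fst (snd (G u))" for u
  define \<beta> where "\<beta> u = snd (snd (G u))" for u
  have limH: "(\<lambda>n. \<eta> (k n) u) \<longlonglongrightarrow> H u" and limh: "(\<lambda>n. g (k n) u) \<longlonglongrightarrow> h u"
    and lim\<beta>: "(\<lambda>n. \<alpha> (k n) u) \<longlonglongrightarrow> \<beta> u" if "0 \<le> u" "u \<le> 1" for u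
    using tendsto_fst[OF lim[OF that]] tendsto_fst[OF tendsto_snd[OF lim[OF that]]]
      tendsto_snd[OF tendsto_snd[OF lim[OF that]]]
    by (auto simp: \<Psi>_def H_def h_def \<beta>_def)
  have H01: "H 0 = p" "H 1 = q" and h0: "h 0 = 0" and \<beta>01: "\<beta> 0 = 0" "\<beta> 1 = A"
    using limH[of 0] limH[of 1] limh[of 0] lim\<beta>[of 0] lim\<beta>[of 1]
    by (auto simp: ends LIMSEQ_const_iff)
  have Hlip: "\<Lambda>-lipschitz_on {0..1} H"
  proof (rule lipschitz_on_leI)
    fix u v :: real assume uv: "u \<in> {0..1}" "v \<in> {0..1}" "u \<le> v"
    have "norm (H v - H u) \<le> \<Lambda> * (v - u)"
      by (rule LIMSEQ_le_const2[OF tendsto_norm[OF tendsto_diff[OF limH limH]]])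
        (use uv \<eta>lip in auto)
    then show "dist (H u) (H v) \<le> \<Lambda> * dist u v" using uv by (simp add: dist_norm norm_minus_commute)
  qed (rule \<Lambda>)
  have hlip: "(K * \<Lambda>)-lipschitz_on {0..1} h"
  proof (rule lipschitz_on_leI)
    fix u v :: real assume uv: "u \<in> {0..1}" "v \<in> {0..1}" "u \<le> v"
    have "\<bar>h v - h u\<bar> \<le> K * \<Lambda> * (v - u)"
      by (rule LIMSEQ_le_const2[OF tendsto_rabs[OF tendsto_diff[OF limh limh]]])
        (use uv glip in auto)
    then show "dist (h u) (h v) \<le> K * \<Lambda> * dist u v" using uv by (simp add: dist_real_def abs_minus_commute)
  qed (use K0 \<Lambda> in simp)
  have \<beta>lip: "D-lipschitz_on {0..1} \<beta>"
  proof (rule lipschitz_on_leI)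
    fix u v :: real assume uv: "u \<in> {0..1}" "v \<in> {0..1}" "u \<le> v"
    have "\<bar>\<alpha> n v - \<alpha> n u\<bar> \<le> D * (v - u)" for n
    proof -
      have "norm (\<alpha> n v - \<alpha> n u) \<le> norm (g n v - g n u, \<alpha> n v - \<alpha> n u)" by (rule norm_snd_le)
      also have "\<dots> \<le> norm (\<Psi> n v - \<Psi> n u)" unfolding \<Psi>_def diff_Pair by (rule norm_snd_le)
      also have "\<dots> \<le> D * (v - u)" using \<Psi>lip1[of u v n] uv by simp
      finally show ?thesis by simp
    qed
    then have "\<bar>\<beta> v - \<beta> u\<bar> \<le> D * (v - u)"
      by (intro LIMSEQ_le_const2[OF tendsto_rabs[OF tendsto_diff[OF lim\<beta> lim\<beta>]]])
        (use uv in auto)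
    then show "dist (\<beta> u) (\<beta> v) \<le> D * dist u v" using uv by (simp add: dist_real_def abs_minus_commute)
  qed (rule D)
  have "energy F 0 1 H \<le> h 1 - h 0"
  proof (rule energy_le_of_increments[OF Hlip hlip _ F])
    fix \<epsilon> :: real assume \<epsilon>: "\<epsilon> > 0"
    have "uniformly_continuous_on (cball 0 R) F"
      by (intro compact_uniformly_continuous continuous_on_subset[OF F]) auto
    then obtain d where d: "d > 0" "\<And>x y. norm x \<le> R \<Longrightarrow> norm y \<le> R \<Longrightarrow> norm (x - y) < d \<Longrightarrow> \<bar>F x - F y\<bar> < \<epsilon>"
      using \<epsilon> unfolding uniformly_continuous_on_def by (auto simp: dist_norm)
    show "\<exists>d>0. \<forall>u v. 0 \<le> u \<and> u \<le> v \<and> v \<le> 1 \<and> v - u < d \<longrightarrow>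
        (F (H u) - \<epsilon>) * norm (H v - H u) \<le> h v - h u"
    proof (intro exI[of _ "d / (\<Lambda> + 1)"] conjI allI impI)
      show "0 < d / (\<Lambda> + 1)" using d(1) \<Lambda> by simp
      fix u v :: real assume uv: "0 \<le> u \<and> u \<le> v \<and> v \<le> 1 \<and> v - u < d / (\<Lambda> + 1)"
      have "\<Lambda> * (v - u) \<le> (\<Lambda> + 1) * (v - u)" using uv by (intro mult_right_mono) auto
      also have "\<dots> < d" using uv \<Lambda> by (simp add: field_simps)
      finally have small: "\<Lambda> * (v - u) < d" .
      have step: "(F (\<eta> n u) - \<epsilon>) * norm (\<eta> n v - \<eta> n u) \<le> g n v - g n u" for n
      proof (rule ginc)
        fix x assume "norm x \<le> R" "norm (x - \<eta> n u) \<le> \<Lambda> * (v - u)"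
        then show "F (\<eta> n u) - \<epsilon> \<le> F x" using d(2)[of x "\<eta> n u"] \<eta>R[of u n] small uv by auto
      qed (use uv in auto)
      have FH: "(\<lambda>n. F (\<eta> (k n) u)) \<longlonglongrightarrow> F (H u)"
        using continuous_on_tendsto_compose[OF F limH] uv by simp
      have "(\<lambda>n. (F (\<eta> (k n) u) - \<epsilon>) * norm (\<eta> (k n) v - \<eta> (k n) u)) \<longlonglongrightarrow> (F (H u) - \<epsilon>) * norm (H v - H u)"
        using uv by (intro tendsto_intros FH limH) auto
      moreover have "(\<lambda>n. g (k n) v - g (k n) u) \<longlonglongrightarrow> h v - h u"
        using uv by (intro tendsto_intros limh) auto
      ultimately show "(F (H u) - \<epsilon>) * norm (H v - H u) \<le> h v - h u"
        by (rule LIMSEQ_le) (use step in auto)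
    qed
  qed simp
  moreover have "h 1 \<le> c"
  proof (rule LIMSEQ_le[OF limh])
    show "(\<lambda>n. e (k n)) \<longlonglongrightarrow> c" using LIMSEQ_subseq_LIMSEQ[OF e Gk(1)] by (simp add: o_def)
  qed (use E in \<open>auto simp: ends\<close>)
  ultimately have EH: "energy F 0 1 H \<le> c" using h0 by simp
  have "area 0 1 H = \<beta> 1 - \<beta> 0"
  proof (rule area_eq_of_increments[OF Hlip \<beta>lip])
    fix u v :: real assume uv: "0 \<le> u" "u \<le> v" "v \<le> 1"
    have "(\<lambda>n. \<bar>\<alpha> (k n) v - \<alpha> (k n) u - \<eta> (k n) u $ 1 * (\<eta> (k n) v $ 2 - \<eta> (k n) u $ 2)\<bar>)
        \<longlonglongrightarrow> \<bar>\<beta> v - \<beta> u - H u $ 1 * (H v $ 2 - H u $ 2)\<bar>"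
      using uv by (intro tendsto_intros lim\<beta> limH) auto
    then show "\<bar>\<beta> v - \<beta> u - H u $ 1 * (H v $ 2 - H u $ 2)\<bar> \<le> \<Lambda>\<^sup>2 * (v - u)\<^sup>2"
      by (rule LIMSEQ_le_const2) (use \<alpha>inc uv in auto)
  qed simp
  then have "area 0 1 H = A" using \<beta>01 by simp
  moreover have "joins p q 0 1 H" using Hlip H01 by (auto simp: joins_iff)
  ultimately show ?thesis using EH by blast
qed

section \<open>Smooth potentials with nondegenerate zeros\<close>

abbreviation dderiv :: "('a::euclidean_space \<Rightarrow> real) \<Rightarrow> 'a \<Rightarrow> 'a \<Rightarrow> real" where
  "dderiv W x v \<equiv> frechet_derivative W (at x) v"

lemma smoothD:
  assumes "smooth W"
  shows smooth_continuous: "continuous_on UNIV W"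
    and smooth_has_derivative: "(W has_derivative dderiv W x) (at x)"
    and smooth_dderiv: "smooth (\<lambda>x. dderiv W x v)"
proof -
  have k: "times_cont_diff k W" for k using assms by (simp add: smooth_def)
  show "continuous_on UNIV W" using k[of 0] by simp
  show "(W has_derivative dderiv W x) (at x)"
    using k[of "Suc 0"] by (simp add: frechet_derivative_works)
  show "smooth (\<lambda>x. dderiv W x v)"
    unfolding smooth_def using k by (metis times_cont_diff.simps(2))
qed

lemma smooth_has_real_derivative_line:
  fixes W :: "'a::euclidean_space \<Rightarrow> real"
  assumes "smooth W"
  shows "((\<lambda>s. W (x + s *\<^sub>R e)) has_real_derivative dderiv W (x + s *\<^sub>R e) e) (at s)"
proof -
  interpret bl: bounded_linear "dderiv W (x + s *\<^sub>R e)"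
    using smooth_has_derivative[OF assms] by (rule has_derivative_bounded_linear)
  have "((\<lambda>s. x + s *\<^sub>R e) has_derivative (\<lambda>h. h *\<^sub>R e)) (at s)"
    by (auto intro!: derivative_eq_intros)
  from has_derivative_compose[OF this smooth_has_derivative[OF assms]]
  show ?thesis by (simp add: has_field_derivative_def bl.scaleR mult.commute[of _ "dderiv W (x + s *\<^sub>R e) e"])
qed

lemma smooth_quadratic_upper_bound:
  fixes W :: "'a::euclidean_space \<Rightarrow> real"
  assumes W: "smooth W" and K: "compact K"
  shows "\<exists>M\<ge>0. \<forall>x\<in>K. \<forall>s. \<bar>s\<bar> \<le> S \<longrightarrow> W (x + s *\<^sub>R e) \<le> W x + s * dderiv W x e + M * s\<^sup>2"
proof -
  define W2 where "W2 x = dderiv (\<lambda>x. dderiv W x e) x e" for x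
  have W1: "smooth (\<lambda>x. dderiv W x e)" by (rule smooth_dderiv[OF W])
  have contW2: "continuous_on UNIV W2"
    unfolding W2_def by (rule smooth_continuous[OF smooth_dderiv[OF W1]])
  have "compact ((\<lambda>z. W2 (fst z + snd z *\<^sub>R e)) ` (K \<times> {-S..S}))"
    by (intro compact_continuous_image compact_Times K continuous_on_compose2[OF contW2] continuous_intros) auto
  from compact_imp_bounded[OF this] obtain M
    where M: "\<And>x s. x \<in> K \<Longrightarrow> \<bar>s\<bar> \<le> S \<Longrightarrow> \<bar>W2 (x + s *\<^sub>R e)\<bar> \<le> M"
    unfolding bounded_iff by (force simp: image_iff abs_le_iff)
  have "W (x + s *\<^sub>R e) \<le> W x + s * dderiv W x e + max M 0 * s\<^sup>2" if x: "x \<in> K" and s: "\<bar>s\<bar> \<le> S" for x s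
  proof -
    let ?g = "\<lambda>s. W (x + s *\<^sub>R e)" and ?g1 = "\<lambda>s. dderiv W (x + s *\<^sub>R e) e"
    have d1: "(?g has_real_derivative ?g1 s) (at s)" for s by (rule smooth_has_real_derivative_line[OF W])
    have d2: "(?g1 has_real_derivative W2 (x + s *\<^sub>R e)) (at s)" for s
      unfolding W2_def by (rule smooth_has_real_derivative_line[OF W1])
    have mvt: "\<exists>z. \<bar>z\<bar> \<le> \<bar>s\<bar> \<and> f s - f 0 = s * f' z"
      if "\<And>s. (f has_real_derivative f' s) (at s)" for f f' :: "real \<Rightarrow> real" and s
    proof (cases s "0::real" rule: linorder_cases)
      case less
      from MVT2[OF less, of f f'] that obtain z where "s < z" "z < 0" "f 0 - f s = (0 - s) * f' z" by auto
      then show ?thesis by (intro exI[of _ z]) (auto simp: algebra_simps)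
    next
      case greater
      from MVT2[OF greater, of f f'] that obtain z where "0 < z" "z < s" "f s - f 0 = (s - 0) * f' z" by auto
      then show ?thesis by (intro exI[of _ z]) auto
    qed auto
    obtain z where z: "\<bar>z\<bar> \<le> \<bar>s\<bar>" "?g s - ?g 0 = s * ?g1 z" using mvt[of ?g ?g1, OF d1] by blast
    obtain y where y: "\<bar>y\<bar> \<le> \<bar>z\<bar>" "?g1 z - ?g1 0 = z * W2 (x + y *\<^sub>R e)" using mvt[of ?g1, OF d2] by blast
    have "s * (z * W2 (x + y *\<^sub>R e)) \<le> \<bar>s\<bar> * (\<bar>z\<bar> * \<bar>W2 (x + y *\<^sub>R e)\<bar>)"
      by (metis abs_ge_self abs_mult)
    also have "\<dots> \<le> \<bar>s\<bar> * (\<bar>s\<bar> * max M 0)"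
      using z y s M[OF x, of y] by (intro mult_left_mono mult_mono) auto
    also have "\<dots> = max M 0 * s\<^sup>2" by (simp add: power2_eq_square flip: abs_mult)
    finally show ?thesis using z(2) y(2) by (simp add: algebra_simps)
  qed
  then show ?thesis by (intro exI[of _ "max M 0"]) auto
qed

text \<open>A smooth function is bounded above by its first-order expansion plus a quadratic term, and
  \<open>sqrt y \<le> r + (y - r\<^sup>2) / (2 r)\<close> carries this over to the square root as long as \<open>r = sqrt (W x)\<close>
  stays away from zero.\<close>

lemma sqrt_smooth_semiconcave:
  fixes W :: "'a::euclidean_space \<Rightarrow> real"
  assumes W: "smooth W" and W0: "\<And>x. 0 \<le> W x" and K: "compact K" and pos: "\<And>x. x \<in> K \<Longrightarrow> 0 < W x"
  shows "\<exists>A k1 k2. 0 \<le> k2 \<and> (\<forall>x\<in>K. \<bar>A x\<bar> \<le> k1 \<and>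
    (\<forall>s. \<bar>s\<bar> \<le> S \<longrightarrow> sqrt (W (x + s *\<^sub>R e)) \<le> sqrt (W x) + s * A x + k2 * s\<^sup>2))"
proof -
  obtain M where M: "M \<ge> 0" "\<And>x s. x \<in> K \<Longrightarrow> \<bar>s\<bar> \<le> S \<Longrightarrow>
      W (x + s *\<^sub>R e) \<le> W x + s * dderiv W x e + M * s\<^sup>2"
    using smooth_quadratic_upper_bound[OF W K] by metis
  have contW: "continuous_on K W" by (rule continuous_on_subset[OF smooth_continuous[OF W]]) simp
  have contD: "continuous_on K (\<lambda>x. dderiv W x e)"
    by (rule continuous_on_subset[OF smooth_continuous[OF smooth_dderiv[OF W]]]) simp
  define A where "A x = dderiv W x e / (2 * sqrt (W x))" for x
  have "continuous_on K A" unfolding A_def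
    by (intro continuous_intros contW contD) (use pos in force)
  then obtain k1 where k1: "\<And>x. x \<in> K \<Longrightarrow> \<bar>A x\<bar> \<le> k1"
    using compact_imp_bounded[OF compact_continuous_image[of K A, OF _ K]]
    unfolding bounded_iff ball_simps real_norm_def by blast
  have "continuous_on K (\<lambda>x. M / (2 * sqrt (W x)))"
    by (intro continuous_intros contW) (use pos in force)
  then obtain k2 where k2: "\<And>x. x \<in> K \<Longrightarrow> \<bar>M / (2 * sqrt (W x))\<bar> \<le> k2"
    using compact_imp_bounded[OF compact_continuous_image[of K "\<lambda>x. M / (2 * sqrt (W x))", OF _ K]]
    unfolding bounded_iff ball_simps real_norm_def by blast
  have "sqrt (W (x + s *\<^sub>R e)) \<le> sqrt (W x) + s * A x + max k2 0 * s\<^sup>2"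
    if x: "x \<in> K" and s: "\<bar>s\<bar> \<le> S" for x s
  proof -
    define y where "y = W (x + s *\<^sub>R e)"
    define r where "r = sqrt (W x)"
    have r: "0 < r" "r\<^sup>2 = W x" using pos[OF x] W0[of x] by (auto simp: r_def)
    have "0 \<le> (sqrt y - r)\<^sup>2" by simp
    then have "2 * r * sqrt y \<le> y + r\<^sup>2" using W0[of "x + s *\<^sub>R e"] by (simp add: power2_diff y_def mult_ac)
    also have "\<dots> \<le> 2 * r\<^sup>2 + s * dderiv W x e + M * s\<^sup>2" using M(2)[OF x s] r by (simp add: y_def)
    finally have "sqrt y \<le> (2 * r\<^sup>2 + s * dderiv W x e + M * s\<^sup>2) / (2 * r)"
      using r(1) by (simp add: pos_le_divide_eq mult_ac)
    also have "\<dots> = r + s * A x + M / (2 * r) * s\<^sup>2"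
      using r(1) by (simp add: A_def r_def[symmetric] field_simps power2_eq_square)
    also have "M / (2 * r) * s\<^sup>2 \<le> max k2 0 * s\<^sup>2"
      using k2[OF x] abs_ge_self[of "M / (2 * sqrt (W x))"]
      by (intro mult_right_mono) (simp_all only: r_def le_max_iff_disj zero_le_power2, linarith)
    finally show ?thesis by (simp add: y_def r_def)
  qed
  then show ?thesis using k1 by (intro exI[of _ A] exI[of _ k1] exI[of _ "max k2 0"]) auto
qed

lemma hessian_quadratic_form:
  fixes W :: "real ^ 'n \<Rightarrow> real"
  assumes W: "smooth W"
  shows "(\<Sum>j\<in>UNIV. z $ j * dderiv (\<lambda>x. dderiv W x (axis j 1)) w z) = z \<bullet> (hessian W w *v z)"
proof -
  have "dderiv (\<lambda>x. dderiv W x (axis j 1)) w z = (\<Sum>i\<in>UNIV. z $ i * hessian W w $ i $ j)" for j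
  proof -
    interpret bl: bounded_linear "dderiv (\<lambda>x. dderiv W x (axis j 1)) w"
      using smooth_has_derivative[OF smooth_dderiv[OF W]] by (rule has_derivative_bounded_linear)
    have "z = (\<Sum>i\<in>UNIV. z $ i *\<^sub>R axis i 1)" by (metis basis_expansion scalar_mult_eq_scaleR)
    then have "dderiv (\<lambda>x. dderiv W x (axis j 1)) w z
        = dderiv (\<lambda>x. dderiv W x (axis j 1)) w (\<Sum>i\<in>UNIV. z $ i *\<^sub>R axis i 1)" by simp
    moreover have "partial_deriv j W = (\<lambda>x. dderiv W x (axis j 1))" by (simp add: partial_deriv_def fun_eq_iff)
    ultimately show ?thesis by (simp add: bl.sum bl.scaleR hessian_def partial_deriv_def[of _ "\<lambda>x. dderiv W x (axis j 1)"])
  qed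
  then have "(\<Sum>j\<in>UNIV. z $ j * dderiv (\<lambda>x. dderiv W x (axis j 1)) w z)
      = (\<Sum>j\<in>UNIV. \<Sum>i\<in>UNIV. z $ j * (z $ i * hessian W w $ i $ j))" by (simp add: sum_distrib_left)
  also have "\<dots> = (\<Sum>i\<in>UNIV. \<Sum>j\<in>UNIV. z $ j * (z $ i * hessian W w $ i $ j))" by (rule sum.swap)
  also have "\<dots> = z \<bullet> (hessian W w *v z)"
    by (simp add: inner_vec_def matrix_vector_mult_def sum_distrib_left mult_ac)
  finally show ?thesis .
qed

text \<open>At a zero of a nonnegative function the gradient vanishes. Along a segment from the zero the
  derivative is then \<open>s z\<^sup>T H z\<close> up to a small error, with \<open>H\<close> the Hessian. Hence the function is comparable
  to the squared distance, and its root to the distance.\<close>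

lemma nondegenerate_zero_two_sided_bound:
  fixes W :: "real ^ 'n \<Rightarrow> real"
  assumes W: "smooth W" and W0: "\<And>x. 0 \<le> W x" and Ww: "W w = 0" and pd: "positive_definite (hessian W w)"
  shows "\<exists>r c C. 0 < r \<and> 0 < c \<and> 0 < C \<and> (\<forall>x. norm (x - w) \<le> r \<longrightarrow>
     c * norm (x - w) \<le> sqrt (W x) \<and> sqrt (W x) \<le> C * norm (x - w))"
proof -
  define q where "q z = z \<bullet> (hessian W w *v z)" for z
  have qc: "continuous_on UNIV q"
    unfolding q_def by (intro continuous_intros matrix_vector_mult_linear_continuous_on)
  have ne: "sphere (0::real^'n) 1 \<noteq> {}" using vector_choose_size[of 1, where ?'a="real^'n"] by auto
  have cs: "compact (sphere (0::real^'n) 1)" by simp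
  obtain zm where zm: "norm zm = 1" "\<And>z. norm z = 1 \<Longrightarrow> q zm \<le> q z"
    using continuous_attains_inf[OF cs ne continuous_on_subset[OF qc]] by auto
  obtain zM where zM: "norm zM = 1" "\<And>z. norm z = 1 \<Longrightarrow> q z \<le> q zM"
    using continuous_attains_sup[OF cs ne continuous_on_subset[OF qc]] by auto
  define \<mu> where "\<mu> = q zm"
  define M where "M = q zM"
  have \<mu>: "0 < \<mu>" using pd zm(1) norm_zero[where 'a="real^'n"]
    unfolding \<mu>_def q_def positive_definite_def by (metis zero_neq_one)
  have \<mu>M: "\<mu> \<le> M" unfolding \<mu>_def M_def using zm zM by blast
  have qscale: "q z = (norm z)\<^sup>2 * q (z /\<^sub>R norm z)" if "z \<noteq> 0" for z
    using that by (simp add: q_def matrix_vector_mult_scaleR power2_eq_square field_simps)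
  have qb: "\<mu> * (norm z)\<^sup>2 \<le> q z" "q z \<le> M * (norm z)\<^sup>2" for z
  proof -
    show "\<mu> * (norm z)\<^sup>2 \<le> q z"
      using zm(2)[of "z /\<^sub>R norm z"] qscale[of z] by (cases "z = 0") (auto simp: \<mu>_def q_def mult.commute mult_left_mono)
    show "q z \<le> M * (norm z)\<^sup>2"
      using zM(2)[of "z /\<^sub>R norm z"] qscale[of z] by (cases "z = 0") (auto simp: M_def q_def mult.commute mult_left_mono)
  qed
  have grad0: "dderiv W w v = 0" for v
  proof -
    have "dderiv W w = (\<lambda>v. 0)"
      by (rule differential_zero_maxmin[of w UNIV W]) (use smooth_has_derivative[OF W] W0 Ww in auto)
    then show ?thesis by simp
  qed
  define n where "n = real (CARD('n))"
  have n: "n > 0" by (simp add: n_def)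
  \<comment> \<open>Each of the \<open>n\<close> partial derivatives may contribute this error, which leaves half of the
    lower bound \<open>\<mu>\<close> of the quadratic form.\<close>
  define \<eta> where "\<eta> = \<mu> / (2 * n)"
  have \<eta>: "\<eta> > 0" using \<mu> n by (simp add: \<eta>_def)
  have "\<exists>d>0. \<forall>x. norm (x - w) < d \<longrightarrow>
      \<bar>dderiv W x (axis j 1) - dderiv (\<lambda>x. dderiv W x (axis j 1)) w (x - w)\<bar> \<le> \<eta> * norm (x - w)" for j
    using smooth_has_derivative[OF smooth_dderiv[OF W], of "axis j 1" w] \<eta>
    unfolding has_derivative_at_alt grad0 by simp
  then obtain d where d: "\<And>j. d j > 0" "\<And>j x. norm (x - w) < d j \<Longrightarrow>
      \<bar>dderiv W x (axis j 1) - dderiv (\<lambda>x. dderiv W x (axis j 1)) w (x - w)\<bar> \<le> \<eta> * norm (x - w)"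
    by metis
  define r where "r = Min (range d) / 2"
  have m: "Min (range d) > 0" using d(1) by (subst Min_gr_iff) auto
  have r: "r > 0" "r < d j" for j
  proof -
    have "Min (range d) \<le> d j" by (intro Min_le) auto
    with m show "r > 0" "r < d j" unfolding r_def by linarith+
  qed
  have main: "\<mu> / 4 * (norm (x - w))\<^sup>2 \<le> W x \<and> W x \<le> (M + \<mu>) * (norm (x - w))\<^sup>2"
    if x: "norm (x - w) \<le> r" for x
  proof -
    define z where "z = x - w"
    define g where "g s = W (w + s *\<^sub>R z)" for s
    have dg: "(g has_real_derivative dderiv W (w + s *\<^sub>R z) z) (at s)" for s
      unfolding g_def by (rule smooth_has_real_derivative_line[OF W])
    have est: "\<bar>dderiv W (w + s *\<^sub>R z) z - s * q z\<bar> \<le> s * (\<mu> / 2 * (norm z)\<^sup>2)" if s: "0 \<le> s" "s \<le> 1" for s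
    proof -
      let ?x = "w + s *\<^sub>R z"
      interpret bl: bounded_linear "dderiv W ?x"
        using smooth_has_derivative[OF W] by (rule has_derivative_bounded_linear)
      interpret bj: bounded_linear "dderiv (\<lambda>x. dderiv W x (axis j 1)) w" for j
        using smooth_has_derivative[OF smooth_dderiv[OF W]] by (rule has_derivative_bounded_linear)
      have "z = (\<Sum>i\<in>UNIV. z $ i *\<^sub>R axis i 1)" by (metis basis_expansion scalar_mult_eq_scaleR)
      then have "dderiv W ?x z = dderiv W ?x (\<Sum>i\<in>UNIV. z $ i *\<^sub>R axis i 1)" by simp
      also have "\<dots> = (\<Sum>j\<in>UNIV. z $ j * dderiv W ?x (axis j 1))" by (simp add: bl.sum bl.scaleR)
      finally have 1: "dderiv W ?x z = (\<Sum>j\<in>UNIV. z $ j * dderiv W ?x (axis j 1))" .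
      have 2: "s * q z = (\<Sum>j\<in>UNIV. z $ j * dderiv (\<lambda>x. dderiv W x (axis j 1)) w (s *\<^sub>R z))"
        unfolding q_def hessian_quadratic_form[OF W, symmetric] by (simp add: bj.scaleR sum_distrib_left mult_ac)
      have "norm (?x - w) \<le> r" using x s mult_right_mono[of s 1 "norm z"] by (simp add: z_def)
      then have dd: "\<bar>dderiv W ?x (axis j 1) - dderiv (\<lambda>x. dderiv W x (axis j 1)) w (s *\<^sub>R z)\<bar> \<le> \<eta> * (s * norm z)" for j
        using d(2)[of ?x j] r(2)[of j] s by simp
      have "\<bar>dderiv W ?x z - s * q z\<bar> = \<bar>\<Sum>j\<in>UNIV. z $ j * (dderiv W ?x (axis j 1) - dderiv (\<lambda>x. dderiv W x (axis j 1)) w (s *\<^sub>R z))\<bar>"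
        unfolding 1 2 by (simp add: sum_subtractf right_diff_distrib)
      also have "\<dots> \<le> (\<Sum>j\<in>(UNIV::'n set). norm z * (\<eta> * (s * norm z)))"
        by (rule order_trans[OF sum_abs sum_mono])
          (auto simp: abs_mult intro!: mult_mono dd component_le_norm_cart)
      also have "\<dots> = s * (\<mu> / 2 * (norm z)\<^sup>2)"
        using n by (simp add: \<eta>_def n_def power2_eq_square field_simps)
      finally show ?thesis .
    qed
    have "g 0 - \<mu> / 4 * (norm z)\<^sup>2 * 0\<^sup>2 \<le> g 1 - \<mu> / 4 * (norm z)\<^sup>2 * 1\<^sup>2"
    proof (rule DERIV_nonneg_imp_nondecreasing[of 0 1 "\<lambda>s. g s - \<mu> / 4 * (norm z)\<^sup>2 * s\<^sup>2"])
      fix s :: real assume s: "0 \<le> s" "s \<le> 1"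
      have D: "((\<lambda>s. g s - \<mu> / 4 * (norm z)\<^sup>2 * s\<^sup>2) has_real_derivative
          (dderiv W (w + s *\<^sub>R z) z - \<mu> / 4 * (norm z)\<^sup>2 * (2 * s))) (at s)"
        by (auto intro!: derivative_eq_intros dg)
      moreover have "s * (\<mu> * (norm z)\<^sup>2) \<le> s * q z" by (intro mult_left_mono qb s)
      ultimately show "\<exists>y. ((\<lambda>s. g s - \<mu> / 4 * (norm z)\<^sup>2 * s\<^sup>2) has_real_derivative y) (at s) \<and> 0 \<le> y"
        using est[OF s, THEN abs_le_D1] est[OF s, THEN abs_le_D2]
        by - (rule exI, rule conjI, rule D, simp add: algebra_simps)
    qed simp
    moreover have "g 1 - (M + \<mu>) * (norm z)\<^sup>2 * 1\<^sup>2 \<le> g 0 - (M + \<mu>) * (norm z)\<^sup>2 * 0\<^sup>2"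
    proof (rule DERIV_nonpos_imp_nonincreasing[of 0 1 "\<lambda>s. g s - (M + \<mu>) * (norm z)\<^sup>2 * s\<^sup>2"])
      fix s :: real assume s: "0 \<le> s" "s \<le> 1"
      have D: "((\<lambda>s. g s - (M + \<mu>) * (norm z)\<^sup>2 * s\<^sup>2) has_real_derivative
          (dderiv W (w + s *\<^sub>R z) z - (M + \<mu>) * (norm z)\<^sup>2 * (2 * s))) (at s)"
        by (auto intro!: derivative_eq_intros dg)
      moreover have "s * q z \<le> s * (M * (norm z)\<^sup>2)" by (intro mult_left_mono qb s)
      moreover have "0 \<le> s * (M * (norm z)\<^sup>2)" "0 \<le> s * (\<mu> * (norm z)\<^sup>2)" using s \<mu> \<mu>M by auto
      ultimately show "\<exists>y. ((\<lambda>s. g s - (M + \<mu>) * (norm z)\<^sup>2 * s\<^sup>2) has_real_derivative y) (at s) \<and> y \<le> 0"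
        using est[OF s, THEN abs_le_D1] est[OF s, THEN abs_le_D2]
        by - (rule exI, rule conjI, rule D, simp add: algebra_simps)
    qed simp
    ultimately show ?thesis by (simp add: g_def z_def Ww)
  qed
  show ?thesis
  proof (intro exI conjI allI impI)
    fix x assume x: "norm (x - w) \<le> r"
    have sq: "sqrt (k * (norm (x - w))\<^sup>2) = sqrt k * norm (x - w)" for k
      by (simp add: real_sqrt_mult)
    show "sqrt (\<mu> / 4) * norm (x - w) \<le> sqrt (W x)" "sqrt (W x) \<le> sqrt (M + \<mu>) * norm (x - w)"
      using main[OF x] unfolding sq[symmetric] by (simp_all only: real_sqrt_le_iff)
  qed (use r \<mu> \<mu>M in auto)
qed

lemma Liminf_at_infinity_pos_bound:
  fixes W :: "'a::real_normed_vector \<Rightarrow> real"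
  assumes "Liminf at_infinity (\<lambda>p. ereal (W p)) > 0"
  obtains c R where "0 < c" "\<And>p. R \<le> norm p \<Longrightarrow> c \<le> W p"
proof -
  obtain y where y: "0 < y" "y < Liminf at_infinity (\<lambda>p. ereal (W p))" using assms dense by blast
  then obtain c where c: "y = ereal c" by (cases y) auto
  have "eventually (\<lambda>p. y < ereal (W p)) at_infinity" using y(2) by (rule less_LiminfD)
  then obtain R where "\<And>p. R \<le> norm p \<Longrightarrow> y < ereal (W p)" unfolding eventually_at_infinity by blast
  then show thesis using y(1) unfolding c by (intro that[of c R]) (auto simp: less_imp_le)
qed

section \<open>Shears between the wells\<close>

lemma has_real_derivative_truncated_power:
  "((\<lambda>z::real. (max 0 z) ^ Suc (Suc n)) has_real_derivative real (Suc (Suc n)) * (max 0 z) ^ Suc n) (at z)"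
proof (cases z "0::real" rule: linorder_cases)
  case less
  have "((\<lambda>z. 0) has_real_derivative 0) (at z)" by simp
  then have "((\<lambda>z::real. (max 0 z) ^ Suc (Suc n)) has_real_derivative 0) (at z)"
    by (rule has_field_derivative_transform_within_open[of _ _ _ "{..<0}"]) (use less in auto)
  then show ?thesis using less by simp
next
  case greater
  have "((\<lambda>z. z ^ Suc (Suc n)) has_real_derivative real (Suc (Suc n)) * z ^ Suc n) (at z)"
    by (rule derivative_eq_intros refl | simp)+
  then have "((\<lambda>z::real. (max 0 z) ^ Suc (Suc n)) has_real_derivative real (Suc (Suc n)) * z ^ Suc n) (at z)"
    by (rule has_field_derivative_transform_within_open[of _ _ _ "{0<..}"]) (use greater in auto)
  then show ?thesis using greater by (simp add: max_absorb2)
next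
  case equal
  have "((\<lambda>h. ((max 0 h) ^ Suc (Suc n)) / h) \<longlongrightarrow> 0) (at (0::real))"
  proof (rule Lim_null_comparison)
    show "eventually (\<lambda>h. norm ((max 0 h) ^ Suc (Suc n) / h) \<le> \<bar>h\<bar> ^ Suc n) (at (0::real))"
    proof (rule always_eventually, rule allI)
      fix h :: real
      show "norm ((max 0 h) ^ Suc (Suc n) / h) \<le> \<bar>h\<bar> ^ Suc n"
      proof (cases "h > 0")
        case False
        then have "max 0 h = 0" by simp
        then show ?thesis by (simp del: power_Suc)
      qed (simp add: max_absorb2)
    qed
    have "((\<lambda>h. \<bar>h\<bar> ^ Suc n) \<longlongrightarrow> \<bar>0\<bar> ^ Suc n) (at (0::real))" by (intro tendsto_intros)
    then show "((\<lambda>h. \<bar>h\<bar> ^ Suc n) \<longlongrightarrow> 0) (at (0::real))" by simp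
  qed
  then show ?thesis using equal by (simp add: DERIV_def)
qed

text \<open>The bump \<open>h\<close> is the quadratic B-spline: the third difference of the truncated power \<open>(max 0 z)\<^sup>2\<close>, which
  vanishes to the right of its last knot because third differences annihilate quadratics. Its
  primitive \<open>H\<close> is explicit, and its total mass is a third difference of a cube.\<close>

lemma exists_bump:
  fixes l r :: real
  assumes lr: "l < r"
  obtains H h h' :: "real \<Rightarrow> real" and \<alpha> \<beta> c :: real
  where "l < \<alpha>" "\<alpha> < \<beta>" "\<beta> < r" "0 < c"
    "\<And>y. (H has_real_derivative h y) (at y)" "\<And>y. (h has_real_derivative h' y) (at y)"
    "continuous_on UNIV h'"
    "\<And>y. y \<le> \<alpha> \<or> \<beta> \<le> y \<Longrightarrow> h y = 0 \<and> h' y = 0"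
    "H r - H l = c"
proof -
  define d where "d = (r - l) / 5"
  have d: "d > 0" using lr by (simp add: d_def)
  define \<alpha> where "\<alpha> = l + d"
  define \<beta> where "\<beta> = l + 4 * d"
  define T where "T n z = (max 0 z) ^ n" for n and z :: real
  define b where "b n y = T n ((y - \<alpha>) / d) - 3 * T n ((y - \<alpha>) / d - 1) + 3 * T n ((y - \<alpha>) / d - 2) - T n ((y - \<alpha>) / d - 3)"
    for n y
  have dT: "(T (Suc (Suc n)) has_real_derivative real (Suc (Suc n)) * T (Suc n) z) (at z)" for n z
    unfolding T_def by (rule has_real_derivative_truncated_power)
  have db: "(b (Suc (Suc n)) has_real_derivative real (Suc (Suc n)) / d * b (Suc n) y) (at y)" for n y
  proof -
    have 1: "((\<lambda>y. T (Suc (Suc n)) ((y - \<alpha>) / d - k)) has_real_derivative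
        real (Suc (Suc n)) * T (Suc n) ((y - \<alpha>) / d - k) * (1 / d)) (at y)" for k
      by (rule DERIV_chain2[OF dT]) (use d in \<open>auto intro!: derivative_eq_intros\<close>)
    show ?thesis unfolding b_def
      by (rule derivative_eq_intros 1 1[of 0, simplified] refl)+ (simp add: algebra_simps add_divide_distrib diff_divide_distrib)
  qed
  have b0: "b (Suc n) y = 0" if "y \<le> \<alpha>" for n y
    using that d by (auto simp: b_def T_def max_def divide_le_0_iff field_simps)
  have bT: "b n y = (let z = (y - \<alpha>) / d in z ^ n - 3 * (z - 1) ^ n + 3 * (z - 2) ^ n - (z - 3) ^ n)" if "\<beta> \<le> y" for n y
  proof -
    have "3 \<le> (y - \<alpha>) / d" using that d by (simp add: \<alpha>_def \<beta>_def pos_le_divide_eq)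
    then show ?thesis by (simp add: b_def T_def max_absorb2 Let_def)
  qed
  show thesis
  proof (rule that[of \<alpha> \<beta> "2 * d" "\<lambda>y. d / 3 * b 3 y" "b 2" "\<lambda>y. 2 / d * b 1 y"])
    show "l < \<alpha>" "\<alpha> < \<beta>" "\<beta> < r" "0 < 2 * d" using d by (auto simp: \<alpha>_def \<beta>_def) (simp add: d_def lr field_simps)
    show "((\<lambda>y. d / 3 * b 3 y) has_real_derivative b 2 y) (at y)" for y
      using DERIV_cmult[OF db[of 1 y], of "d / 3"] d by (simp add: numeral_3_eq_3 numeral_2_eq_2)
    show "(b 2 has_real_derivative 2 / d * b 1 y) (at y)" for y
      using db[of 0 y] by (simp add: numeral_2_eq_2)
    show "continuous_on UNIV (\<lambda>y. 2 / d * b 1 y)"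
      unfolding b_def T_def by (intro continuous_intros) (use d in auto)
    show "b 2 y = 0 \<and> 2 / d * b 1 y = 0" if "y \<le> \<alpha> \<or> \<beta> \<le> y" for y
    proof (cases "y \<le> \<alpha>")
      case True then show ?thesis using b0[of y 0] b0[of y 1] by (simp add: numeral_2_eq_2)
    next
      case False then show ?thesis using that by (auto simp: bT Let_def power2_eq_square algebra_simps)
    qed
    have "b 3 l = 0" using b0[of l 2] d by (simp add: \<alpha>_def numeral_3_eq_3)
    moreover have "b 3 r = 6"
    proof -
      have "r = l + 5 * d" by (simp add: d_def field_simps)
      then have "\<beta> \<le> r" using d by (simp add: \<beta>_def)
      then show ?thesis by (simp add: bT Let_def power3_eq_cube algebra_simps)
    qed
    ultimately show "d / 3 * b 3 r - d / 3 * b 3 l = 2 * d" by simp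
  qed
qed

text \<open>The bound is \<open>sqrt (n\<^sup>2 + x) \<le> n + x / (2 n)\<close> with \<open>n = norm v\<close>, with the remainder kept proportional to
  \<open>norm v\<close> so that it can be integrated along a curve.\<close>

lemma norm_add_quadratic_bound:
  fixes v w :: "'a::real_inner"
  assumes "norm w \<le> k * norm v"
  shows "norm (v + t *\<^sub>R w) \<le> norm v + t * ((v \<bullet> w) / norm v) + t\<^sup>2 * (k\<^sup>2 * norm v)"
    and "\<bar>(v \<bullet> w) / norm v\<bar> \<le> k * norm v"
proof -
  have "norm (v + t *\<^sub>R w) \<le> norm v + t * ((v \<bullet> w) / norm v) + t\<^sup>2 * (k\<^sup>2 * norm v) \<and>
      \<bar>(v \<bullet> w) / norm v\<bar> \<le> k * norm v"
  proof (cases "v = 0")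
    case True
    then show ?thesis using assms by simp
  next
    case False
    define n where "n = norm v"
    define y where "y = norm (v + t *\<^sub>R w)"
    have n: "n > 0" using False by (simp add: n_def)
    have "y\<^sup>2 = n\<^sup>2 + 2 * t * (v \<bullet> w) + t\<^sup>2 * (norm w)\<^sup>2"
      unfolding y_def n_def power2_norm_eq_inner
      by (simp add: inner_add_left inner_add_right inner_commute power2_eq_square)
    moreover have "0 \<le> (y - n)\<^sup>2" by simp
    ultimately have "2 * n * y \<le> 2 * n\<^sup>2 + 2 * t * (v \<bullet> w) + t\<^sup>2 * (norm w)\<^sup>2"
      by (simp add: power2_diff mult_ac)
    moreover have "(norm w)\<^sup>2 \<le> (k * n)\<^sup>2" using assms by (intro power_mono) (auto simp: n_def)
    then have "t\<^sup>2 * (norm w)\<^sup>2 \<le> t\<^sup>2 * (k * n)\<^sup>2" by (intro mult_left_mono) auto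
    moreover have "0 \<le> t\<^sup>2 * (k * n)\<^sup>2" by simp
    ultimately have "2 * n * y \<le> 2 * n\<^sup>2 + 2 * t * (v \<bullet> w) + 2 * (t\<^sup>2 * (k * n)\<^sup>2)"
      by linarith
    then have "n * y \<le> n * (n + t * ((v \<bullet> w) / n) + t\<^sup>2 * (k\<^sup>2 * n))"
      using n by (simp add: distrib_left power2_eq_square power_mult_distrib mult_ac)
    then have "y \<le> n + t * ((v \<bullet> w) / n) + t\<^sup>2 * (k\<^sup>2 * n)" using n by simp
    moreover have "\<bar>v \<bullet> w\<bar> \<le> n * (k * n)"
      using Cauchy_Schwarz_ineq2[of v w] mult_left_mono[OF assms norm_ge_zero[of v]] by (simp add: n_def)
    then have "\<bar>(v \<bullet> w) / n\<bar> \<le> k * n" using n by (simp add: abs_divide pos_divide_le_eq mult_ac)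
    ultimately show ?thesis by (simp add: y_def n_def)
  qed
  then show "norm (v + t *\<^sub>R w) \<le> norm v + t * ((v \<bullet> w) / norm v) + t\<^sup>2 * (k\<^sup>2 * norm v)"
    and "\<bar>(v \<bullet> w) / norm v\<bar> \<le> k * norm v" by auto
qed

lemma product_of_quadratic_bounds:
  fixes P N n t :: real
  assumes P: "0 \<le> P" "P \<le> a0 + t * a1 + t\<^sup>2 * a2" and N: "0 \<le> N" "N \<le> n + t * n1 + t\<^sup>2 * (k * n)"
    and t: "\<bar>t\<bar> \<le> 1" and n: "0 \<le> n" and n1: "\<bar>n1\<bar> \<le> k' * n" and b: "0 \<le> k" "0 \<le> k'"
      "0 \<le> a0" "a0 \<le> c0" "\<bar>a1\<bar> \<le> c1" "0 \<le> a2" "a2 \<le> c2"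
  shows "P * N \<le> a0 * n + t * (a1 * n + a0 * n1) + t\<^sup>2 * ((c2 + c1 * k' + c0 * k + c1 * k + c2 * k' + c2 * k) * n)"
proof -
  have "P * N \<le> (a0 + t * a1 + t\<^sup>2 * a2) * (n + t * n1 + t\<^sup>2 * (k * n))"
    using P N by (intro mult_mono) auto
  also have "\<dots> = a0 * n + t * (a1 * n + a0 * n1)
      + t\<^sup>2 * (a2 * n + a1 * n1 + a0 * (k * n) + t * (a1 * (k * n) + a2 * n1) + t\<^sup>2 * (a2 * (k * n)))"
    by (simp add: algebra_simps power2_eq_square)
  also have "\<dots> \<le> a0 * n + t * (a1 * n + a0 * n1)
      + t\<^sup>2 * (c2 * n + c1 * (k' * n) + c0 * (k * n) + (c1 * (k * n) + c2 * (k' * n)) + c2 * (k * n))"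
  proof (intro add_left_mono mult_left_mono add_mono)
    have c: "0 \<le> c0" "0 \<le> c1" "0 \<le> c2" using b by linarith+
    show "a2 * n \<le> c2 * n" using b n by (intro mult_right_mono)
    have *: "x * y \<le> X * Y" if "\<bar>x\<bar> \<le> X" "\<bar>y\<bar> \<le> Y" for x y X Y :: real
      using mult_mono'[OF that] abs_ge_self[of "x * y"] by (simp add: abs_mult)
    show "a1 * n1 \<le> c1 * (k' * n)" using b n1 by (intro *)
    show "a0 * (k * n) \<le> c0 * (k * n)" using b n by (intro mult_right_mono) auto
    have "\<bar>a1 * (k * n) + a2 * n1\<bar> \<le> c1 * (k * n) + c2 * (k' * n)"
    proof (rule order_trans[OF abs_triangle_ineq add_mono])
      show "\<bar>a1 * (k * n)\<bar> \<le> c1 * (k * n)" using b n by (auto simp: abs_mult intro!: mult_right_mono)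
      show "\<bar>a2 * n1\<bar> \<le> c2 * (k' * n)" using b n n1 c by (auto simp: abs_mult intro!: mult_mono)
    qed
    from *[OF t this] show "t * (a1 * (k * n) + a2 * n1) \<le> c1 * (k * n) + c2 * (k' * n)" by simp
    have "\<bar>a2 * (k * n)\<bar> \<le> c2 * (k * n)" using b n by (auto simp: abs_mult intro!: mult_right_mono)
    moreover have "\<bar>t\<^sup>2\<bar> \<le> 1" using t by (simp add: abs_square_le_1)
    ultimately show "t\<^sup>2 * (a2 * (k * n)) \<le> c2 * (k * n)" using *[of "t\<^sup>2" 1 "a2 * (k * n)" "c2 * (k * n)"] by simp
  qed simp
  also have "\<dots> = a0 * n + t * (a1 * n + a0 * n1) + t\<^sup>2 * ((c2 + c1 * k' + c0 * k + c1 * k + c2 * k' + c2 * k) * n)"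
    by (simp add: algebra_simps)
  finally show ?thesis .
qed

text \<open>The curves \<open>\<Gamma> t\<close> are the images of \<open>\<gamma>\<close> under the shears \<open>x \<mapsto> x + t h(x \<bullet> u) e\<close>, where \<open>u = q - p\<close>, the
  vector \<open>e\<close> is \<open>u\<close> turned by a right angle, and \<open>h\<close> is a bump function supported in a strip strictly between
  the two wells.
  
  The area changes by exactly \<open>t \<integral> h(\<gamma> \<bullet> u) (\<gamma>' \<bullet> u)\<close> plus the integral of an exact form that vanishes at the
  wells. This integral depends on the end points only: it equals the constant \<open>c\<close> for every curve.
  
  In the strip \<open>F\<close> is positive and semiconcave, so the energy density at parameter \<open>t\<close> is at most
  \<open>\<phi>\<^sub>0 + t \<phi>\<^sub>1 + M t\<^sup>2 \<phi>\<^sub>0\<close>. The first-order term \<open>\<phi>\<^sub>1\<close> is not controlled, but it cancels when the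
  inequalities at \<open>t \<le> 0\<close> and at \<open>s \<ge> 0\<close> are combined with the weights \<open>s\<close> and \<open>-t\<close>. This gives the last
  property: a quantitative form of concavity at zero.
  
  The same exact integral shows that a curve cannot cross the strip without spending energy.\<close>

lemma shear_family:
  fixes W :: "real ^ 2 \<Rightarrow> real" and p q :: "real ^ 2"
  assumes W: "smooth W" and W0: "\<And>x. 0 \<le> W x" and pq: "p \<noteq> q"
    and zeros: "\<And>x. W x = 0 \<Longrightarrow> x = p \<or> x = q"
  defines "F \<equiv> \<lambda>x. sqrt (W x)"
  obtains c M N where "0 < c" "0 \<le> M" "0 \<le> N"
    "\<And>a b \<gamma>. joins p q a b \<gamma> \<Longrightarrow> (\<And>\<tau>. \<tau> \<in> {a..b} \<Longrightarrow> norm (\<gamma> \<tau>) \<le> R) \<Longrightarrow>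
      0 < energy F a b \<gamma> \<and> (\<exists>\<Gamma>. (\<forall>t. \<bar>t\<bar> \<le> 1 \<longrightarrow> joins p q a b (\<Gamma> t) \<and> area a b (\<Gamma> t) = area a b \<gamma> + t * c \<and>
              energy (\<lambda>_. 1) a b (\<Gamma> t) \<le> N * energy (\<lambda>_. 1) a b \<gamma>) \<and>
          (\<forall>s t. - 1 \<le> t \<and> t \<le> 0 \<and> 0 \<le> s \<and> s \<le> 1 \<longrightarrow>
              s * energy F a b (\<Gamma> t) - t * energy F a b (\<Gamma> s) \<le> (s - t) * (1 - M * s * t) * energy F a b \<gamma>))"
proof -
  define u where "u = q - p"
  define e where "e = (vector [u $ 2, - (u $ 1)] :: real ^ 2)"
  have e12: "e $ 1 = u $ 2" "e $ 2 = - (u $ 1)" by (simp_all add: e_def)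
  have "q \<bullet> u - p \<bullet> u = u \<bullet> u" by (simp add: u_def inner_diff_left)
  then have "p \<bullet> u < q \<bullet> u" using pq by (simp add: u_def) (metis inner_gt_zero_iff diff_gt_0_iff_gt right_minus_eq)
  from exists_bump[OF this] obtain H h h' :: "real \<Rightarrow> real" and \<alpha> \<beta> c :: real
    where strip: "p \<bullet> u < \<alpha>" "\<alpha> < \<beta>" "\<beta> < q \<bullet> u" and c: "0 < c"
    and dH: "\<And>y. (H has_real_derivative h y) (at y)" and dh: "\<And>y. (h has_real_derivative h' y) (at y)"
    and ch': "continuous_on UNIV h'"
    and h0: "\<And>y. y \<le> \<alpha> \<or> \<beta> \<le> y \<Longrightarrow> h y = 0 \<and> h' y = 0"
    and Hc: "H (q \<bullet> u) - H (p \<bullet> u) = c" by metis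
  have ch: "continuous_on UNIV h" by (rule DERIV_continuous_on) (use dh in auto)
  have "bounded (h ` {\<alpha>..\<beta>})" "bounded (h' ` {\<alpha>..\<beta>})"
    by (intro compact_imp_bounded compact_continuous_image continuous_on_subset[OF ch] continuous_on_subset[OF ch']; simp)+
  then obtain B1 B2 where B12: "\<And>y. y \<in> {\<alpha>..\<beta>} \<Longrightarrow> \<bar>h y\<bar> \<le> B1" "\<And>y. y \<in> {\<alpha>..\<beta>} \<Longrightarrow> \<bar>h' y\<bar> \<le> B2"
    unfolding bounded_iff ball_simps real_norm_def by blast
  define B where "B = max (max B1 B2) 0"
  have B: "0 \<le> B" "\<bar>h y\<bar> \<le> B" "\<bar>h' y\<bar> \<le> B" for y
  proof -
    show "0 \<le> B" by (simp add: B_def)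
    show "\<bar>h y\<bar> \<le> B" "\<bar>h' y\<bar> \<le> B"
      using h0[of y] B12[of y] by (cases "y \<in> {\<alpha>..\<beta>}"; force simp: B_def)+
  qed
  define k where "k = B * (norm u * norm e)"
  have k: "0 \<le> k" using B by (simp add: k_def)
  define S where "S t x = x + (t * h (x \<bullet> u)) *\<^sub>R e" for t x
  define DS where "DS t x v = v + t *\<^sub>R ((h' (x \<bullet> u) * (v \<bullet> u)) *\<^sub>R e)" for t x v
  have wk: "norm ((h' (x \<bullet> u) * (v \<bullet> u)) *\<^sub>R e) \<le> k * norm v" for x v
  proof -
    have "\<bar>h' (x \<bullet> u)\<bar> * \<bar>v \<bullet> u\<bar> * norm e \<le> B * (norm v * norm u) * norm e"
      by (intro mult_right_mono mult_mono B Cauchy_Schwarz_ineq2) (use B in auto)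
    then show ?thesis by (simp add: k_def abs_mult mult_ac)
  qed
  have F: "continuous_on UNIV F" unfolding F_def
    by (intro continuous_intros smooth_continuous[OF W])
  have F0: "0 \<le> F x" for x by (simp add: F_def W0)
  \<comment> \<open>Outside the strip the shears are the identity, so that only this compact set matters.\<close>
  define K where "K = cball 0 R \<inter> {x. \<alpha> \<le> x \<bullet> u} \<inter> {x. x \<bullet> u \<le> \<beta>}"
  have cK: "compact K" unfolding K_def
    by (intro compact_Int_closed compact_cball closed_Collect_le continuous_intros)
  have Kpos: "0 < W x" if "x \<in> K" for x
    using zeros[of x] W0[of x] that strip by (force simp: K_def less_le)
  obtain A k1 k2 where A: "0 \<le> k2" "\<And>x. x \<in> K \<Longrightarrow> \<bar>A x\<bar> \<le> k1"
    "\<And>x s. x \<in> K \<Longrightarrow> \<bar>s\<bar> \<le> B \<Longrightarrow> F (x + s *\<^sub>R e) \<le> F x + s * A x + k2 * s\<^sup>2"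
    using sqrt_smooth_semiconcave[OF W W0 cK Kpos, of B e] unfolding F_def by metis
  have "bounded (F ` K)" "bounded ((\<lambda>x. 1 / F x) ` K)"
    by (intro compact_imp_bounded compact_continuous_image cK continuous_intros continuous_on_subset[OF F];
        use Kpos in \<open>force simp: F_def\<close>)+
  then obtain f0 f1 where f: "\<And>x. x \<in> K \<Longrightarrow> \<bar>F x\<bar> \<le> f0" "\<And>x. x \<in> K \<Longrightarrow> \<bar>1 / F x\<bar> \<le> f1"
    unfolding bounded_iff ball_simps real_norm_def by blast
  define C where "C = B\<^sup>2 * k2 + B * \<bar>k1\<bar> * k + \<bar>f0\<bar> * k\<^sup>2 + B * \<bar>k1\<bar> * k\<^sup>2 + B\<^sup>2 * k2 * k + B\<^sup>2 * k2 * k\<^sup>2"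
  have C: "0 \<le> C" unfolding C_def using A(1) B(1) k by (intro add_nonneg_nonneg mult_nonneg_nonneg) auto
  define M where "M = C * \<bar>f1\<bar>"
  have M: "0 \<le> M" using C by (simp add: M_def)
  have pointwise: "\<exists>\<phi>. \<forall>t. \<bar>t\<bar> \<le> 1 \<longrightarrow>
      F (S t x) * norm (DS t x v) \<le> F x * norm v + t * \<phi> + t\<^sup>2 * (M * (F x * norm v))"
    if x: "norm x \<le> R" for x v
  proof (cases "x \<in> K")
    case False
    then have "h (x \<bullet> u) = 0 \<and> h' (x \<bullet> u) = 0" using x by (intro h0) (auto simp: K_def)
    then have "S t x = x" "DS t x v = v" for t by (simp_all add: S_def DS_def)
    then show ?thesis using F0[of x] M by (intro exI[of _ 0]) simp
  next
    case True
    define y where "y = h (x \<bullet> u)"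
    have y: "\<bar>y\<bar> \<le> B" using B by (simp add: y_def)
    define w where "w = (h' (x \<bullet> u) * (v \<bullet> u)) *\<^sub>R e"
    have nw: "norm w \<le> k * norm v" using wk by (simp add: w_def)
    define n1 where "n1 = (v \<bullet> w) / norm v"
    define \<phi> where "\<phi> = (y * A x) * norm v + F x * n1"
    have "F (S t x) * norm (DS t x v) \<le> F x * norm v + t * \<phi> + t\<^sup>2 * (M * (F x * norm v))" if t: "\<bar>t\<bar> \<le> 1" for t
    proof -
      have y2: "y\<^sup>2 \<le> B\<^sup>2" using y by (metis abs_le_square_iff abs_of_nonneg B(1))
      have "F (S t x) * norm (DS t x v) \<le> F x * norm v + t * ((y * A x) * norm v + F x * n1)
         + t\<^sup>2 * ((B\<^sup>2 * k2 + B * \<bar>k1\<bar> * k + \<bar>f0\<bar> * k\<^sup>2 + B * \<bar>k1\<bar> * k\<^sup>2 + B\<^sup>2 * k2 * k + B\<^sup>2 * k2 * k\<^sup>2) * norm v)"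
      proof (rule product_of_quadratic_bounds)
        have "\<bar>t * y\<bar> \<le> B" using mult_mono[OF t y] B(1) by (simp add: abs_mult)
        from A(3)[OF True this] show "F (S t x) \<le> F x + t * (y * A x) + t\<^sup>2 * (y\<^sup>2 * k2)"
          by (simp add: S_def y_def power_mult_distrib mult_ac)
        show "norm (DS t x v) \<le> norm v + t * n1 + t\<^sup>2 * (k\<^sup>2 * norm v)"
          using norm_add_quadratic_bound(1)[OF nw, of t] by (simp add: DS_def w_def n1_def)
        show "\<bar>n1\<bar> \<le> k * norm v" using norm_add_quadratic_bound(2)[OF nw] by (simp add: n1_def)
        show "F x \<le> \<bar>f0\<bar>" using f(1)[OF True] by linarith
        have "\<bar>y\<bar> * \<bar>A x\<bar> \<le> B * \<bar>k1\<bar>" using A(2)[OF True] y by (intro mult_mono) auto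
        then show "\<bar>y * A x\<bar> \<le> B * \<bar>k1\<bar>" by (simp add: abs_mult)
        show "y\<^sup>2 * k2 \<le> B\<^sup>2 * k2" using y2 A(1) by (rule mult_right_mono)
      qed (use t F0 k A(1) in auto)
      also have "(B\<^sup>2 * k2 + B * \<bar>k1\<bar> * k + \<bar>f0\<bar> * k\<^sup>2 + B * \<bar>k1\<bar> * k\<^sup>2 + B\<^sup>2 * k2 * k + B\<^sup>2 * k2 * k\<^sup>2) * norm v
          \<le> M * (F x * norm v)"
      proof -
        have "1 \<le> \<bar>f1\<bar> * F x"
        proof -
          have Fx: "0 < F x" using Kpos[OF True] by (simp add: F_def)
          have "1 / F x \<le> \<bar>f1\<bar>" using f(2)[OF True] by linarith
          then show ?thesis using Fx by (simp add: pos_divide_le_eq)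
        qed
        then have "C * norm v * 1 \<le> C * norm v * (\<bar>f1\<bar> * F x)" using C by (intro mult_left_mono) auto
        then have "C * norm v \<le> M * (F x * norm v)" by (simp add: M_def mult_ac)
        then show ?thesis by (simp only: C_def)
      qed
      finally show ?thesis by (simp add: \<phi>_def mult_left_mono)
    qed
    then show ?thesis by blast
  qed
  have hlip: "\<bar>h y - h z\<bar> \<le> B * \<bar>y - z\<bar>" for y z
    using field_differentiable_bound[of UNIV h h' B y z] dh B(3) by simp
  have dhx: "((\<lambda>x. h (x \<bullet> u)) has_derivative (\<lambda>v. h' (x \<bullet> u) * (v \<bullet> u))) (at x)" for x
    using has_derivative_compose[of "\<lambda>x. x \<bullet> u" "\<lambda>v. v \<bullet> u" x UNIV h "\<lambda>z. h' (x \<bullet> u) * z"]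
      dh[of "x \<bullet> u"] by (simp add: has_field_derivative_def bounded_linear_imp_has_derivative bounded_linear_inner_left)
  have dHx: "((\<lambda>x. H (x \<bullet> u)) has_derivative (\<lambda>v. h (x \<bullet> u) * (v \<bullet> u))) (at x)" for x
    using has_derivative_compose[of "\<lambda>x. x \<bullet> u" "\<lambda>v. v \<bullet> u" x UNIV H "\<lambda>z. h (x \<bullet> u) * z"]
      dH[of "x \<bullet> u"] by (simp add: has_field_derivative_def bounded_linear_imp_has_derivative bounded_linear_inner_left)
  show thesis
  proof (rule that[OF c M, of "1 + k"])
    show "0 \<le> 1 + k" using k by simp
    fix a b and \<gamma> :: "real \<Rightarrow> real ^ 2"
    assume J: "joins p q a b \<gamma>" and bnd: "\<And>\<tau>. \<tau> \<in> {a..b} \<Longrightarrow> norm (\<gamma> \<tau>) \<le> R"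
    obtain L where lip: "L-lipschitz_on {a..b} \<gamma>" and ab: "a < b" and ends: "\<gamma> a = p" "\<gamma> b = q"
      using J by (auto simp: joins_iff)
    define \<Gamma> where "\<Gamma> t \<tau> = S t (\<gamma> \<tau>)" for t \<tau>
    have \<Gamma>lip: "((1 + \<bar>t\<bar> * k) * L)-lipschitz_on {a..b} (\<Gamma> t)" for t
    proof (rule lipschitz_onI)
      fix r s assume rs: "r \<in> {a..b}" "s \<in> {a..b}"
      have "\<bar>h (\<gamma> r \<bullet> u) - h (\<gamma> s \<bullet> u)\<bar> \<le> B * \<bar>(\<gamma> r - \<gamma> s) \<bullet> u\<bar>"
        using hlip by (simp add: inner_diff_left)
      also have "\<dots> \<le> B * (norm (\<gamma> r - \<gamma> s) * norm u)"
        by (intro mult_left_mono Cauchy_Schwarz_ineq2 B)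
      finally have hd: "\<bar>h (\<gamma> r \<bullet> u) - h (\<gamma> s \<bullet> u)\<bar> \<le> B * (norm (\<gamma> r - \<gamma> s) * norm u)" .
      have "\<Gamma> t r - \<Gamma> t s = (\<gamma> r - \<gamma> s) + (t * (h (\<gamma> r \<bullet> u) - h (\<gamma> s \<bullet> u))) *\<^sub>R e"
        by (simp add: \<Gamma>_def S_def algebra_simps)
      then have "norm (\<Gamma> t r - \<Gamma> t s) \<le> norm (\<gamma> r - \<gamma> s) + \<bar>t\<bar> * \<bar>h (\<gamma> r \<bullet> u) - h (\<gamma> s \<bullet> u)\<bar> * norm e"
        using norm_triangle_ineq[of "\<gamma> r - \<gamma> s" "(t * (h (\<gamma> r \<bullet> u) - h (\<gamma> s \<bullet> u))) *\<^sub>R e"]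
        by (simp add: abs_mult)
      also have "\<dots> \<le> norm (\<gamma> r - \<gamma> s) + \<bar>t\<bar> * (B * (norm (\<gamma> r - \<gamma> s) * norm u)) * norm e"
        by (intro add_left_mono mult_right_mono mult_left_mono hd) auto
      also have "\<dots> = (1 + \<bar>t\<bar> * k) * norm (\<gamma> r - \<gamma> s)" by (simp add: k_def algebra_simps)
      also have "\<dots> \<le> (1 + \<bar>t\<bar> * k) * (L * dist r s)"
        using lipschitz_onD[OF lip rs] k by (intro mult_left_mono) (auto simp: dist_norm)
      finally show "dist (\<Gamma> t r) (\<Gamma> t s) \<le> (1 + \<bar>t\<bar> * k) * L * dist r s" by (simp add: dist_norm mult.assoc)
    qed (use k lipschitz_on_nonneg[OF lip] in auto)
    have h_ends: "h (p \<bullet> u) = 0" "h (q \<bullet> u) = 0" using h0[of "p \<bullet> u"] h0[of "q \<bullet> u"] strip by auto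
    have \<Gamma>J: "joins p q a b (\<Gamma> t)" for t
      using \<Gamma>lip[of t] ab ends h_ends by (auto simp: joins_iff \<Gamma>_def S_def)
    have vel1: "velocity (\<Gamma> t) \<tau> = DS t (\<gamma> \<tau>) (velocity \<gamma> \<tau>)"
      if "(\<gamma> has_vector_derivative velocity \<gamma> \<tau>) (at \<tau>)" for t \<tau>
    proof (rule vector_derivative_at)
      have "((\<lambda>\<tau>. h (\<gamma> \<tau> \<bullet> u)) has_derivative (\<lambda>r. r * (h' (\<gamma> \<tau> \<bullet> u) * (velocity \<gamma> \<tau> \<bullet> u)))) (at \<tau>)"
        using has_derivative_compose[OF that[unfolded has_vector_derivative_def] dhx] by (simp add: mult_ac)
      then have "((\<lambda>\<tau>. h (\<gamma> \<tau> \<bullet> u)) has_vector_derivative (h' (\<gamma> \<tau> \<bullet> u) * (velocity \<gamma> \<tau> \<bullet> u))) (at \<tau>)"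
        by (simp add: has_vector_derivative_def)
      from has_vector_derivative_add[OF that bounded_linear.has_vector_derivative[OF bounded_linear_scaleR_left has_vector_derivative_mult_right[OF this, of t], of e]]
      show "(\<Gamma> t has_vector_derivative DS t (\<gamma> \<tau>) (velocity \<gamma> \<tau>)) (at \<tau>)"
        by (simp add: \<Gamma>_def[abs_def] S_def DS_def)
    qed
    have vel: "ae_between a b (\<lambda>\<tau>. \<forall>t. velocity (\<Gamma> t) \<tau> = DS t (\<gamma> \<tau>) (velocity \<gamma> \<tau>))"
      by (rule ae_between_mono[OF lipschitz_velocity_ae[OF lip less_imp_le[OF ab]]]) (use vel1 in auto)
    have area: "area a b (\<Gamma> t) = area a b \<gamma> + t * c" for t
    proof -
      \<comment> \<open>The integrand of the area of the sheared curve differs from that of \<open>\<gamma>\<close> by the derivative of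
        this function along \<open>\<gamma>\<close>; the choice of \<open>e\<close> is what makes the first-order term a function of
        \<open>x \<bullet> u\<close>.\<close>
      define \<psi> where "\<psi> x = t\<^sup>2 / 2 * (e $ 1 * e $ 2) * (h (x \<bullet> u) * h (x \<bullet> u)) + t * e $ 2 * (x $ 1 * h (x \<bullet> u)) + t * H (x \<bullet> u)" for x
      define D where "D x v = t\<^sup>2 * (e $ 1 * e $ 2) * (h (x \<bullet> u) * (h' (x \<bullet> u) * (v \<bullet> u)))
          + t * e $ 2 * (x $ 1 * (h' (x \<bullet> u) * (v \<bullet> u)) + v $ 1 * h (x \<bullet> u)) + t * (h (x \<bullet> u) * (v \<bullet> u))" for x v
      have "((\<lambda>\<tau>. D (\<gamma> \<tau>) (velocity \<gamma> \<tau>)) has_integral \<psi> (\<gamma> b) - \<psi> (\<gamma> a)) {a..b}"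
      proof (rule ftc_along_curve[OF lip less_imp_le[OF ab]])
        show "(\<psi> has_derivative D x) (at x)" for x
          unfolding \<psi>_def[abs_def]
          by (rule derivative_eq_intros dhx dHx bounded_linear_imp_has_derivative bounded_linear_vec_nth refl)+
            (simp add: D_def fun_eq_iff algebra_simps)
        show "continuous_on UNIV (\<lambda>x. D (fst x) (snd x))"
          unfolding D_def by (intro continuous_intros continuous_on_compose2[OF ch] continuous_on_compose2[OF ch']) auto
      qed
      moreover have "\<psi> (\<gamma> b) - \<psi> (\<gamma> a) = t * c"
        unfolding \<psi>_def ends h_ends using Hc by (simp add: algebra_simps)
      ultimately have D: "((\<lambda>\<tau>. D (\<gamma> \<tau>) (velocity \<gamma> \<tau>)) has_integral t * c) {a..b}" by simp
      have g: "((\<lambda>\<tau>. \<gamma> \<tau> $ 1 * velocity \<gamma> \<tau> $ 2) has_integral area a b \<gamma>) {a..b}"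
        unfolding area_velocity by (intro integrable_integral area_integrable[OF lip]) auto
      have "area a b (\<Gamma> t) = integral {a..b} (\<lambda>\<tau>. \<gamma> \<tau> $ 1 * velocity \<gamma> \<tau> $ 2 + D (\<gamma> \<tau>) (velocity \<gamma> \<tau>))"
        unfolding area_velocity
      proof (rule integral_cong_ae(1), rule ae_between_mono[OF vel])
        fix \<tau> assume v: "\<forall>t. velocity (\<Gamma> t) \<tau> = DS t (\<gamma> \<tau>) (velocity \<gamma> \<tau>)"
        have vu: "velocity \<gamma> \<tau> \<bullet> u = velocity \<gamma> \<tau> $ 1 * u $ 1 + velocity \<gamma> \<tau> $ 2 * u $ 2"
          by (simp add: inner_vec_def sum_2)
        show "\<Gamma> t \<tau> $ 1 * velocity (\<Gamma> t) \<tau> $ 2 = \<gamma> \<tau> $ 1 * velocity \<gamma> \<tau> $ 2 + D (\<gamma> \<tau>) (velocity \<gamma> \<tau>)"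
          unfolding v[rule_format] \<Gamma>_def S_def DS_def D_def vu
          by (simp add: e12 algebra_simps power2_eq_square)
      qed
      also have "\<dots> = area a b \<gamma> + t * c" by (rule integral_unique[OF has_integral_add[OF g D]])
      finally show ?thesis .
    qed
    have len: "energy (\<lambda>_. 1) a b (\<Gamma> t) \<le> (1 + k) * energy (\<lambda>_. 1) a b \<gamma>" if t: "\<bar>t\<bar> \<le> 1" for t
    proof -
      have "energy (\<lambda>_. 1) a b (\<Gamma> t) \<le> integral {a..b} (\<lambda>\<tau>. (1 + k) * (1 * norm (velocity \<gamma> \<tau>)))"
        unfolding energy_velocity
      proof (rule integral_mono_ae)
        show "ae_between a b (\<lambda>\<tau>. 1 * norm (velocity (\<Gamma> t) \<tau>) \<le> (1 + k) * (1 * norm (velocity \<gamma> \<tau>)))"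
        proof (rule ae_between_mono[OF vel])
          fix \<tau> assume v: "\<forall>t. velocity (\<Gamma> t) \<tau> = DS t (\<gamma> \<tau>) (velocity \<gamma> \<tau>)"
          let ?v = "velocity \<gamma> \<tau>" and ?w = "(h' (\<gamma> \<tau> \<bullet> u) * (velocity \<gamma> \<tau> \<bullet> u)) *\<^sub>R e"
          have "norm (DS t (\<gamma> \<tau>) ?v) \<le> norm ?v + \<bar>t\<bar> * norm ?w"
            unfolding DS_def by (rule order_trans[OF norm_triangle_ineq]) (simp add: abs_mult)
          also have "\<bar>t\<bar> * norm ?w \<le> 1 * (k * norm ?v)" by (intro mult_mono t wk) auto
          finally show "1 * norm (velocity (\<Gamma> t) \<tau>) \<le> (1 + k) * (1 * norm (velocity \<gamma> \<tau>))"
            by (simp add: v algebra_simps)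
        qed
      qed (use energy_integrable[OF \<Gamma>lip[of t], of "\<lambda>_. 1" a b] energy_integrable[OF lip, of "\<lambda>_. 1" a b]
          in \<open>auto intro!: integrable_on_mult_right\<close>)
      then show ?thesis by (simp add: energy_velocity)
    qed
    have en: "s * energy F a b (\<Gamma> t) - t * energy F a b (\<Gamma> s) \<le> (s - t) * (1 - M * s * t) * energy F a b \<gamma>"
      if st: "- 1 \<le> t" "t \<le> 0" "0 \<le> s" "s \<le> 1" for s t
    proof -
      have i: "(\<lambda>\<tau>. F (\<Gamma> r \<tau>) * norm (velocity (\<Gamma> r) \<tau>)) integrable_on {a..b}" for r
        by (rule energy_integrable[OF \<Gamma>lip F]) auto
      have i0: "(\<lambda>\<tau>. F (\<gamma> \<tau>) * norm (velocity \<gamma> \<tau>)) integrable_on {a..b}"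
        by (rule energy_integrable[OF lip F]) auto
      have "integral {a..b} (\<lambda>\<tau>. s * (F (\<Gamma> t \<tau>) * norm (velocity (\<Gamma> t) \<tau>)) - t * (F (\<Gamma> s \<tau>) * norm (velocity (\<Gamma> s) \<tau>)))
          \<le> integral {a..b} (\<lambda>\<tau>. (s - t) * (1 - M * s * t) * (F (\<gamma> \<tau>) * norm (velocity \<gamma> \<tau>)))"
      proof (rule integral_mono_ae)
        show "ae_between a b (\<lambda>\<tau>. s * (F (\<Gamma> t \<tau>) * norm (velocity (\<Gamma> t) \<tau>)) - t * (F (\<Gamma> s \<tau>) * norm (velocity (\<Gamma> s) \<tau>))
            \<le> (s - t) * (1 - M * s * t) * (F (\<gamma> \<tau>) * norm (velocity \<gamma> \<tau>)))"
        proof (rule ae_between_mono[OF vel])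
          fix \<tau> assume \<tau>: "a < \<tau>" "\<tau> < b" and v: "\<forall>t. velocity (\<Gamma> t) \<tau> = DS t (\<gamma> \<tau>) (velocity \<gamma> \<tau>)"
          let ?P = "\<lambda>r. F (\<Gamma> r \<tau>) * norm (velocity (\<Gamma> r) \<tau>)" and ?Q = "F (\<gamma> \<tau>) * norm (velocity \<gamma> \<tau>)"
          obtain \<phi> where \<phi>: "\<And>r. \<bar>r\<bar> \<le> 1 \<Longrightarrow> ?P r \<le> ?Q + r * \<phi> + r\<^sup>2 * (M * ?Q)"
            using pointwise[OF bnd[of \<tau>], of "velocity \<gamma> \<tau>"] \<tau> by (auto simp: v \<Gamma>_def)
          have "s * ?P t - t * ?P s \<le> s * (?Q + t * \<phi> + t\<^sup>2 * (M * ?Q)) - t * (?Q + s * \<phi> + s\<^sup>2 * (M * ?Q))"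
            using mult_left_mono[OF \<phi>[of t], of s] mult_left_mono_neg[OF \<phi>[of s], of t] st by linarith
          also have "\<dots> = (s - t) * (1 - M * s * t) * ?Q" by (simp add: algebra_simps power2_eq_square)
          finally show "s * ?P t - t * ?P s \<le> (s - t) * (1 - M * s * t) * ?Q" .
        qed
      qed (use i i0 in \<open>auto intro!: integrable_diff integrable_on_mult_right\<close>)
      then show ?thesis
        using i i0 by (simp add: energy_velocity integral_diff integrable_on_mult_right)
    qed
    have positive: "0 < energy F a b \<gamma>"
    proof -
      have I: "((\<lambda>\<tau>. h (\<gamma> \<tau> \<bullet> u) * (velocity \<gamma> \<tau> \<bullet> u)) has_integral c) {a..b}"
      proof -
        have "continuous_on UNIV (\<lambda>x::(real^2)\<times>(real^2). h (fst x \<bullet> u) * (snd x \<bullet> u))"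
          by (intro continuous_intros continuous_on_compose2[OF ch]) auto
        from ftc_along_curve[OF lip less_imp_le[OF ab] dHx this] show ?thesis
          using Hc by (simp add: ends)
      qed
      have "c = integral {a..b} (\<lambda>\<tau>. h (\<gamma> \<tau> \<bullet> u) * (velocity \<gamma> \<tau> \<bullet> u))"
        using I by (simp add: integral_unique)
      also have "\<dots> \<le> integral {a..b} (\<lambda>\<tau>. (B * norm u * \<bar>f1\<bar>) * (F (\<gamma> \<tau>) * norm (velocity \<gamma> \<tau>)))"
      proof (rule integral_le)
        show "(\<lambda>\<tau>. (B * norm u * \<bar>f1\<bar>) * (F (\<gamma> \<tau>) * norm (velocity \<gamma> \<tau>))) integrable_on {a..b}"
          by (intro integrable_on_mult_right energy_integrable[OF lip F]) auto
        fix \<tau> assume \<tau>: "\<tau> \<in> {a..b}"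
        let ?x = "\<gamma> \<tau>" and ?v = "velocity \<gamma> \<tau>"
        show "h (?x \<bullet> u) * (?v \<bullet> u) \<le> (B * norm u * \<bar>f1\<bar>) * (F ?x * norm ?v)"
        proof (cases "?x \<in> K")
          case False
          then have "h (?x \<bullet> u) = 0" using bnd[OF \<tau>] h0[of "?x \<bullet> u"] by (auto simp: K_def)
          then show ?thesis using B(1) F0[of ?x] by simp
        next
          case True
          have Fx: "0 < F ?x" using Kpos[OF True] by (simp add: F_def)
          have "1 / F ?x \<le> \<bar>f1\<bar>" using f(2)[OF True] by linarith
          then have one: "1 \<le> \<bar>f1\<bar> * F ?x" using Fx by (simp add: pos_divide_le_eq)
          have "h (?x \<bullet> u) * (?v \<bullet> u) \<le> \<bar>h (?x \<bullet> u)\<bar> * \<bar>?v \<bullet> u\<bar>" by (metis abs_ge_self abs_mult)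
          also have "\<dots> \<le> B * (norm ?v * norm u)" by (intro mult_mono B Cauchy_Schwarz_ineq2) auto
          also have "\<dots> = B * norm u * norm ?v * 1" by simp
          also have "\<dots> \<le> B * norm u * norm ?v * (\<bar>f1\<bar> * F ?x)" using one B(1) by (intro mult_left_mono) auto
          finally show ?thesis by (simp add: mult_ac)
        qed
      qed (use I in auto)
      also have "\<dots> = (B * norm u * \<bar>f1\<bar>) * energy F a b \<gamma>" by (simp add: energy_velocity)
      finally have "energy F a b \<gamma> \<noteq> 0" using c by auto
      then show ?thesis using energy_nonneg[of a b F \<gamma>] F0 by (simp add: less_le)
    qed
    show "0 < energy F a b \<gamma> \<and> (\<exists>\<Gamma>. (\<forall>t. \<bar>t\<bar> \<le> 1 \<longrightarrow> joins p q a b (\<Gamma> t) \<and> area a b (\<Gamma> t) = area a b \<gamma> + t * c \<and>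
              energy (\<lambda>_. 1) a b (\<Gamma> t) \<le> (1 + k) * energy (\<lambda>_. 1) a b \<gamma>) \<and>
          (\<forall>s t. - 1 \<le> t \<and> t \<le> 0 \<and> 0 \<le> s \<and> s \<le> 1 \<longrightarrow>
              s * energy F a b (\<Gamma> t) - t * energy F a b (\<Gamma> s) \<le> (s - t) * (1 - M * s * t) * energy F a b \<gamma>))"
      using positive \<Gamma>J area len en by (intro conjI exI[of _ \<Gamma>]) auto
  qed
qed

section \<open>Straightening a curve near a well\<close>

text \<open>After its last visit to the ball of radius \<open>R\<close>, the curve pays at least \<open>c\<close> per unit of length.\<close>

lemma curve_stays_bounded:
  fixes \<gamma> :: "real \<Rightarrow> real ^ 2"
  assumes lip: "L-lipschitz_on {a..b} \<gamma>" and F: "continuous_on UNIV F" and F0: "\<And>p. 0 \<le> F p"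
    and c: "0 < c" "\<And>x. R \<le> norm x \<Longrightarrow> c \<le> F x" and start: "norm (\<gamma> a) \<le> R" and t: "t \<in> {a..b}"
  shows "norm (\<gamma> t) \<le> R + energy F a b \<gamma> / c"
proof (cases "norm (\<gamma> t) \<le> R")
  case True
  then show ?thesis using c(1) energy_nonneg[of a b F \<gamma>] F0 by (simp add: add_increasing2)
next
  case False
  let ?S = "{s \<in> {a..t}. norm (\<gamma> s) \<le> R}"
  have cont: "continuous_on {a..t} \<gamma>"
    using t by (intro continuous_on_subset[OF lipschitz_on_continuous_on[OF lip]]) auto
  have "closed ?S" by (intro continuous_on_closed_Collect_le continuous_intros cont)
  then have "compact ({a..t} \<inter> ?S)" by (intro compact_Int_closed compact_Icc)
  moreover have "{a..t} \<inter> ?S = ?S" by blast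
  ultimately have "compact ?S" by simp
  moreover have "a \<in> ?S" using t start by auto
  ultimately obtain s where s: "s \<in> ?S" "\<And>u. u \<in> ?S \<Longrightarrow> u \<le> s"
    using compact_attains_sup[of ?S] by blast
  have "c * norm (\<gamma> t - \<gamma> s) \<le> energy F s t \<gamma>"
  proof (rule energy_ge_displacement[OF lip F F0])
    fix u assume u: "s < u" "u < t"
    then have "u \<notin> ?S" using s(2)[of u] by auto
    then show "c \<le> F (\<gamma> u)" using u s(1) by (intro c(2)) auto
  qed (use s t in auto)
  also have "\<dots> \<le> energy F a b \<gamma>"
    using energy_split[OF lip F, of a s t] energy_split[OF lip F, of a t b] s(1) t F0
      energy_nonneg[of a s F \<gamma>] energy_nonneg[of t b F \<gamma>] by simp
  finally have "norm (\<gamma> t - \<gamma> s) \<le> energy F a b \<gamma> / c" using c(1) by (simp add: pos_le_divide_eq mult.commute)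
  then show ?thesis using norm_triangle_sub[of "\<gamma> t" "\<gamma> s"] s(1) by simp
qed

text \<open>This is \<open>\<integral> p\<^sub>1 dp\<^sub>2\<close> along the broken line from \<open>x\<close> to \<open>w\<close> and on to \<open>y\<close>.\<close>

definition broken_line_area :: "real ^ 2 \<Rightarrow> real ^ 2 \<Rightarrow> real ^ 2 \<Rightarrow> real" where
  "broken_line_area w x y = w $ 1 * (y $ 2 - x $ 2)
     + ((y $ 1 - w $ 1) * (y $ 2 - w $ 2) - (x $ 1 - w $ 1) * (x $ 2 - w $ 2)) / 2"

text \<open>Up to an exact form, the area integrand is half the cross product of \<open>\<gamma> - w\<close> with \<open>\<gamma>'\<close>. Near a
  well \<open>w\<close>, where \<open>F\<close> is comparable to the distance from \<open>w\<close>, this says that energy controls area.\<close>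

lemma area_minus_broken_line_area:
  fixes \<gamma> :: "real \<Rightarrow> real ^ 2"
  assumes lip: "L-lipschitz_on {a..b} \<gamma>" and ab: "a \<le> b"
  shows "\<bar>area a b \<gamma> - broken_line_area w (\<gamma> a) (\<gamma> b)\<bar> \<le> energy (\<lambda>x. norm (x - w)) a b \<gamma> / 2"
proof -
  define \<psi> where "\<psi> x = w $ 1 * x $ 2 + (x $ 1 - w $ 1) * (x $ 2 - w $ 2) / 2" for x :: "real ^ 2"
  define D where "D x v = w $ 1 * v $ 2 + ((x $ 1 - w $ 1) * v $ 2 + v $ 1 * (x $ 2 - w $ 2)) / 2" for x v :: "real ^ 2"
  have 1: "((\<lambda>\<tau>. D (\<gamma> \<tau>) (velocity \<gamma> \<tau>)) has_integral \<psi> (\<gamma> b) - \<psi> (\<gamma> a)) {a..b}"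
  proof (rule ftc_along_curve[OF lip ab])
    show "(\<psi> has_derivative D x) (at x)" for x
      unfolding \<psi>_def[abs_def]
      by (rule derivative_eq_intros bounded_linear_imp_has_derivative bounded_linear_vec_nth refl | simp)+
        (simp add: D_def fun_eq_iff algebra_simps)
    show "continuous_on UNIV (\<lambda>x. D (fst x) (snd x))"
      unfolding D_def by (intro continuous_intros) auto
  qed
  have 2: "((\<lambda>\<tau>. \<gamma> \<tau> $ 1 * velocity \<gamma> \<tau> $ 2) has_integral area a b \<gamma>) {a..b}"
    unfolding area_velocity by (intro integrable_integral area_integrable[OF lip]) auto
  have 3: "((\<lambda>\<tau>. \<gamma> \<tau> $ 1 * velocity \<gamma> \<tau> $ 2 - D (\<gamma> \<tau>) (velocity \<gamma> \<tau>)) has_integral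
      (area a b \<gamma> - broken_line_area w (\<gamma> a) (\<gamma> b))) {a..b}"
  proof -
    have "\<psi> (\<gamma> b) - \<psi> (\<gamma> a) = broken_line_area w (\<gamma> a) (\<gamma> b)"
      by (simp add: \<psi>_def broken_line_area_def field_simps)
    then show ?thesis using has_integral_diff[OF 2 1] by simp
  qed
  have "norm (integral {a..b} (\<lambda>\<tau>. \<gamma> \<tau> $ 1 * velocity \<gamma> \<tau> $ 2 - D (\<gamma> \<tau>) (velocity \<gamma> \<tau>)))
      \<le> integral {a..b} (\<lambda>\<tau>. norm (\<gamma> \<tau> - w) * norm (velocity \<gamma> \<tau>) / 2)"
  proof (rule integral_norm_bound_integral)
    show "(\<lambda>\<tau>. \<gamma> \<tau> $ 1 * velocity \<gamma> \<tau> $ 2 - D (\<gamma> \<tau>) (velocity \<gamma> \<tau>)) integrable_on {a..b}"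
      using 3 by (rule has_integral_integrable)
    show "(\<lambda>\<tau>. norm (\<gamma> \<tau> - w) * norm (velocity \<gamma> \<tau>) / 2) integrable_on {a..b}"
      by (intro integrable_on_divide energy_integrable[OF lip] continuous_intros) auto
    fix \<tau>
    define x where "x = \<gamma> \<tau> - w"
    define v where "v = velocity \<gamma> \<tau>"
    have "\<bar>x $ 1 * v $ 2 - v $ 1 * x $ 2\<bar> \<le> norm x * norm v"
    proof -
      have "(x $ 1 * v $ 2 - v $ 1 * x $ 2)\<^sup>2 \<le> ((x $ 1)\<^sup>2 + (x $ 2)\<^sup>2) * ((v $ 1)\<^sup>2 + (v $ 2)\<^sup>2)"
      proof -
        have "0 \<le> (x $ 1 * v $ 1 + x $ 2 * v $ 2)\<^sup>2" by simp
        then show ?thesis by (simp add: power2_eq_square algebra_simps)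
      qed
      also have "\<dots> = (norm x * norm v)\<^sup>2"
        by (simp add: power_mult_distrib norm_vec_def L2_set_def sum_2)
      finally show ?thesis by (rule abs_le_square_iff[THEN iffD2, of _ "norm x * norm v", simplified])
    qed
    moreover have eq: "\<gamma> \<tau> $ 1 * v $ 2 - D (\<gamma> \<tau>) v = (x $ 1 * v $ 2 - v $ 1 * x $ 2) / 2"
      by (simp add: D_def x_def field_simps)
    ultimately show "norm (\<gamma> \<tau> $ 1 * velocity \<gamma> \<tau> $ 2 - D (\<gamma> \<tau>) (velocity \<gamma> \<tau>))
        \<le> norm (\<gamma> \<tau> - w) * norm (velocity \<gamma> \<tau>) / 2"
      unfolding v_def[symmetric] x_def[symmetric] eq by simp
  qed
  also have "\<dots> = energy (\<lambda>x. norm (x - w)) a b \<gamma> / 2" by (simp add: energy_velocity)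
  finally show ?thesis using integral_unique[OF 3] by simp
qed

text \<open>The energy with this weight measures the length of a curve inside the ball, where \<open>F\<close> itself does not
  control the length. A weight that is continuous, unlike the indicator of the ball, keeps such
  lengths within the energies treated so far.\<close>

definition cutoff :: "real ^ 2 \<Rightarrow> real \<Rightarrow> real ^ 2 \<Rightarrow> real" where
  "cutoff w r x = max 0 (r - norm (x - w))"

lemma cutoff_props: "continuous_on UNIV (cutoff w r)" "0 \<le> cutoff w r x" "0 \<le> r \<Longrightarrow> cutoff w r x \<le> r"
  "r \<le> norm (x - w) \<Longrightarrow> cutoff w r x = 0"
  unfolding cutoff_def[abs_def] by (auto intro!: continuous_intros)

text \<open>Here \<open>G(t)\<close> is the energy accumulated up to time \<open>t\<close>. If \<open>G(t) + \<delta>\<close> is at most the square of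
  \<open>C |\<gamma>(t) - w|\<close>, then \<open>c |\<gamma> - w| |\<gamma>'| \<le> G'\<close> bounds the speed in the ball by a multiple of
  \<open>G' / sqrt (G + \<delta>)\<close>, the derivative of \<open>2 sqrt (G + \<delta>)\<close>. So the length near the well is finite,
  although \<open>F\<close> vanishes there; the positive \<open>\<delta>\<close> keeps the square root Lipschitz, and the bound
  stays finite as \<open>\<delta>\<close> tends to zero.\<close>

lemma cutoff_energy_bound:
  fixes \<gamma> :: "real \<Rightarrow> real ^ 2"
  assumes lip: "L-lipschitz_on {a..b} \<gamma>" and F: "continuous_on UNIV F" and F0: "\<And>p. 0 \<le> F p"
    and T: "a \<le> T" "T \<le> b" and r: "0 \<le> r" and c: "0 < c" and C: "0 \<le> C" and \<delta>: "0 < \<delta>"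
    and near: "\<And>x. norm (x - w) \<le> r \<Longrightarrow> c * norm (x - w) \<le> F x"
    and quad: "\<And>t. T < t \<Longrightarrow> t < b \<Longrightarrow> norm (\<gamma> t - w) \<le> r \<Longrightarrow>
        energy F a t \<gamma> + \<delta> \<le> C\<^sup>2 * (norm (\<gamma> t - w))\<^sup>2"
  shows "energy (cutoff w r) T b \<gamma> \<le> 2 * r * C / c * sqrt (energy F a b \<gamma> + \<delta>)"
proof -
  have ab: "a \<le> b" using T by simp
  define G where "G t = energy F a t \<gamma>" for t
  have G0: "0 \<le> G t" for t unfolding G_def by (intro energy_nonneg F0)
  define h where "h t = sqrt (G t + \<delta>)" for t
  obtain M where M: "M-lipschitz_on {a..b} G"
    using lipschitz_energy_from_start[OF lip F F0] unfolding G_def by blast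
  have hlip: "(M / (2 * sqrt \<delta>))-lipschitz_on {a..b} h"
  proof (rule lipschitz_onI)
    fix s t assume st: "s \<in> {a..b}" "t \<in> {a..b}"
    have hs: "sqrt \<delta> \<le> h s" "sqrt \<delta> \<le> h t" using G0 by (auto simp: h_def)
    have sd: "0 < sqrt \<delta>" using \<delta> by simp
    have "(h s - h t) * (h s + h t) = G s - G t"
      using G0[of s] G0[of t] \<delta> by (simp add: h_def algebra_simps)
    then have "\<bar>h s - h t\<bar> * (h s + h t) = \<bar>G s - G t\<bar>"
      using hs sd by (metis abs_mult abs_of_nonneg add_nonneg_nonneg less_imp_le order_trans)
    also have "\<dots> \<le> M * \<bar>s - t\<bar>" using lipschitz_onD[OF M st] by (simp add: dist_real_def)
    finally have "\<bar>h s - h t\<bar> * (h s + h t) \<le> M * \<bar>s - t\<bar>" .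
    moreover have "\<bar>h s - h t\<bar> * (2 * sqrt \<delta>) \<le> \<bar>h s - h t\<bar> * (h s + h t)"
      using hs by (intro mult_left_mono) auto
    ultimately show "dist (h s) (h t) \<le> M / (2 * sqrt \<delta>) * dist s t"
      using sd by (simp add: dist_real_def pos_le_divide_eq)
  qed (use lipschitz_on_nonneg[OF M] \<delta> in auto)
  define K where "K = 2 * r * C / c"
  have K: "0 \<le> K" using r C c by (simp add: K_def)
  have G': "ae_between T b (\<lambda>t. (G has_vector_derivative F (\<gamma> t) * norm (velocity \<gamma> t)) (at t))"
    using ae_between_subset[OF indefinite_integral_derivative_ae[OF energy_integrable[OF lip F, of a b]], of T b] T
    by (simp add: G_def[abs_def] energy_velocity)
  have "energy (cutoff w r) T b \<gamma> \<le> integral {T..b} (\<lambda>t. K * velocity h t)"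
    unfolding energy_velocity
  proof (rule integral_mono_ae)
    show "ae_between T b (\<lambda>t. cutoff w r (\<gamma> t) * norm (velocity \<gamma> t) \<le> K * velocity h t)"
    proof (rule ae_between_mono[OF G'])
      fix t assume t: "T < t" "t < b" and D: "(G has_vector_derivative F (\<gamma> t) * norm (velocity \<gamma> t)) (at t)"
      let ?G' = "F (\<gamma> t) * norm (velocity \<gamma> t)"
      have pos: "0 < G t + \<delta>" using G0[of t] \<delta> by simp
      have "(h has_real_derivative (?G' * (inverse (sqrt (G t + \<delta>)) / 2))) (at t)"
        unfolding h_def[abs_def] using D pos
        by (auto intro!: derivative_eq_intros simp: has_real_derivative_iff_has_vector_derivative[symmetric])
      then have vh: "velocity h t = ?G' / (2 * h t)"
        by (simp add: has_real_derivative_iff_has_vector_derivative vector_derivative_at h_def divide_simps)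
      have ht: "0 < h t" using pos by (simp add: h_def)
      show "cutoff w r (\<gamma> t) * norm (velocity \<gamma> t) \<le> K * velocity h t"
      proof (cases "norm (\<gamma> t - w) \<le> r")
        case False
        then show ?thesis using K ht F0[of "\<gamma> t"] by (simp add: cutoff_props vh)
      next
        case True
        let ?x = "norm (\<gamma> t - w)" and ?v = "norm (velocity \<gamma> t)"
        have "h t \<le> C * ?x"
        proof -
          have "h t \<le> sqrt ((C * ?x)\<^sup>2)" unfolding h_def
            using quad[OF t True] by (intro real_sqrt_le_mono) (simp add: G_def power_mult_distrib)
          then show ?thesis using C by simp
        qed
        then have "r * ?v * h t * c \<le> r * ?v * (C * ?x) * c"
          using r c by (intro mult_left_mono mult_right_mono) auto
        also have "\<dots> = r * C * (c * ?x * ?v)" by simp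
        also have "\<dots> \<le> r * C * ?G'" using near[OF True] r C by (intro mult_left_mono mult_right_mono) auto
        finally have "r * ?v \<le> K * (?G' / (2 * h t))"
          using ht c by (simp add: K_def field_simps)
        moreover have "cutoff w r (\<gamma> t) * ?v \<le> r * ?v" using r by (intro mult_right_mono cutoff_props) auto
        ultimately show ?thesis unfolding vh by linarith
      qed
    qed
    show "(\<lambda>t. cutoff w r (\<gamma> t) * norm (velocity \<gamma> t)) integrable_on {T..b}"
      using T by (intro energy_integrable[OF lip] cutoff_props) auto
    show "(\<lambda>t. K * velocity h t) integrable_on {T..b}"
      using lipschitz_ftc[OF hlip ab, of T b] T by (intro integrable_on_mult_right) auto
  qed
  also have "\<dots> = K * (h b - h T)"
    using lipschitz_ftc[OF hlip ab, of T b] T by (simp add: integral_unique)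
  also have "\<dots> \<le> K * h b" using K G0[of T] \<delta> by (intro mult_left_mono) (auto simp: h_def)
  finally show ?thesis by (simp add: K_def h_def G_def)
qed

text \<open>Let \<open>T\<close> be the last time in the ball around \<open>w\<close> at which the energy spent so far is at least
  \<open>2 C |\<gamma>(T) - w|\<^sup>2\<close>, up to \<open>\<delta>\<close>. The segment from \<open>w\<close> to \<open>\<gamma>(T)\<close> costs at most half as much.
  The energy saved by replacing the initial piece with it dominates the change of
  area, because before \<open>T\<close> the energy density is at least \<open>c' |\<gamma> - w|\<close>. After \<open>T\<close> the energy
  is so small compared to the squared distance that the length near \<open>w\<close> is bounded.\<close>

lemma straighten_start:
  fixes F :: "real ^ 2 \<Rightarrow> real" and w z :: "real ^ 2"
  assumes F: "continuous_on UNIV F" and F0: "\<And>p. 0 \<le> F p"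
    and pos: "0 < r" "0 < c" "0 < C" "0 < c'"
    and near_w: "\<And>x. norm (x - w) \<le> r \<Longrightarrow> c * norm (x - w) \<le> F x"
      "\<And>x. norm (x - w) \<le> r \<Longrightarrow> F x \<le> C * norm (x - w)"
    and near_z: "\<And>x. norm (x - z) \<le> r \<Longrightarrow> F x \<le> C * norm (x - z)"
    and disj: "2 * r < norm (z - w)"
    and far: "\<And>x. norm x \<le> R \<Longrightarrow> r < norm (x - z) \<Longrightarrow> c' * norm (x - w) \<le> F x"
    and least: "\<And>a b \<eta>. joins w z a b \<eta> \<Longrightarrow> E0 \<le> energy F a b \<eta>"
    and J: "joins w z a b \<gamma>" and bnd: "\<And>t. t \<in> {a..b} \<Longrightarrow> norm (\<gamma> t) \<le> R"
    and small: "energy F a b \<gamma> < 2 * E0 - 2 * C * r\<^sup>2" and \<delta>: "0 < \<delta>"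
  obtains \<eta> where "joins w z a b \<eta>"
    "energy F a b \<eta> + min c' C / 2 * \<bar>area a b \<eta> - area a b \<gamma>\<bar> \<le> energy F a b \<gamma> + \<delta>"
    "energy (cutoff w r) a b \<eta> \<le> r\<^sup>2 + 2 * r * sqrt (2 * C) / c * sqrt (energy F a b \<gamma> + \<delta>)"
    "energy (cutoff z r) a b \<eta> \<le> energy (cutoff z r) a b \<gamma>"
proof -
  obtain L where lip: "L-lipschitz_on {a..b} \<gamma>" and ab: "a < b" and ends: "\<gamma> a = w" "\<gamma> b = z"
    using J by (auto simp: joins_iff)
  define G where "G t = energy F a t \<gamma>" for t
  obtain M where M: "M-lipschitz_on {a..b} G"
    using lipschitz_energy_from_start[OF lip F F0] unfolding G_def by blast
  have cont: "continuous_on {a..b} G" "continuous_on {a..b} \<gamma>"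
    by (rule lipschitz_on_continuous_on[OF M], rule lipschitz_on_continuous_on[OF lip])
  let ?S = "{t \<in> {a..b}. norm (\<gamma> t - w) \<le> r} \<inter> {t \<in> {a..b}. 2 * C * (norm (\<gamma> t - w))\<^sup>2 \<le> G t + \<delta>}"
  have "closed ?S"
    by (intro closed_Int continuous_on_closed_Collect_le continuous_intros cont)
  then have "compact ({a..b} \<inter> ?S)" by (intro compact_Int_closed compact_Icc)
  moreover have "{a..b} \<inter> ?S = ?S" by blast
  ultimately have "compact ?S" by simp
  moreover have "a \<in> ?S" using ab pos \<delta> by (simp add: ends G_def energy_velocity)
  ultimately obtain T where T: "T \<in> ?S" "\<And>t. t \<in> ?S \<Longrightarrow> t \<le> T"
    using compact_attains_sup[of ?S] by blast
  define \<rho> where "\<rho> = norm (\<gamma> T - w)"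
  have \<rho>: "0 \<le> \<rho>" "\<rho> \<le> r" "2 * C * \<rho>\<^sup>2 \<le> G T + \<delta>" and aT: "a \<le> T" "T \<le> b"
    using T(1) by (auto simp: \<rho>_def)
  have Tb: "T \<noteq> b" using \<rho> disj pos by (auto simp: \<rho>_def ends)
  have lipTb: "L-lipschitz_on {T..b} \<gamma>" using lip by (rule lipschitz_on_subset) (use aT in auto)
  have E_split: "energy F a b \<gamma> = G T + energy F T b \<gamma>"
    using energy_split[OF lip F, of a T b] aT by (simp add: G_def)
  \<comment> \<open>A curve that comes close to \<open>z\<close> before \<open>T\<close> travels between the wells twice: completing its two
    parts by short segments gives two competitors with a total energy of at least \<open>2 E0\<close>.\<close>
  have avoid: "r < norm (\<gamma> s - z)" if s: "a \<le> s" "s \<le> T" for s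
  proof (rule ccontr)
    assume "\<not> r < norm (\<gamma> s - z)"
    then have sz: "norm (\<gamma> s - z) \<le> r" by simp
    have lip1: "L-lipschitz_on {a..s} \<gamma>" using lip by (rule lipschitz_on_subset) (use s aT in auto)
    let ?s1 = "segment_curve (\<gamma> s) z s (s + 1)"
    have seg1: "(norm (z - \<gamma> s) / (s + 1 - s))-lipschitz_on {s..s+1} ?s1"
      by (rule segment_curve_lipschitz) simp
    have n1: "norm (z - \<gamma> s) \<le> r" using sz by (simp add: norm_minus_commute)
    have "energy F s (s + 1) ?s1 \<le> (C * r) * norm (z - \<gamma> s)"
    proof (rule energy_segment_curve_le[OF F])
      fix t assume "s \<le> t" "t \<le> s + 1"
      then have *: "norm (?s1 t - z) \<le> r" using norm_segment_curve(2)[of s t "s + 1" "\<gamma> s" z] n1 by simp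
      show "F (?s1 t) \<le> C * r" using near_z[OF *] * pos by (meson mult_left_mono less_imp_le order_trans)
    qed (use pos in auto)
    also have "\<dots> \<le> C * r * r" using n1 pos by (intro mult_left_mono) auto
    finally have 1: "energy F s (s + 1) ?s1 \<le> C * r\<^sup>2" by (simp add: power2_eq_square)
    have "joins w z a (s + 1) (\<lambda>t. if t \<le> s then \<gamma> t else ?s1 t)"
      using lipschitz_concat[OF lip1 seg1] s ends by (auto simp: joins_iff)
    from least[OF this] have E1: "E0 \<le> G s + C * r\<^sup>2"
      using energy_concat[OF lip1 seg1 s(1) _ _ F] 1 by (simp add: G_def)
    let ?s2 = "segment_curve w (\<gamma> T) (T - 1) T"
    have seg2: "(norm (\<gamma> T - w) / (T - (T - 1)))-lipschitz_on {T-1..T} ?s2"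
      by (rule segment_curve_lipschitz) simp
    have "energy F (T - 1) T ?s2 \<le> (C * r) * norm (\<gamma> T - w)"
    proof (rule energy_segment_curve_le[OF F])
      fix t assume "T - 1 \<le> t" "t \<le> T"
      then have *: "norm (?s2 t - w) \<le> r" using norm_segment_curve(1)[of "T - 1" t T w "\<gamma> T"] \<rho> by (simp add: \<rho>_def)
      show "F (?s2 t) \<le> C * r" using near_w(2)[OF *] * pos by (meson mult_left_mono less_imp_le order_trans)
    qed (use pos in auto)
    also have "\<dots> \<le> C * r * r" using \<rho> pos by (intro mult_left_mono) (auto simp: \<rho>_def)
    finally have 2: "energy F (T - 1) T ?s2 \<le> C * r\<^sup>2" by (simp add: power2_eq_square)
    have "joins w z (T - 1) b (\<lambda>t. if t \<le> T then ?s2 t else \<gamma> t)"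
      using lipschitz_concat[OF seg2 lipTb] aT Tb ends by (auto simp: joins_iff)
    from least[OF this] have E2: "E0 \<le> C * r\<^sup>2 + energy F T b \<gamma>"
      using energy_concat[OF seg2 lipTb _ aT(2) _ F] 2 by simp
    have "G T = G s + energy F s T \<gamma>"
      using energy_split[OF lip F, of a s T] s aT by (simp add: G_def)
    then have "G s \<le> G T" using energy_nonneg[of s T F \<gamma>] F0 by simp
    with E1 E2 E_split small show False by simp
  qed
  let ?seg = "segment_curve w (\<gamma> T) a T"
  have seg_end: "?seg T = \<gamma> T"
    by (rule segment_curve_end) (use aT ends in \<open>cases "a = T"; auto\<close>)
  have seg: "(norm (\<gamma> T - w) / (T - a))-lipschitz_on {a..T} ?seg"
    by (rule segment_curve_lipschitz[OF aT(1)])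
  have seg_near: "norm (?seg t - w) \<le> \<rho>" if "a \<le> t" "t \<le> T" for t
    using norm_segment_curve(1)[OF that, of w "\<gamma> T"] by (simp add: \<rho>_def)
  have lipaT: "L-lipschitz_on {a..T} \<gamma>" using lip by (rule lipschitz_on_subset) (use aT in auto)
  define \<eta> where "\<eta> t = (if t \<le> T then ?seg t else \<gamma> t)" for t
  have \<eta>J: "joins w z a b \<eta>"
    using lipschitz_concat[OF seg lipTb aT seg_end] ab aT Tb ends
    unfolding \<eta>_def[abs_def] by (auto simp: joins_iff)
  have \<eta>E: "energy \<phi> a b \<eta> = energy \<phi> a T ?seg + energy \<phi> T b \<gamma>" if "continuous_on UNIV \<phi>" for \<phi>
    unfolding \<eta>_def[abs_def] by (rule energy_concat[OF seg lipTb aT seg_end that])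
  have \<eta>A: "area a b \<eta> = area a T ?seg + area T b \<gamma>"
    unfolding \<eta>_def[abs_def] by (rule area_concat[OF seg lipTb aT seg_end])
  have segE: "energy F a T ?seg \<le> C * \<rho>\<^sup>2"
  proof -
    have "energy F a T ?seg \<le> (C * \<rho>) * norm (\<gamma> T - w)"
    proof (rule energy_segment_curve_le[OF F aT(1)])
      fix t assume t: "a \<le> t" "t \<le> T"
      have "F (?seg t) \<le> C * norm (?seg t - w)" using seg_near[OF t] \<rho> by (intro near_w) simp
      also have "\<dots> \<le> C * \<rho>" using seg_near[OF t] pos by (intro mult_left_mono) auto
      finally show "F (?seg t) \<le> C * \<rho>" .
    qed (use pos \<rho> in auto)
    then show ?thesis by (simp add: \<rho>_def power2_eq_square)
  qed
  have cn: "continuous_on UNIV (\<lambda>x. norm (x - w))" by (intro continuous_intros)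
  have segN: "energy (\<lambda>x. norm (x - w)) a T ?seg \<le> \<rho>\<^sup>2"
    using energy_segment_curve_le[OF cn aT(1), of w "\<gamma> T" \<rho>] seg_near \<rho> by (simp add: \<rho>_def power2_eq_square)
  have GN: "c' * energy (\<lambda>x. norm (x - w)) a T \<gamma> \<le> G T"
  proof -
    have "c' * energy (\<lambda>x. norm (x - w)) a T \<gamma> = energy (\<lambda>x. c' * norm (x - w)) a T \<gamma>"
      by (simp add: energy_velocity mult.assoc)
    also have "\<dots> \<le> energy F a T \<gamma>"
      using avoid aT by (intro energy_le[OF lip] F continuous_intros far bnd) auto
    finally show ?thesis by (simp add: G_def)
  qed
  define \<kappa> where "\<kappa> = min c' C / 2"
  have \<kappa>: "0 \<le> \<kappa>" "\<kappa> \<le> c' / 2" "\<kappa> \<le> C / 2" using pos by (auto simp: \<kappa>_def)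
  have gain: "energy F a b \<eta> + \<kappa> * \<bar>area a b \<eta> - area a b \<gamma>\<bar> \<le> energy F a b \<gamma> + \<delta>"
  proof -
    let ?N = "energy (\<lambda>x. norm (x - w)) a T \<gamma>"
    have "\<bar>area a T \<gamma> - broken_line_area w w (\<gamma> T)\<bar> \<le> ?N / 2"
      using area_minus_broken_line_area[OF lipaT aT(1), of w] by (simp add: ends)
    moreover have "\<bar>area a T ?seg - broken_line_area w w (\<gamma> T)\<bar> \<le> \<rho>\<^sup>2 / 2"
      using area_minus_broken_line_area[OF seg aT(1), of w] segN by (simp add: seg_end)
    moreover have "area a b \<gamma> = area a T \<gamma> + area T b \<gamma>"
      using area_split[OF lip, of a T b] aT by simp
    ultimately have "\<bar>area a b \<eta> - area a b \<gamma>\<bar> \<le> ?N / 2 + \<rho>\<^sup>2 / 2" using \<eta>A by linarith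
    then have "\<kappa> * \<bar>area a b \<eta> - area a b \<gamma>\<bar> \<le> \<kappa> * (?N / 2 + \<rho>\<^sup>2 / 2)" using \<kappa> by (intro mult_left_mono)
    also have "\<dots> = \<kappa> * ?N / 2 + \<kappa> * \<rho>\<^sup>2 / 2" by (simp add: algebra_simps)
    also have "\<dots> \<le> (c' / 2) * ?N / 2 + (C / 2) * \<rho>\<^sup>2 / 2"
      using \<kappa> energy_nonneg[of a T "\<lambda>x. norm (x - w)" \<gamma>]
      by (intro add_mono divide_right_mono mult_right_mono) auto
    finally have "\<kappa> * \<bar>area a b \<eta> - area a b \<gamma>\<bar> \<le> c' * ?N / 4 + C * \<rho>\<^sup>2 / 4" by simp
    moreover have "0 \<le> G T" unfolding G_def by (intro energy_nonneg F0)
    ultimately show ?thesis using GN segE \<rho>(3) E_split \<eta>E[OF F] \<delta> by simp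
  qed
  \<comment> \<open>By the maximality of \<open>T\<close>.\<close>
  have after: "G t + \<delta> \<le> (sqrt (2 * C))\<^sup>2 * (norm (\<gamma> t - w))\<^sup>2" if t: "T < t" "t < b" "norm (\<gamma> t - w) \<le> r" for t
  proof -
    have "t \<notin> ?S" using T(2)[of t] t(1) by auto
    then show ?thesis using t aT pos by auto
  qed
  have "energy (cutoff w r) T b \<gamma> \<le> 2 * r * sqrt (2 * C) / c * sqrt (energy F a b \<gamma> + \<delta>)"
    by (rule cutoff_energy_bound[OF lip F F0 aT _ pos(2) _ \<delta> near_w(1)])
      (use pos after in \<open>auto simp: G_def\<close>)
  moreover have "energy (cutoff w r) a T ?seg \<le> r\<^sup>2"
  proof -
    have "energy (cutoff w r) a T ?seg \<le> r * norm (\<gamma> T - w)"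
      using pos by (intro energy_segment_curve_le[OF _ aT(1)] cutoff_props) auto
    also have "\<dots> \<le> r * r" using \<rho> pos by (intro mult_left_mono) (auto simp: \<rho>_def)
    finally show ?thesis by (simp add: power2_eq_square)
  qed
  ultimately have len_w: "energy (cutoff w r) a b \<eta> \<le> r\<^sup>2 + 2 * r * sqrt (2 * C) / c * sqrt (energy F a b \<gamma> + \<delta>)"
    using \<eta>E[OF cutoff_props(1)] by simp
  have "energy (cutoff z r) a T ?seg \<le> 0 * norm (\<gamma> T - w)"
  proof (rule energy_segment_curve_le[OF cutoff_props(1) aT(1)])
    fix t assume t: "a \<le> t" "t \<le> T"
    have "norm (z - w) \<le> norm (?seg t - w) + norm (?seg t - z)"
      using norm_triangle_ineq4[of "?seg t - w" "?seg t - z"] by (simp add: algebra_simps)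
    then have "r \<le> norm (?seg t - z)" using seg_near[OF t] \<rho> disj by simp
    then show "cutoff z r (?seg t) \<le> 0" by (simp add: cutoff_props)
  qed simp
  then have len_z: "energy (cutoff z r) a b \<eta> \<le> energy (cutoff z r) a b \<gamma>"
    using \<eta>E[OF cutoff_props(1)] energy_split[OF lip cutoff_props(1), of a T b z r] aT
      energy_nonneg[of a T "cutoff z r" \<gamma>] cutoff_props(2) by simp
  show thesis using that[OF \<eta>J gain[unfolded \<kappa>_def] len_w len_z] .
qed

lemma positive_continuous_ge_on_compact:
  fixes f :: "'a::topological_space \<Rightarrow> real"
  assumes "compact K" "continuous_on K f" "\<And>x. x \<in> K \<Longrightarrow> 0 < f x"
  obtains m where "0 < m" "\<And>x. x \<in> K \<Longrightarrow> m \<le> f x"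
proof (cases "K = {}")
  case True then show thesis by (intro that[of 1]) auto
next
  case False
  then obtain x0 where "x0 \<in> K" "\<And>x. x \<in> K \<Longrightarrow> f x0 \<le> f x"
    using continuous_attains_inf[OF assms(1) _ assms(2)] by auto
  then show thesis using assms(3) by (intro that[of "f x0"]) auto
qed

text \<open>The ball around \<open>w\<close> is covered by the linear lower bound, and what remains of the region is compact and
  free of zeros.\<close>

lemma far_bound:
  fixes F :: "'a::euclidean_space \<Rightarrow> real"
  assumes F: "continuous_on UNIV F" and F0: "\<And>x. 0 \<le> F x" and zeros: "\<And>x. F x = 0 \<Longrightarrow> x = w \<or> x = z"
    and r: "0 < r" and c: "0 < c" and near: "\<And>x. norm (x - w) \<le> r \<Longrightarrow> c * norm (x - w) \<le> F x"
  obtains c' where "0 < c'" "\<And>x. norm x \<le> R \<Longrightarrow> r < norm (x - z) \<Longrightarrow> c' * norm (x - w) \<le> F x"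
proof -
  define K where "K = cball 0 R \<inter> {x. r \<le> norm (x - z)} \<inter> {x. r \<le> norm (x - w)}"
  have K: "compact K" unfolding K_def
    by (intro compact_Int_closed compact_cball closed_Collect_le continuous_intros)
  have posK: "0 < F x / (norm (x - w) + 1)" if "x \<in> K" for x
  proof -
    have "F x \<noteq> 0" using zeros[of x] that r by (auto simp: K_def)
    then have "0 < F x" using F0[of x] by simp
    moreover have "0 < norm (x - w) + 1" by (simp add: add_nonneg_pos)
    ultimately show ?thesis by (rule divide_pos_pos)
  qed
  have contK: "continuous_on K (\<lambda>x. F x / (norm (x - w) + 1))"
    by (intro continuous_intros continuous_on_subset[OF F]) (auto simp: add_nonneg_eq_0_iff)
  obtain m where m: "0 < m" "\<And>x. x \<in> K \<Longrightarrow> m \<le> F x / (norm (x - w) + 1)"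
    using positive_continuous_ge_on_compact[OF K contK posK] by blast
  show thesis
  proof (rule that[of "min c m"])
    show "0 < min c m" using c m by simp
    fix x assume x: "norm x \<le> R" "r < norm (x - z)"
    show "min c m * norm (x - w) \<le> F x"
    proof (cases "norm (x - w) \<le> r")
      case True
      have "min c m * norm (x - w) \<le> c * norm (x - w)" by (intro mult_right_mono) auto
      then show ?thesis using near[OF True] by simp
    next
      case False
      have pos: "0 < norm (x - w) + 1" by (simp add: add_nonneg_pos)
      have "m \<le> F x / (norm (x - w) + 1)" using x False by (intro m) (auto simp: K_def)
      then have "m * (norm (x - w) + 1) \<le> F x" using pos by (simp add: pos_le_divide_eq)
      moreover have "min c m * norm (x - w) \<le> m * (norm (x - w) + 1)" using m c by (intro mult_mono) auto
      ultimately show ?thesis by simp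
    qed
  qed
qed

text \<open>The initial piece is straightened, then that of the reversed curve. The second step does not
  increase the length near the first well, since the new segment stays outside the ball around it.\<close>

lemma straighten_both_ends:
  fixes F :: "real ^ 2 \<Rightarrow> real" and p q :: "real ^ 2"
  assumes F: "continuous_on UNIV F" and F0: "\<And>x. 0 \<le> F x"
    and pos: "0 < r" "0 < c" "0 < C" "0 < c'"
    and near_p: "\<And>x. norm (x - p) \<le> r \<Longrightarrow> c * norm (x - p) \<le> F x \<and> F x \<le> C * norm (x - p)"
    and near_q: "\<And>x. norm (x - q) \<le> r \<Longrightarrow> c * norm (x - q) \<le> F x \<and> F x \<le> C * norm (x - q)"
    and disj: "2 * r < norm (q - p)"
    and far_p: "\<And>x. norm x \<le> R \<Longrightarrow> r < norm (x - q) \<Longrightarrow> c' * norm (x - p) \<le> F x"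
    and far_q: "\<And>x. norm x \<le> R \<Longrightarrow> r < norm (x - p) \<Longrightarrow> c' * norm (x - q) \<le> F x"
    and least: "\<And>a b \<eta>. joins p q a b \<eta> \<Longrightarrow> E0 \<le> energy F a b \<eta>"
    and bnd: "\<And>a b \<eta> t. joins p q a b \<eta> \<Longrightarrow> energy F a b \<eta> \<le> E1 \<Longrightarrow> t \<in> {a..b} \<Longrightarrow> norm (\<eta> t) \<le> R"
    and E1: "E1 < 2 * E0 - 2 * C * r\<^sup>2"
    and J: "joins p q a b \<gamma>" and small: "energy F a b \<gamma> + 2 * \<delta> \<le> E1" and \<delta>: "0 < \<delta>"
  obtains \<eta> where "joins p q a b \<eta>"
    "energy F a b \<eta> + min c' C / 2 * \<bar>area a b \<eta> - area a b \<gamma>\<bar> \<le> energy F a b \<gamma> + 2 * \<delta>"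
    "energy (cutoff p r) a b \<eta> \<le> r\<^sup>2 + 2 * r * sqrt (2 * C) / c * sqrt E1"
    "energy (cutoff q r) a b \<eta> \<le> r\<^sup>2 + 2 * r * sqrt (2 * C) / c * sqrt E1"
proof -
  let ?X = "\<lambda>E. r\<^sup>2 + 2 * r * sqrt (2 * C) / c * sqrt E"
  have X: "?X E \<le> ?X E1" if "E \<le> E1" for E
    using that pos by (intro add_left_mono mult_left_mono) auto
  define \<kappa> where "\<kappa> = min c' C / 2"
  have \<kappa>: "0 \<le> \<kappa>" using pos by (simp add: \<kappa>_def)
  have refl: "(\<lambda>t. \<zeta> (a + b - (a + b - t))) = \<zeta>" for \<zeta> :: "real \<Rightarrow> real ^ 2" by simp
  have bnd1: "norm (\<gamma> t) \<le> R" if "t \<in> {a..b}" for t using small \<delta> by (intro bnd[OF J _ that]) simp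
  obtain \<gamma>1 where g1: "joins p q a b \<gamma>1"
    "energy F a b \<gamma>1 + min c' C / 2 * \<bar>area a b \<gamma>1 - area a b \<gamma>\<bar> \<le> energy F a b \<gamma> + \<delta>"
    "energy (cutoff p r) a b \<gamma>1 \<le> ?X (energy F a b \<gamma> + \<delta>)"
  proof (rule straighten_start[OF F F0 pos _ _ _ disj far_p least J bnd1 _ \<delta>])
    show "energy F a b \<gamma> < 2 * E0 - 2 * C * r\<^sup>2" using small \<delta> E1 by simp
  qed (use near_p near_q in auto)
  have E\<gamma>1: "energy F a b \<gamma>1 \<le> energy F a b \<gamma> + \<delta>"
    using g1(2) mult_nonneg_nonneg[OF \<kappa>, of "\<bar>area a b \<gamma>1 - area a b \<gamma>\<bar>"] unfolding \<kappa>_def by simp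
  define \<rho> where "\<rho> t = \<gamma>1 (a + b - t)" for t
  have \<rho>J: "joins q p a b \<rho>" and \<rho>E: "energy F a b \<rho> \<le> energy F a b \<gamma>1"
    and \<rho>p: "energy (cutoff p r) a b \<rho> \<le> energy (cutoff p r) a b \<gamma>1"
    and \<rho>A: "area a b \<rho> = - area a b \<gamma>1"
    unfolding \<rho>_def[abs_def]
    by (rule joins_reverse[OF g1(1)], rule energy_reverse_le[OF g1(1) F F0],
        rule energy_reverse_le[OF g1(1) cutoff_props(1,2)], rule area_reverse[OF g1(1)])
  have bnd2: "norm (\<rho> t) \<le> R" if "t \<in> {a..b}" for t
    unfolding \<rho>_def using E\<gamma>1 small \<delta> that by (intro bnd[OF g1(1)]) auto
  have least': "E0 \<le> energy F a' b' \<eta>" if "joins q p a' b' \<eta>" for a' b' \<eta>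
    using least[OF joins_reverse[OF that]] energy_reverse_le[OF that F F0] by simp
  have disj': "2 * r < norm (p - q)" using disj by (simp add: norm_minus_commute)
  obtain \<gamma>2 where g2: "joins q p a b \<gamma>2"
    "energy F a b \<gamma>2 + min c' C / 2 * \<bar>area a b \<gamma>2 - area a b \<rho>\<bar> \<le> energy F a b \<rho> + \<delta>"
    "energy (cutoff q r) a b \<gamma>2 \<le> ?X (energy F a b \<rho> + \<delta>)"
    "energy (cutoff p r) a b \<gamma>2 \<le> energy (cutoff p r) a b \<rho>"
  proof (rule straighten_start[OF F F0 pos _ _ _ disj' far_q least' \<rho>J bnd2 _ \<delta>])
    show "energy F a b \<rho> < 2 * E0 - 2 * C * r\<^sup>2" using \<rho>E E\<gamma>1 small \<delta> E1 by simp
  qed (use near_p near_q in auto)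
  define \<eta> where "\<eta> t = \<gamma>2 (a + b - t)" for t
  have \<eta>J: "joins p q a b \<eta>" and \<eta>E: "energy F a b \<eta> \<le> energy F a b \<gamma>2"
    and \<eta>p: "energy (cutoff p r) a b \<eta> \<le> energy (cutoff p r) a b \<gamma>2"
    and \<eta>q: "energy (cutoff q r) a b \<eta> \<le> energy (cutoff q r) a b \<gamma>2"
    and \<eta>A: "area a b \<eta> = - area a b \<gamma>2"
    unfolding \<eta>_def[abs_def]
    by (rule joins_reverse[OF g2(1)], rule energy_reverse_le[OF g2(1) F F0],
        rule energy_reverse_le[OF g2(1) cutoff_props(1,2)],
        rule energy_reverse_le[OF g2(1) cutoff_props(1,2)], rule area_reverse[OF g2(1)])
  show thesis
  proof (rule that[OF \<eta>J])
    have "\<bar>area a b \<eta> - area a b \<gamma>\<bar> \<le> \<bar>area a b \<gamma>2 - area a b \<rho>\<bar> + \<bar>area a b \<gamma>1 - area a b \<gamma>\<bar>"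
      using \<eta>A \<rho>A by linarith
    then have "\<kappa> * \<bar>area a b \<eta> - area a b \<gamma>\<bar> \<le> \<kappa> * \<bar>area a b \<gamma>2 - area a b \<rho>\<bar> + \<kappa> * \<bar>area a b \<gamma>1 - area a b \<gamma>\<bar>"
      using mult_left_mono[OF _ \<kappa>] by (metis distrib_left)
    then show "energy F a b \<eta> + min c' C / 2 * \<bar>area a b \<eta> - area a b \<gamma>\<bar> \<le> energy F a b \<gamma> + 2 * \<delta>"
      using g1(2) g2(2) \<rho>E \<eta>E unfolding \<kappa>_def[symmetric] by linarith
    show "energy (cutoff p r) a b \<eta> \<le> ?X E1"
      using \<eta>p g2(4) \<rho>p g1(3) X[of "energy F a b \<gamma> + \<delta>"] small \<delta> by linarith
    show "energy (cutoff q r) a b \<eta> \<le> ?X E1"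
      using \<eta>q g2(3) X[of "energy F a b \<rho> + \<delta>"] \<rho>E E\<gamma>1 small \<delta> by linarith
  qed
qed

text \<open>The sum of the three weights is positive everywhere, hence bounded below on the ball.\<close>

lemma length_le_weighted_energies:
  fixes F :: "real ^ 2 \<Rightarrow> real" and p q :: "real ^ 2"
  assumes F: "continuous_on UNIV F" and F0: "\<And>x. 0 \<le> F x" and zeros: "\<And>x. F x = 0 \<Longrightarrow> x = p \<or> x = q"
    and r: "0 < r"
  obtains K where "0 \<le> K"
    "\<And>a b \<gamma>. joins p q a b \<gamma> \<Longrightarrow> (\<And>t. t \<in> {a..b} \<Longrightarrow> norm (\<gamma> t) \<le> R) \<Longrightarrow>
      energy (\<lambda>_. 1) a b \<gamma> \<le> K * (energy (cutoff p r) a b \<gamma> + energy (cutoff q r) a b \<gamma> + energy F a b \<gamma>)"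
proof -
  let ?w = "\<lambda>x. cutoff p r x + cutoff q r x + F x"
  have w: "continuous_on UNIV ?w" by (intro continuous_intros cutoff_props F)
  have "0 < ?w x" for x
  proof -
    have "0 \<le> cutoff p r x" "0 \<le> cutoff q r x" "0 \<le> F x" by (auto simp: cutoff_props F0)
    moreover have "0 < cutoff p r x \<or> 0 < cutoff q r x \<or> 0 < F x"
      using zeros[of x] F0[of x] r by (auto simp: cutoff_def less_le)
    ultimately show ?thesis by linarith
  qed
  then obtain m where m: "0 < m" "\<And>x. x \<in> cball 0 R \<Longrightarrow> m \<le> ?w x"
    using positive_continuous_ge_on_compact[of "cball 0 R" ?w] continuous_on_subset[OF w] by auto
  show thesis
  proof (rule that[of "1 / m"])
    show "0 \<le> 1 / m" using m by simp
    fix a b and \<gamma> :: "real \<Rightarrow> real ^ 2"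
    assume J: "joins p q a b \<gamma>" and bnd: "\<And>t. t \<in> {a..b} \<Longrightarrow> norm (\<gamma> t) \<le> R"
    obtain L where lip: "L-lipschitz_on {a..b} \<gamma>" using J by (auto simp: joins_iff)
    have "m * energy (\<lambda>_. 1) a b \<gamma> = energy (\<lambda>_. m) a b \<gamma>" by (simp add: energy_velocity)
    also have "\<dots> \<le> energy ?w a b \<gamma>"
      using m bnd by (intro energy_le[OF lip] w) auto
    also have "\<dots> = energy (cutoff p r) a b \<gamma> + energy (cutoff q r) a b \<gamma> + energy F a b \<gamma>"
      unfolding energy_velocity distrib_right
      using energy_integrable[OF lip cutoff_props(1)[of p r], of a b]
        energy_integrable[OF lip cutoff_props(1)[of q r], of a b] energy_integrable[OF lip F, of a b]
      by (simp add: integral_add integrable_add)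
    finally show "energy (\<lambda>_. 1) a b \<gamma> \<le> 1 / m * (energy (cutoff p r) a b \<gamma> + energy (cutoff q r) a b \<gamma> + energy F a b \<gamma>)"
      using m(1) by (simp add: pos_le_divide_eq mult.commute)
  qed
qed

section \<open>Existence of constrained minimizers\<close>

theorem theorem5p3:
  fixes W F :: "real ^ 2 \<Rightarrow> real" and p_minus p_plus :: "real ^ 2"
    and \<gamma>0 :: "real \<Rightarrow> real ^ 2"
  assumes "smooth W"
    and "\<And>p. 0 \<le> W p"
    and "p_minus \<noteq> p_plus"
    and "{p. W p = 0} = {p_minus, p_plus}"
    and "positive_definite (hessian W p_minus)"
    and "positive_definite (hessian W p_plus)"
    and "Liminf at_infinity (\<lambda>p. ereal (W p)) > 0"
    and "F = (\<lambda>p. sqrt (W p))"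
    and "minimizing_geodesic F p_minus p_plus 0 1 \<gamma>0"
  shows "\<exists>\<epsilon>0>0. \<forall>A \<in> {area 0 1 \<gamma>0 - \<epsilon>0 <..< area 0 1 \<gamma>0 + \<epsilon>0}.
           \<exists>a b \<gamma>. joins p_minus p_plus a b \<gamma> \<and> area a b \<gamma> = A \<and>
             energy F a b \<gamma> = min_energy F p_minus p_plus A"
proof -
  define p where "p = p_minus"
  define q where "q = p_plus"
  note W = assms(1) and W0 = assms(2)
  have pq: "p \<noteq> q" using assms(3) by (simp add: p_def q_def)
  have zeros: "W x = 0 \<longleftrightarrow> x = p \<or> x = q" for x using assms(4) by (auto simp: p_def q_def)
  have Fdef: "F = (\<lambda>x. sqrt (W x))" by (rule assms(8))
  have F: "continuous_on UNIV F" unfolding Fdef by (intro continuous_intros smooth_continuous[OF W])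
  have F0: "0 \<le> F x" for x by (simp add: Fdef W0)
  have Fzeros: "F x = 0 \<Longrightarrow> x = p \<or> x = q" for x using zeros by (simp add: Fdef)
  define E0 where "E0 = energy F 0 1 \<gamma>0"
  have J0: "joins p q 0 1 \<gamma>0" and least: "\<And>a b \<eta>. joins p q a b \<eta> \<Longrightarrow> E0 \<le> energy F a b \<eta>"
    using assms(9) by (auto simp: minimizing_geodesic_def p_def q_def E0_def)
  \<comment> \<open>Since \<open>W\<close> is bounded away from zero at infinity, all curves that join the wells with an energy
    of at most \<open>E0 + 1\<close> lie in one ball.\<close>
  obtain c0 R0 where c0: "0 < c0" "\<And>x. R0 \<le> norm x \<Longrightarrow> c0 \<le> W x"
    using Liminf_at_infinity_pos_bound[OF assms(7)] by metis
  define R where "R = max R0 (norm p) + (E0 + 1) / sqrt c0"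
  have bnd: "norm (\<eta> t) \<le> R" if J: "joins p q a b \<eta>" and E: "energy F a b \<eta> \<le> E0 + 1" and t: "t \<in> {a..b}" for a b \<eta> t
  proof -
    obtain L where lip: "L-lipschitz_on {a..b} \<eta>" and "\<eta> a = p" using J by (auto simp: joins_iff)
    then have "norm (\<eta> t) \<le> max R0 (norm p) + energy F a b \<eta> / sqrt c0"
      using c0 t by (intro curve_stays_bounded[OF lip F F0]) (auto simp: Fdef)
    also have "\<dots> \<le> R" unfolding R_def using E c0(1) by (intro add_left_mono divide_right_mono) auto
    finally show ?thesis .
  qed
  obtain c M N where cMN: "0 < c" "0 \<le> M" "0 \<le> N"
    and shear: "\<And>a b \<gamma>. joins p q a b \<gamma> \<Longrightarrow> (\<And>\<tau>. \<tau> \<in> {a..b} \<Longrightarrow> norm (\<gamma> \<tau>) \<le> R) \<Longrightarrow>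
      0 < energy F a b \<gamma> \<and> (\<exists>\<Gamma>. (\<forall>t. \<bar>t\<bar> \<le> 1 \<longrightarrow> joins p q a b (\<Gamma> t) \<and> area a b (\<Gamma> t) = area a b \<gamma> + t * c \<and>
              energy (\<lambda>_. 1) a b (\<Gamma> t) \<le> N * energy (\<lambda>_. 1) a b \<gamma>) \<and>
          (\<forall>s t. - 1 \<le> t \<and> t \<le> 0 \<and> 0 \<le> s \<and> s \<le> 1 \<longrightarrow>
              s * energy F a b (\<Gamma> t) - t * energy F a b (\<Gamma> s) \<le> (s - t) * (1 - M * s * t) * energy F a b \<gamma>))"
    apply (rule shear_family[OF W W0 pq, of R, folded Fdef])
     apply (blast dest: zeros[THEN iffD1])
    subgoal premises s for c M N by (rule s(1)[of c M N]) (fact s)+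
    done
  have E0: "0 < E0"
    using shear[OF J0] bnd[OF J0] by (auto simp: E0_def)
  \<comment> \<open>The shear by \<open>t\<close> is compared with the shear by \<open>\<tau>\<close> to the other side, whose energy is at least
    \<open>E0\<close>. For a nearly minimizing curve the cost of a small change of area is thus of arbitrarily
    small rate: \<open>\<tau>\<close> is chosen first, then the energy excess is taken small compared to \<open>\<tau>\<close>.\<close>
  have cheap: "\<exists>\<eta>. joins p q a b \<eta> \<and> area a b \<eta> = area a b \<gamma> + t * c \<and>
        energy (\<lambda>_. 1) a b \<eta> \<le> N * energy (\<lambda>_. 1) a b \<gamma> \<and>
        energy F a b \<eta> \<le> energy F a b \<gamma> + \<bar>t\<bar> * ((energy F a b \<gamma> - E0) / \<tau> + 2 * M * \<tau> * (E0 + 1))"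
    if J: "joins p q a b \<gamma>" and E: "energy F a b \<gamma> \<le> E0 + 1" and \<tau>: "0 < \<tau>" "\<tau> \<le> 1" and t: "\<bar>t\<bar> \<le> \<tau>"
    for a b \<gamma> t \<tau>
  proof -
    let ?E = "energy F a b \<gamma>"
    obtain \<Gamma> where \<Gamma>: "\<And>t. \<bar>t\<bar> \<le> 1 \<Longrightarrow> joins p q a b (\<Gamma> t) \<and> area a b (\<Gamma> t) = area a b \<gamma> + t * c \<and>
              energy (\<lambda>_. 1) a b (\<Gamma> t) \<le> N * energy (\<lambda>_. 1) a b \<gamma>"
      and conc: "\<And>s t. - 1 \<le> t \<Longrightarrow> t \<le> 0 \<Longrightarrow> 0 \<le> s \<Longrightarrow> s \<le> 1 \<Longrightarrow>
              s * energy F a b (\<Gamma> t) - t * energy F a b (\<Gamma> s) \<le> (s - t) * (1 - M * s * t) * ?E"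
      using shear[OF J bnd[OF J E]] by auto
    have E0le: "E0 \<le> energy F a b (\<Gamma> t)" if "\<bar>t\<bar> \<le> 1" for t using least \<Gamma>[OF that] by blast
    define \<theta> where "\<theta> = \<bar>t\<bar>"
    have \<theta>: "0 \<le> \<theta>" "\<theta> \<le> \<tau>" using t by (auto simp: \<theta>_def)
    have main: "\<tau> * energy F a b (\<Gamma> t) \<le> (\<tau> + \<theta>) * (1 + M * \<tau> * \<theta>) * ?E - \<theta> * E0"
    proof (cases "t \<le> 0")
      case True
      have "\<theta> * E0 \<le> \<theta> * energy F a b (\<Gamma> \<tau>)" using \<theta> \<tau> by (intro mult_left_mono E0le) auto
      then show ?thesis using conc[of t \<tau>] True \<tau> t by (simp add: \<theta>_def)
    next
      case False
      then have \<theta>t: "\<theta> = t" by (simp add: \<theta>_def)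
      have "\<theta> * E0 \<le> \<theta> * energy F a b (\<Gamma> (- \<tau>))" using \<theta> \<tau> by (intro mult_left_mono E0le) auto
      moreover have "t * energy F a b (\<Gamma> (- \<tau>)) + \<tau> * energy F a b (\<Gamma> t) \<le> (\<tau> + t) * (1 + M * \<tau> * t) * ?E"
        using conc[of "- \<tau>" t] False \<tau> t by (simp add: algebra_simps)
      ultimately show ?thesis unfolding \<theta>t by linarith
    qed
    have "(\<tau> + \<theta>) * (M * \<tau> * \<theta>) * ?E \<le> (2 * \<tau>) * (M * \<tau> * \<theta>) * (E0 + 1)"
      using \<theta> \<tau> cMN E energy_nonneg[of a b F \<gamma>] F0 by (intro mult_mono) auto
    moreover have "\<tau> * (?E + \<theta> * ((?E - E0) / \<tau> + 2 * M * \<tau> * (E0 + 1)))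
        = \<tau> * ?E + \<theta> * (?E - E0) + (2 * \<tau>) * (M * \<tau> * \<theta>) * (E0 + 1)"
      using \<tau>(1) by (simp add: field_simps)
    moreover have "(\<tau> + \<theta>) * (1 + M * \<tau> * \<theta>) * ?E - \<theta> * E0
        = \<tau> * ?E + \<theta> * (?E - E0) + (\<tau> + \<theta>) * (M * \<tau> * \<theta>) * ?E"
      by (simp add: algebra_simps)
    ultimately have "\<tau> * energy F a b (\<Gamma> t) \<le> \<tau> * (?E + \<theta> * ((?E - E0) / \<tau> + 2 * M * \<tau> * (E0 + 1)))"
      using main by linarith
    then have "energy F a b (\<Gamma> t) \<le> ?E + \<theta> * ((?E - E0) / \<tau> + 2 * M * \<tau> * (E0 + 1))"
      using \<tau> by simp
    then show ?thesis using \<Gamma>[of t] \<tau> t by (intro exI[of _ "\<Gamma> t"]) (auto simp: \<theta>_def)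
  qed
  obtain r1 k1 C1 where w1: "0 < r1" "0 < k1" "0 < C1"
    "\<And>x. norm (x - p) \<le> r1 \<Longrightarrow> k1 * norm (x - p) \<le> F x \<and> F x \<le> C1 * norm (x - p)"
    using nondegenerate_zero_two_sided_bound[OF W W0, of p] zeros[of p] assms(5) unfolding Fdef p_def by auto
  obtain r2 k2 C2 where w2: "0 < r2" "0 < k2" "0 < C2"
    "\<And>x. norm (x - q) \<le> r2 \<Longrightarrow> k2 * norm (x - q) \<le> F x \<and> F x \<le> C2 * norm (x - q)"
    using nondegenerate_zero_two_sided_bound[OF W W0, of q] zeros[of q] assms(6) unfolding Fdef q_def by auto
  define k where "k = min k1 k2"
  define C where "C = max C1 C2"
  \<comment> \<open>The last bound on \<open>r\<close> makes the energy of two segments in the balls small compared to \<open>E0\<close>,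
    which prevents nearly minimizing curves from visiting the wells in the wrong order.\<close>
  define r where "r = min (min r1 r2) (min (norm (q - p) / 3) (sqrt (E0 / (4 * C))))"
  have C: "0 < C" and k: "0 < k" using w1 w2 by (auto simp: C_def k_def)
  have r: "0 < r" "r \<le> r1" "r \<le> r2" "2 * r < norm (q - p)" "2 * C * r\<^sup>2 \<le> E0 / 2"
  proof -
    have npq: "0 < norm (q - p)" using pq by simp
    show r0: "0 < r" using w1(1) w2(1) npq E0 C unfolding r_def by simp
    show "r \<le> r1" "r \<le> r2" by (auto simp: r_def)
    have "r \<le> norm (q - p) / 3" by (simp add: r_def)
    then show "2 * r < norm (q - p)" using npq by linarith
    have "r \<le> sqrt (E0 / (4 * C))" by (simp add: r_def)
    then have "r\<^sup>2 \<le> (sqrt (E0 / (4 * C)))\<^sup>2" using r0 by (intro power_mono) auto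
    then show "2 * C * r\<^sup>2 \<le> E0 / 2" using E0 C by (simp add: field_simps)
  qed
  have scale: "k * norm x \<le> k1 * norm x" "k * norm x \<le> k2 * norm x"
    "C1 * norm x \<le> C * norm x" "C2 * norm x \<le> C * norm x" for x :: "real ^ 2"
    by (auto simp: k_def C_def intro!: mult_right_mono)
  have near_p: "k * norm (x - p) \<le> F x \<and> F x \<le> C * norm (x - p)" if "norm (x - p) \<le> r" for x
    using w1(4)[of x] that r scale[of "x - p"] by linarith
  have near_q: "k * norm (x - q) \<le> F x \<and> F x \<le> C * norm (x - q)" if "norm (x - q) \<le> r" for x
    using w2(4)[of x] that r scale[of "x - q"] by linarith
  have Fzeros': "F x = 0 \<Longrightarrow> x = q \<or> x = p" for x using Fzeros by blast
  obtain d1 where d1: "0 < d1" "\<And>x. norm x \<le> R \<Longrightarrow> r < norm (x - q) \<Longrightarrow> d1 * norm (x - p) \<le> F x"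
    using far_bound[where R=R, OF F F0 Fzeros r(1) k] near_p by metis
  obtain d2 where d2: "0 < d2" "\<And>x. norm x \<le> R \<Longrightarrow> r < norm (x - p) \<Longrightarrow> d2 * norm (x - q) \<le> F x"
    using far_bound[where R=R, OF F F0 Fzeros' r(1) k] near_q by metis
  define d where "d = min d1 d2"
  have d: "0 < d" using d1 d2 by (simp add: d_def)
  have dscale: "d * norm x \<le> d1 * norm x" "d * norm x \<le> d2 * norm x" for x :: "real ^ 2"
    by (auto simp: d_def intro!: mult_right_mono)
  have far_p: "d * norm (x - p) \<le> F x" if "norm x \<le> R" "r < norm (x - q)" for x
    using d1(2)[OF that] dscale(1)[of "x - p"] by linarith
  have far_q: "d * norm (x - q) \<le> F x" if "norm x \<le> R" "r < norm (x - p)" for x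
    using d2(2)[OF that] dscale(2)[of "x - q"] by linarith
  define \<kappa> where "\<kappa> = min d C / 2"
  have \<kappa>: "0 < \<kappa>" using d C by (simp add: \<kappa>_def)
  \<comment> \<open>The rate \<open>\<kappa>\<close> is the energy saved by straightening per unit of changed area. Half of the permitted
    cost \<open>\<kappa> c\<close> of a shear per unit of \<open>t\<close> is left to the term with \<open>\<tau>\<close>, half to the energy excess.\<close>
  define \<tau> where "\<tau> = min 1 (\<kappa> * c / (4 * M * (E0 + 1) + 1))"
  have den: "0 < 4 * M * (E0 + 1) + 1" using cMN(2) E0 by (simp add: add_nonneg_pos)
  have \<tau>: "0 < \<tau>" "\<tau> \<le> 1" using \<kappa> cMN(1) den by (auto simp: \<tau>_def)
  have \<tau>2: "2 * M * \<tau> * (E0 + 1) \<le> \<kappa> * c / 2"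
  proof -
    have "\<tau> * (4 * M * (E0 + 1) + 1) \<le> \<kappa> * c"
      using den by (simp add: \<tau>_def pos_le_divide_eq[symmetric])
    then show ?thesis using \<tau> by (simp add: algebra_simps)
  qed
  define \<epsilon> where "\<epsilon> = min 1 (min (E0 / 4) (\<kappa> * c * \<tau> / 2))"
  have \<epsilon>: "0 < \<epsilon>" "\<epsilon> \<le> 1" "\<epsilon> \<le> E0 / 4" "\<epsilon> \<le> \<kappa> * c * \<tau> / 2" using E0 \<kappa> cMN(1) \<tau> by (auto simp: \<epsilon>_def)
  have correct: "\<exists>\<eta>. joins p q a b \<eta> \<and> area a b \<eta> = A \<and>
        energy (\<lambda>_. 1) a b \<eta> \<le> N * energy (\<lambda>_. 1) a b \<gamma> \<and>
        energy F a b \<eta> \<le> energy F a b \<gamma> + \<kappa> * \<bar>A - area a b \<gamma>\<bar>"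
    if J: "joins p q a b \<gamma>" and E: "energy F a b \<gamma> \<le> E0 + \<epsilon>" and A: "\<bar>A - area a b \<gamma>\<bar> \<le> c * \<tau>" for a b \<gamma> A
  proof -
    define t where "t = (A - area a b \<gamma>) / c"
    have t: "\<bar>t\<bar> \<le> \<tau>" using A cMN(1) by (simp add: t_def abs_divide pos_divide_le_eq mult.commute)
    have "(energy F a b \<gamma> - E0) / \<tau> \<le> \<kappa> * c / 2"
      using E \<epsilon>(4) \<tau>(1) by (simp add: pos_divide_le_eq)
    then have "(energy F a b \<gamma> - E0) / \<tau> + 2 * M * \<tau> * (E0 + 1) \<le> \<kappa> * c"
      using \<tau>2 by linarith
    then have "\<bar>t\<bar> * ((energy F a b \<gamma> - E0) / \<tau> + 2 * M * \<tau> * (E0 + 1)) \<le> \<bar>t\<bar> * (\<kappa> * c)"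
      by (intro mult_left_mono) auto
    also have "\<dots> = \<kappa> * \<bar>A - area a b \<gamma>\<bar>" using cMN(1) by (simp add: t_def abs_divide)
    finally have le: "\<bar>t\<bar> * ((energy F a b \<gamma> - E0) / \<tau> + 2 * M * \<tau> * (E0 + 1)) \<le> \<kappa> * \<bar>A - area a b \<gamma>\<bar>" .
    have "area a b \<gamma> + t * c = A" using cMN(1) by (simp add: t_def)
    then show ?thesis using cheap[OF J _ \<tau> t] E \<epsilon>(2) le by fastforce
  qed
  obtain K where K: "0 \<le> K" "\<And>a b \<gamma>. joins p q a b \<gamma> \<Longrightarrow> (\<And>t. t \<in> {a..b} \<Longrightarrow> norm (\<gamma> t) \<le> R) \<Longrightarrow>
      energy (\<lambda>_. 1) a b \<gamma> \<le> K * (energy (cutoff p r) a b \<gamma> + energy (cutoff q r) a b \<gamma> + energy F a b \<gamma>)"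
    using length_le_weighted_energies[OF F F0 Fzeros r(1), of R] by metis
  define X where "X = r\<^sup>2 + 2 * r * sqrt (2 * C) / k * sqrt (E0 + \<epsilon>)"
  define \<Lambda> where "\<Lambda> = N * (K * (X + X + (E0 + \<epsilon>)))"
  \<comment> \<open>Straightening saves at least \<open>\<kappa>\<close> times the change of area (up to \<open>2 \<delta>\<close>), and the shear
    undoes this change for no more than the same price.\<close>
  have improve: "\<exists>\<eta>. joins p q a b \<eta> \<and> area a b \<eta> = area a b \<gamma> \<and> energy (\<lambda>_. 1) a b \<eta> \<le> \<Lambda> \<and>
       energy F a b \<eta> \<le> energy F a b \<gamma> + 2 * \<delta>"
    if J: "joins p q a b \<gamma>" and small: "energy F a b \<gamma> + 2 * \<delta> \<le> E0 + \<epsilon>" and \<delta>: "0 < \<delta>" for a b \<gamma> \<delta>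
  proof -
    obtain \<beta> where \<beta>: "joins p q a b \<beta>"
      "energy F a b \<beta> + min d C / 2 * \<bar>area a b \<beta> - area a b \<gamma>\<bar> \<le> energy F a b \<gamma> + 2 * \<delta>"
      "energy (cutoff p r) a b \<beta> \<le> r\<^sup>2 + 2 * r * sqrt (2 * C) / k * sqrt (E0 + \<epsilon>)"
      "energy (cutoff q r) a b \<beta> \<le> r\<^sup>2 + 2 * r * sqrt (2 * C) / k * sqrt (E0 + \<epsilon>)"
    proof (rule straighten_both_ends[OF F F0 r(1) k C d near_p near_q r(4) far_p far_q least _ _ J small \<delta>])
      show "norm (\<eta> t) \<le> R" if "joins p q a b \<eta>" "energy F a b \<eta> \<le> E0 + \<epsilon>" "t \<in> {a..b}" for a b \<eta> t
        using that \<epsilon>(2) by (intro bnd) auto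
      show "E0 + \<epsilon> < 2 * E0 - 2 * C * r\<^sup>2" using r(5) \<epsilon>(3) E0 by simp
    qed auto
    let ?D = "\<bar>area a b \<gamma> - area a b \<beta>\<bar>"
    have gain: "energy F a b \<beta> + \<kappa> * ?D \<le> energy F a b \<gamma> + 2 * \<delta>"
      using \<beta>(2) by (simp add: \<kappa>_def abs_minus_commute)
    have D0: "0 \<le> \<kappa> * ?D" using \<kappa> by simp
    have E\<beta>: "energy F a b \<beta> \<le> E0 + \<epsilon>" using gain small D0 by linarith
    have "\<kappa> * ?D \<le> \<epsilon>" using gain small least[OF \<beta>(1)] by linarith
    also have "\<epsilon> \<le> \<kappa> * (c * \<tau>)" using \<epsilon>(1,4) by simp
    finally have "?D \<le> c * \<tau>" using \<kappa> by simp
    from correct[OF \<beta>(1) E\<beta> this] obtain \<eta> where \<eta>: "joins p q a b \<eta>" "area a b \<eta> = area a b \<gamma>"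
        "energy (\<lambda>_. 1) a b \<eta> \<le> N * energy (\<lambda>_. 1) a b \<beta>" "energy F a b \<eta> \<le> energy F a b \<beta> + \<kappa> * ?D"
      by blast
    have "energy (\<lambda>_. 1) a b \<beta> \<le> K * (energy (cutoff p r) a b \<beta> + energy (cutoff q r) a b \<beta> + energy F a b \<beta>)"
      using E\<beta> \<epsilon>(2) by (intro K(2) \<beta>(1) bnd[OF \<beta>(1)]) auto
    also have "\<dots> \<le> K * (X + X + (E0 + \<epsilon>))"
      using \<beta>(3,4) E\<beta> by (intro mult_left_mono add_mono K(1)) (auto simp: X_def)
    finally have "N * energy (\<lambda>_. 1) a b \<beta> \<le> \<Lambda>" unfolding \<Lambda>_def by (rule mult_left_mono[OF _ cMN(3)])
    then show ?thesis using \<eta> gain by (intro exI[of _ \<eta>]) auto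
  qed
  have exists: "\<exists>a b \<gamma>. joins p q a b \<gamma> \<and> area a b \<gamma> = A \<and> energy F a b \<gamma> = min_energy F p q A"
    if A: "\<bar>A - area 0 1 \<gamma>0\<bar> < min (c * \<tau>) (\<epsilon> / \<kappa>)" for A
  proof -
    define Z where "Z = {energy F a b \<gamma> | a b \<gamma>. joins p q a b \<gamma> \<and> area a b \<gamma> = A}"
    define m where "m = min_energy F p q A"
    have m: "m = Inf Z" by (simp add: m_def min_energy_def Z_def)
    have bdd: "bdd_below Z" unfolding Z_def bdd_below_def by (rule exI[of _ 0]) (auto intro!: energy_nonneg F0)
    obtain \<eta>0 where \<eta>0: "joins p q 0 1 \<eta>0" "area 0 1 \<eta>0 = A" "energy F 0 1 \<eta>0 \<le> E0 + \<kappa> * \<bar>A - area 0 1 \<gamma>0\<bar>"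
      using correct[OF J0, of A] A \<epsilon>(1) by (auto simp: E0_def)
    have "\<kappa> * \<bar>A - area 0 1 \<gamma>0\<bar> < \<epsilon>" using A \<kappa> by (simp add: pos_less_divide_eq mult.commute)
    moreover have in_Z: "energy F 0 1 \<eta>0 \<in> Z" using \<eta>0 unfolding Z_def by blast
    then have "m \<le> energy F 0 1 \<eta>0" unfolding m by (rule cInf_lower[OF _ bdd])
    ultimately have mlt: "m < E0 + \<epsilon>" using \<eta>0(3) by linarith
    \<comment> \<open>The factor \<open>3\<close> leaves room for one \<open>\<delta>\<close> in the choice of a nearly optimal curve and two in its
      improvement.\<close>
    define \<delta> where "\<delta> n = (E0 + \<epsilon> - m) / 3 * inverse (real (Suc n))" for n
    have \<delta>: "0 < \<delta> n" "3 * \<delta> n \<le> E0 + \<epsilon> - m" for n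
    proof -
      show "0 < \<delta> n" using mlt by (simp add: \<delta>_def)
      have "inverse (real (Suc n)) \<le> 1" by (simp add: inverse_le_1_iff)
      then have "(E0 + \<epsilon> - m) * inverse (real (Suc n)) \<le> E0 + \<epsilon> - m"
        using mlt by (intro mult_left_le) auto
      then show "3 * \<delta> n \<le> E0 + \<epsilon> - m" by (simp add: \<delta>_def)
    qed
    have "\<exists>a b \<eta>. joins p q a b \<eta> \<and> area a b \<eta> = A \<and> energy (\<lambda>_. 1) a b \<eta> \<le> \<Lambda> \<and> energy F a b \<eta> \<le> m + 3 * \<delta> n" for n
    proof -
      have "Inf Z < m + \<delta> n" using \<delta>(1)[of n] by (simp add: m)
      then obtain a b \<gamma> where g: "joins p q a b \<gamma>" "area a b \<gamma> = A" "energy F a b \<gamma> < m + \<delta> n"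
        using cInf_lessD[of Z "m + \<delta> n"] in_Z unfolding Z_def by blast
      have "energy F a b \<gamma> + 2 * \<delta> n \<le> E0 + \<epsilon>" using g(3) \<delta>(2)[of n] by linarith
      from improve[OF g(1) this \<delta>(1)] obtain \<eta> where "joins p q a b \<eta>" "area a b \<eta> = area a b \<gamma>"
        "energy (\<lambda>_. 1) a b \<eta> \<le> \<Lambda>" "energy F a b \<eta> \<le> energy F a b \<gamma> + 2 * \<delta> n" by blast
      then show ?thesis using g by (intro exI[of _ a] exI[of _ b] exI[of _ \<eta>]) auto
    qed
    then obtain a b \<eta> where \<eta>: "\<And>n. joins p q (a n) (b n) (\<eta> n)" "\<And>n. area (a n) (b n) (\<eta> n) = A"
      "\<And>n. energy (\<lambda>_. 1) (a n) (b n) (\<eta> n) \<le> \<Lambda>" "\<And>n. energy F (a n) (b n) (\<eta> n) \<le> m + 3 * \<delta> n"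
      by metis
    have "(\<lambda>n. m + (E0 + \<epsilon> - m) * inverse (real (Suc n))) \<longlonglongrightarrow> m + (E0 + \<epsilon> - m) * 0"
      by (intro tendsto_intros LIMSEQ_inverse_real_of_nat)
    then have lim: "(\<lambda>n. m + 3 * \<delta> n) \<longlonglongrightarrow> m" by (simp add: \<delta>_def)
    from bounded_length_curves_limit[OF pq F F0 \<eta>(1,3,4) lim \<eta>(2)]
    obtain \<zeta> where \<zeta>: "joins p q 0 1 \<zeta>" "area 0 1 \<zeta> = A" "energy F 0 1 \<zeta> \<le> m" by blast
    have "energy F 0 1 \<zeta> \<in> Z" using \<zeta> unfolding Z_def by blast
    then have "m \<le> energy F 0 1 \<zeta>" unfolding m by (rule cInf_lower[OF _ bdd])
    then show ?thesis using \<zeta> by (intro exI[of _ 0] exI[of _ 1] exI[of _ \<zeta>]) (auto simp: m_def)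
  qed
  show ?thesis
  proof (rule exI[of _ "min (c * \<tau>) (\<epsilon> / \<kappa>)"], rule conjI, rule_tac[2] ballI)
    show "0 < min (c * \<tau>) (\<epsilon> / \<kappa>)" using cMN(1) \<tau> \<epsilon> \<kappa> by simp
    fix A assume "A \<in> {area 0 1 \<gamma>0 - min (c * \<tau>) (\<epsilon> / \<kappa>) <..< area 0 1 \<gamma>0 + min (c * \<tau>) (\<epsilon> / \<kappa>)}"
    then have "\<bar>A - area 0 1 \<gamma>0\<bar> < min (c * \<tau>) (\<epsilon> / \<kappa>)"
      unfolding greaterThanLessThan_iff by linarith
    from exists[OF this]
    show "\<exists>a b \<gamma>. joins p_minus p_plus a b \<gamma> \<and> area a b \<gamma> = A \<and> energy F a b \<gamma> = min_energy F p_minus p_plus A"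
      unfolding p_def q_def .
  qed
qed

end
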